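(* Let $K$ be any quadratic field. Let $G$ be any of the following fifteen groups: $\mathbb{Z}/n\mathbb{Z}$ with $n\in\{1,2,3,4,5,6,7,8,9,10,12\}$, or $\mathbb{Z}/2\mathbb{Z}\oplus\mathbb{Z}/2n\mathbb{Z}$ with $n\in\{1,2,3,4\}$. Then $G$ appears as a torsion group over $K$, i.e. there exists an elliptic curve $E$ defined over $K$ such that $E(K)_{tors}\cong G$.
   Context: A quadratic field is a field extension of $\mathbb{Q}$ of degree $2$. For an elliptic curve $E$ over a number field $K$, $E(K)_{tors}$ denotes the torsion subgroup of the finitely generated abelian group $E(K)$ of $K$-rational points. The fifteen groups listed are those in Mazur's theorem, i.e. the torsion subgroups of elliptic curves over $\mathbb{Q}$. *)

theory Defs
  imports Complex_Main "HOL-Algebra.Elementary_Groups"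
begin

section \<open>Quadratic fields\<close>

text \<open>A field of characteristic 0 is a vector space over the rationals through the unique embedding
  \<^term>\<open>of_rat\<close>.  Since \<^const>\<open>vector_space.dim\<close> is 0 for infinite-dimensional spaces,
  dimension 2 includes finite-dimensionality.\<close>

definition rat_scale :: "rat \<Rightarrow> 'k::field_char_0 \<Rightarrow> 'k" where
  "rat_scale q x = of_rat q * x"

lemma vector_space_rat_scale: "vector_space rat_scale"
  by unfold_locales (simp_all add: rat_scale_def algebra_simps of_rat_add of_rat_mult)

definition quadratic_field :: "'k::field_char_0 itself \<Rightarrow> bool" where
  "quadratic_field _ \<longleftrightarrow> vector_space.dim rat_scale (UNIV :: 'k set) = 2"


section \<open>Elliptic curves in Weierstrass form\<close>

text \<open>\<open>Weierstrass a1 a2 a3 a4 a6\<close> is the projective closure of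
  \<open>y^2 + a1 x y + a3 y = x^3 + a2 x^2 + a4 x + a6\<close>.\<close>

datatype 'k weierstrass =
  Weierstrass (coeff_a1: 'k) (coeff_a2: 'k) (coeff_a3: 'k) (coeff_a4: 'k) (coeff_a6: 'k)

fun discriminant :: "'k::field weierstrass \<Rightarrow> 'k" where
  "discriminant (Weierstrass a1 a2 a3 a4 a6) =
    (let b2 = a1^2 + 4 * a2;
         b4 = 2 * a4 + a1 * a3;
         b6 = a3^2 + 4 * a6;
         b8 = a1^2 * a6 + 4 * a2 * a6 - a1 * a3 * a4 + a2 * a3^2 - a4^2
     in - (b2^2 * b8) - 8 * b4^3 - 27 * b6^2 + 9 * b2 * b4 * b6)"

text \<open>The curve is smooth iff its discriminant does not vanish.\<close>

definition elliptic_curve :: "'k::field weierstrass \<Rightarrow> bool" where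
  "elliptic_curve E \<longleftrightarrow> discriminant E \<noteq> 0"

datatype 'k ec_point = Point_At_Infinity | Affine 'k 'k

fun on_curve :: "'k::field weierstrass \<Rightarrow> 'k ec_point \<Rightarrow> bool" where
  "on_curve E Point_At_Infinity \<longleftrightarrow> True"
| "on_curve (Weierstrass a1 a2 a3 a4 a6) (Affine x y) \<longleftrightarrow>
    y^2 + a1 * x * y + a3 * y = x^3 + a2 * x^2 + a4 * x + a6"

text \<open>The chord-tangent law: \<open>l\<close> is the slope of the line through the two points (of the tangent if
  they coincide).  If the \<open>x\<close>-coordinates agree and the points are not mutually inverse, then they
  are equal and the denominator of the tangent slope is nonzero.\<close>

fun ec_add :: "'k::field weierstrass \<Rightarrow> 'k ec_point \<Rightarrow> 'k ec_point \<Rightarrow> 'k ec_point" where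
  "ec_add E Point_At_Infinity Q = Q"
| "ec_add E P Point_At_Infinity = P"
| "ec_add (Weierstrass a1 a2 a3 a4 a6) (Affine x1 y1) (Affine x2 y2) =
    (if x1 = x2 \<and> y1 + y2 + a1 * x1 + a3 = 0 then Point_At_Infinity
     else
       let l = (if x1 = x2
                then (3 * x1^2 + 2 * a2 * x1 + a4 - a1 * y1) / (2 * y1 + a1 * x1 + a3)
                else (y2 - y1) / (x2 - x1));
           x3 = l^2 + a1 * l - a2 - x1 - x2
       in Affine x3 (- (l * (x3 - x1) + y1) - a1 * x3 - a3))"

text \<open>\<open>E(K)\<close>, with the group law written multiplicatively as usual for \<^typ>\<open>'a monoid\<close>.\<close>

definition ec_group :: "'k::field weierstrass \<Rightarrow> 'k ec_point monoid" where
  "ec_group E = \<lparr>carrier = {P. on_curve E P}, monoid.mult = ec_add E, one = Point_At_Infinity\<rparr>"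


section \<open>Torsion subgroups\<close>

definition torsion_subgroup :: "('a, 'b) monoid_scheme \<Rightarrow> ('a, 'b) monoid_scheme" where
  "torsion_subgroup G =
    G\<lparr>carrier := {x \<in> carrier G. \<exists>n::nat. n > 0 \<and> x [^]\<^bsub>G\<^esub> n = \<one>\<^bsub>G\<^esub>}\<rparr>"

definition appears_as_torsion_group :: "'k::field itself \<Rightarrow> ('g, 'h) monoid_scheme \<Rightarrow> bool" where
  "appears_as_torsion_group _ G \<longleftrightarrow>
    (\<exists>E :: 'k weierstrass. elliptic_curve E \<and> torsion_subgroup (ec_group E) \<cong> G)"

end

(*
Each group is the torsion group of an explicit curve y^2 = x^3 + a x^2 + b x + c over the integers, with visible
generators of the right order; what has to be shown is that no further torsion appears over K.

Torsion of order prime to p, where p is 2 or 3, is controlled by a valuation v of K above p, which exists by Zorn's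
lemma.  Multiplication by p permutes the multiples of such a point, and it is an explicit rational function of x that
strictly lowers v(x) when v(x) < 0 (suitably scaled), so these points are integral.  Two of them with the
same residue are equal up to sign, because otherwise the formula for x(P + R) + x(P - R) makes one of P + R and P - R
non-integral.  The residue field has at most p^2 elements, which leaves only the known points.

The p-primary torsion is finished by checking that the p-torsion points are known and that the generators are not
divisible by p.  For p = 2 this says that certain integers, differences of x-coordinates and a discriminant, are not
squares in K.  If r, s and r s are not squares of integers, then r or s is not a square in the quadratic field K;
hence for each group one of at most two curves works, whatever K is.
*)

theory Submission
  imports Defs "HOL-Computational_Algebra.Primes" "HOL-Algebra.Multiplicative_Group"
begin

section \<open>Quadratic fields\<close>

text \<open>Nothing is known about how p behaves in K, so every argument has to cover split, inert
  and ramified p at once. This is why valuations are normalised by v(p) = 2 and why residues are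
  only known to lie in a subfield of the field with p^2 elements. The arithmetic of K enters through
  one fact: any three elements satisfy an integer linear relation. For 1, x, x^2 it yields the
  valuation and the residue field; for 1 and two square roots it limits which integers become
  squares; it also shows that a monic integer cubic with a root in K has an integer root, so cubic
  obstructions persist in every quadratic field. Square obstructions may vanish over a particular K,
  which is what forces a choice of curves. Torsion is split at p because the kernel of reduction has
  no torsion of order prime to p, whereas torsion of p-power order can hide there, in particular if
  p ramifies. That part is therefore treated by explicit 2- or 3-torsion and divisibility, not by
  reduction.\<close>

lemma quadratic_field_dependent:
  fixes x y z :: "'k::field_char_0"
  assumes "quadratic_field TYPE('k)"
  obtains a b c :: int where "a \<noteq> 0 \<or> b \<noteq> 0 \<or> c \<noteq> 0"
    and "of_int a * x + of_int b * y + of_int c * z = 0"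
proof -
  interpret vector_space "rat_scale :: rat \<Rightarrow> 'k \<Rightarrow> 'k" by (rule vector_space_rat_scale)
  have "\<exists>p q r :: rat. (p \<noteq> 0 \<or> q \<noteq> 0 \<or> r \<noteq> 0) \<and> of_rat p * x + of_rat q * y + of_rat r * z = 0"
  \<comment> \<open>The set {x, y, z} forgets repetitions, so linear dependence of the set says
    nothing when two of the elements coincide.\<close>
  proof (cases "x = y \<or> x = z \<or> y = z")
    case True
    then consider "x = y" | "x = z" | "y = z" by blast
    then show ?thesis
    proof cases
      case 1 then show ?thesis
        by (intro exI[of _ 1] exI[of _ "-1"] exI[of _ 0]) (simp add: of_rat_minus)
    next
      case 2 then show ?thesis
        by (rule_tac exI[of _ 1], rule_tac exI[of _ 0], rule_tac exI[of _ "-1"]) (simp add: of_rat_minus)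
    next
      case 3 then show ?thesis
        by (rule_tac exI[of _ 0], rule_tac exI[of _ 1], rule_tac exI[of _ "-1"]) (simp add: of_rat_minus)
    qed
  next
    case False
    obtain B :: "'k set" where B: "UNIV \<subseteq> span B" "card B = dim (UNIV :: 'k set)"
      using basis_exists[of UNIV] by metis
    have "card B = 2" using B assms by (simp add: quadratic_field_def)
    then have "finite B" by (metis card.infinite zero_neq_numeral)
    have "dependent {x, y, z}"
    proof (rule ccontr)
      assume "independent {x, y, z}"
      with \<open>finite B\<close> B(1) have "card {x, y, z} \<le> card B"
        using independent_span_bound by blast
      then show False using False \<open>card B = 2\<close> by simp
    qed
    then obtain u where u: "\<exists>v\<in>{x, y, z}. u v \<noteq> 0" "(\<Sum>v\<in>{x, y, z}. rat_scale (u v) v) = 0"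
      using dependent_finite[of "{x, y, z}"] by auto
    then show ?thesis using False
      by (intro exI[of _ "u x"] exI[of _ "u y"] exI[of _ "u z"]) (auto simp: rat_scale_def add.assoc)
  qed
  then obtain p q r :: rat where pqr: "p \<noteq> 0 \<or> q \<noteq> 0 \<or> r \<noteq> 0"
    "of_rat p * x + of_rat q * y + of_rat r * z = 0" by blast
  have frac: "\<exists>m n. t = of_int m / of_int n \<and> n > 0" for t :: rat
    by (cases t) (auto simp: Fract_of_int_quotient)
  obtain p1 p2 where p: "p = of_int p1 / of_int p2" "p2 > 0" using frac by blast
  obtain q1 q2 where q: "q = of_int q1 / of_int q2" "q2 > 0" using frac by blast
  obtain r1 r2 where r: "r = of_int r1 / of_int r2" "r2 > 0" using frac by blast
  note e = p(1) q(1) r(1) p(2) q(2) r(2)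
  have "of_int (p1*q2*r2) * x + of_int (q1*p2*r2) * y + of_int (r1*p2*q2) * z
      = of_int (p2*q2*r2) * (of_rat p * x + of_rat q * y + of_rat r * z)"
    using e(4-6) by (simp add: e(1-3) of_rat_divide field_simps)
  with pqr e have "of_int (p1*q2*r2) * x + of_int (q1*p2*r2) * y + of_int (r1*p2*q2) * z = 0"
    "p1*q2*r2 \<noteq> 0 \<or> q1*p2*r2 \<noteq> 0 \<or> r1*p2*q2 \<noteq> 0" by auto
  then show thesis using that by blast
qed

text \<open>Coprime coefficients keep the relation nontrivial modulo every prime: for each p one of
  them is a p-adic unit.\<close>

lemma quadratic_field_coprime_relation:
  fixes x y z :: "'k::field_char_0"
  assumes "quadratic_field TYPE('k)"
  obtains a b c :: int where "gcd a (gcd b c) = 1"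
    and "of_int a * x + of_int b * y + of_int c * z = 0"
proof -
  obtain a b c :: int where nz: "a \<noteq> 0 \<or> b \<noteq> 0 \<or> c \<noteq> 0"
    and eq: "of_int a * x + of_int b * y + of_int c * z = 0"
    using quadratic_field_dependent[OF assms] by metis
  define g where "g = gcd a (gcd b c)"
  have g: "g \<noteq> 0" using nz by (auto simp: g_def)
  obtain a' b' c' where e: "a = g * a'" "b = g * b'" "c = g * c'"
    unfolding g_def by (metis dvdE dvd_trans gcd_dvd1 gcd_dvd2)
  have "g = \<bar>g\<bar> * gcd a' (gcd b' c')"
    using gcd_mult_distrib_int[of g b' c'] gcd_mult_distrib_int[of g a' "gcd b' c'"] g_def e
    by (metis abs_gcd_int abs_of_nonneg gcd_ge_0_int)
  moreover have "\<bar>g\<bar> = g" by (simp add: g_def)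
  ultimately have "gcd a' (gcd b' c') = 1" using g by simp
  moreover have "of_int g * (of_int a' * x + of_int b' * y + of_int c' * z) = 0"
    using eq by (simp add: e algebra_simps)
  then have "of_int a' * x + of_int b' * y + of_int c' * z = 0" using g by simp
  ultimately show thesis by (rule that)
qed

lemma of_int_power_eq_imp_int:
  fixes m n :: int and k :: nat
  assumes "m ^ 2 = n * l ^ 2" "l \<noteq> 0"
  shows "\<exists>r::int. r ^ 2 = n"
proof -
  have "l ^ 2 dvd m ^ 2" using assms by simp
  then have "l dvd m" by simp
  then obtain r where "m = l * r" by blast
  then have "r ^ 2 = n" using assms by (simp add: power_mult_distrib)
  then show ?thesis by blast
qed

text \<open>Squaring \<open>c y = - (a + b x)\<close> makes \<open>2 a b x\<close> an integer. As x
  is irrational, a b = 0, and the relation that is left exhibits s or r s as the square of a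
  rational number, hence of an integer.\<close>

lemma not_both_squares:
  fixes x y :: "'k::field_char_0" and r s :: int
  assumes K: "quadratic_field TYPE('k)"
    and x: "x ^ 2 = of_int r" and y: "y ^ 2 = of_int s"
    and "\<nexists>m::int. m ^ 2 = r" "\<nexists>m::int. m ^ 2 = s" "\<nexists>m::int. m ^ 2 = r * s"
  shows False
proof -
  obtain a b c :: int where nz: "a \<noteq> 0 \<or> b \<noteq> 0 \<or> c \<noteq> 0"
    and eq: "of_int a * 1 + of_int b * x + of_int c * y = (0::'k)"
    using quadratic_field_dependent[OF K] by metis
  have "of_int (c^2 * s) = (of_int c * y)^2" using y by (simp add: power_mult_distrib)
  also have "of_int c * y = - (of_int a + of_int b * x)" using eq by (simp add: algebra_simps eq_neg_iff_add_eq_0)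
  also have "(- (of_int a + of_int b * x))^2 = of_int (a^2 + b^2*r) + of_int (2*a*b) * x"
    using x by (simp add: power2_eq_square algebra_simps)
  finally have 1: "of_int (c^2*s - a^2 - b^2*r) = of_int (2*a*b) * x" by simp
  have 2: "(c^2*s - a^2 - b^2*r)^2 = r * (2*a*b)^2"
  proof -
    have "(of_int ((c^2*s - a^2 - b^2*r)^2) :: 'k) = of_int (r * (2*a*b)^2)"
      using arg_cong[OF 1, of "\<lambda>u. u^2"] x by (simp add: power_mult_distrib)
    then show ?thesis by (simp only: of_int_eq_iff)
  qed
  then have ab: "a * b = 0" using of_int_power_eq_imp_int[of _ r "2*a*b"] assms(4) by auto
  then have 3: "c^2*s = a^2 + b^2*r" using 2 by (auto simp: mult.assoc)
  show False
  proof (cases "b = 0")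
    case True
    then have "a^2 = s * c^2" using 3 by (simp add: mult.commute)
    then show False using of_int_power_eq_imp_int[of a s c] assms(5) nz True by (cases "c = 0") auto
  next
    case False
    then have "(c*s)^2 = (r*s) * b^2" using 3 ab
      by (metis add_0 mult.assoc mult.commute mult_eq_0_iff power2_eq_square power_mult_distrib)
    then show False using of_int_power_eq_imp_int[of "c*s" "r*s" b] False assms(6) by auto
  qed
qed

text \<open>For positive \<open>n\<close> the certificate \<open>k\<close> is the integer part of
  its square root; for negative \<open>n\<close> any \<open>k\<close> will do.\<close>

lemma not_int_square:
  fixes n k :: int
  assumes "n < 0 \<or> k \<ge> 0 \<and> k ^ 2 < n \<and> n < (k + 1) ^ 2"
  shows "\<nexists>m::int. m ^ 2 = n"
proof
  assume "\<exists>m::int. m ^ 2 = n"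
  then obtain m :: int where m: "\<bar>m\<bar> ^ 2 = n" by auto
  then have "n \<ge> 0" by auto
  with assms have k: "k \<ge> 0" "k ^ 2 < \<bar>m\<bar> ^ 2" "\<bar>m\<bar> ^ 2 < (k + 1) ^ 2" using m by auto
  then have "k < \<bar>m\<bar>" "\<bar>m\<bar> < k + 1"
    using power_less_imp_less_base[of k 2 "\<bar>m\<bar>"] power_less_imp_less_base[of "\<bar>m\<bar>" 2 "k + 1"] by auto
  then show False by simp
qed

text \<open>Divide the cubic by an integer quadratic that vanishes at x. A nonzero linear remainder
  makes x rational; a zero remainder leaves a linear cofactor, which has a rational root. Rational
  roots of a monic integer polynomial are integers.\<close>

lemma int_cubic_root:
  fixes x :: "'k::field_char_0" and u v w :: int
  assumes K: "quadratic_field TYPE('k)"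
    and x: "x ^ 3 + of_int u * x ^ 2 + of_int v * x + of_int w = 0"
  shows "\<exists>m::int. m ^ 3 + u * m ^ 2 + v * m + w = 0"
proof -
  \<comment> \<open>The rational root theorem in homogeneous form: a reduced denominator divides the
    cube of the numerator, so it is a unit.\<close>
  have int: "\<exists>m::int. m ^ 3 + u * m ^ 2 + v * m + w = 0"
    if pq: "p ^ 3 + u * p ^ 2 * q + v * p * q ^ 2 + w * q ^ 3 = 0" "q \<noteq> 0" for p q :: int
  proof -
    define g where "g = gcd p q"
    have g0: "g \<noteq> 0" using that by (simp add: g_def)
    obtain p' q' where e: "p = g * p'" "q = g * q'" "coprime p' q'"
      using gcd_coprime_exists[of p q] g0 unfolding g_def by (metis mult.commute)
    have "g^3 * (p' ^ 3 + u * p' ^ 2 * q' + v * p' * q' ^ 2 + w * q' ^ 3) = 0"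
      using pq(1) by (simp add: e(1,2) algebra_simps power2_eq_square power3_eq_cube)
    then have *: "p' ^ 3 + u * p' ^ 2 * q' + v * p' * q' ^ 2 + w * q' ^ 3 = 0" using g0 by simp
    then have "p' ^ 3 = q' * (- (u * p' ^ 2 + v * p' * q' + w * q' ^ 2))"
      by (simp add: algebra_simps power2_eq_square power3_eq_cube)
    then have "q' dvd p' ^ 3" by (metis dvd_triv_left)
    then have "is_unit q'" using e(3) by (meson coprime_common_divisor coprime_commute coprime_power_right_iff dvd_refl zero_less_numeral)
    then have "q' = 1 \<or> q' = -1" by auto
    then have "p' ^ 3 + u * p' ^ 2 + v * p' + w = 0 \<or> (-p') ^ 3 + u * (-p') ^ 2 + v * (-p') + w = 0"
      using * by auto
    then show ?thesis by blast
  qed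
  obtain a b c :: int where nz: "a \<noteq> 0 \<or> b \<noteq> 0 \<or> c \<noteq> 0"
    and eq: "of_int a * x^2 + of_int b * x + of_int c * 1 = 0"
    using quadratic_field_dependent[OF K] by metis
  have lin: ?thesis if "of_int p + of_int q * x = 0" "q \<noteq> 0" for p q :: int
  proof -
    have "of_int q * x = of_int (-p)" using that by (simp add: eq_neg_iff_add_eq_0 add.commute)
    then have "of_int ((-p) ^ 3 + u * (-p) ^ 2 * q + v * (-p) * q ^ 2 + w * q ^ 3)
        = (of_int q * x)^3 + of_int u * (of_int q * x)^2 * of_int q + of_int v * (of_int q * x) * of_int q ^ 2
          + of_int w * of_int q ^ 3" by simp
    also have "\<dots> = of_int q ^ 3 * (x ^ 3 + of_int u * x ^ 2 + of_int v * x + of_int w)"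
      by (simp add: algebra_simps power2_eq_square power3_eq_cube)
    finally have "of_int ((-p) ^ 3 + u * (-p) ^ 2 * q + v * (-p) * q ^ 2 + w * q ^ 3) = (0::'k)"
      using x by simp
    then have "(-p) ^ 3 + u * (-p) ^ 2 * q + v * (-p) * q ^ 2 + w * q ^ 3 = 0"
      by (simp only: of_int_eq_0_iff)
    then show ?thesis using that(2) by (rule int)
  qed
  show ?thesis
  proof (cases "a = 0")
    case True
    then have "b \<noteq> 0" using nz eq by auto
    then show ?thesis using lin[of c b] eq True by (simp add: add.commute)
  next
    case False
    \<comment> \<open>dividing the cubic by the quadratic leaves a linear remainder\<close>
    define S where "S = a * a * v - a * c - (a * u - b) * b"
    define R where "R = a * a * w - (a * u - b) * c"
    have "of_int R + of_int S * x = of_int (a^2) * (x ^ 3 + of_int u * x ^ 2 + of_int v * x + of_int w)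
       - (of_int a * x + of_int (a * u - b)) * (of_int a * x^2 + of_int b * x + of_int c * 1)"
      by (simp add: R_def S_def algebra_simps power2_eq_square power3_eq_cube)
    also have "\<dots> = 0" using x eq by simp
    finally have RS: "of_int R + of_int S * x = 0" .
    show ?thesis
    proof (cases "S = 0")
      case True
      then have "R = 0" using RS by simp
      \<comment> \<open>The cofactor is proportional to \<open>a * x + (a * u - b)\<close>, so its
        root is \<open>p / a\<close>.\<close>
      define p where "p = b - a * u"
      have "p ^ 3 + u * p ^ 2 * a + v * p * a ^ 2 + w * a ^ 3 = p * p * (p + u * a) + p * (a * a * v) + a * (a * a * w)"
         by (simp add: algebra_simps power2_eq_square power3_eq_cube)
      also have "a * a * v = a * c + (a * u - b) * b" using True by (simp add: S_def)
      also have "a * a * w = (a * u - b) * c" using \<open>R = 0\<close> by (simp add: R_def)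
      also have "p * p * (p + u * a) + p * (a * c + (a * u - b) * b) + a * ((a * u - b) * c) = 0"
        by (simp add: p_def algebra_simps)
      finally show ?thesis using int[of p a] \<open>a \<noteq> 0\<close> by blast
    next
      case False then show ?thesis using lin RS by blast
    qed
  qed
qed

section \<open>Valuations of quadratic fields\<close>

definition is_subring :: "'a::comm_ring_1 set \<Rightarrow> bool" where
  "is_subring A \<longleftrightarrow> 1 \<in> A \<and> (\<forall>x\<in>A. \<forall>y\<in>A. x - y \<in> A \<and> x * y \<in> A)"

lemma is_subring_closed:
  assumes "is_subring A"
  shows "0 \<in> A" "1 \<in> A" "x \<in> A \<Longrightarrow> y \<in> A \<Longrightarrow> x + y \<in> A" "x \<in> A \<Longrightarrow> y \<in> A \<Longrightarrow> x - y \<in> A"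
    "x \<in> A \<Longrightarrow> y \<in> A \<Longrightarrow> x * y \<in> A" "x \<in> A \<Longrightarrow> - x \<in> A" "x \<in> A \<Longrightarrow> x ^ n \<in> A" "of_int k \<in> A"
proof -
  show 1: "1 \<in> A" and d: "\<And>x y. x \<in> A \<Longrightarrow> y \<in> A \<Longrightarrow> x - y \<in> A"
    and m: "\<And>x y. x \<in> A \<Longrightarrow> y \<in> A \<Longrightarrow> x * y \<in> A"
    using assms by (auto simp: is_subring_def)
  show 0: "0 \<in> A" using d[OF 1 1] by simp
  show n: "- x \<in> A" if "x \<in> A" for x using d[OF 0 that] by simp
  show a: "x + y \<in> A" if "x \<in> A" "y \<in> A" for x y using d[OF that(1) n[OF that(2)]] by simp
  show "x ^ n \<in> A" if "x \<in> A" for x by (induction n) (auto simp: 1 m that)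
  show "of_int k \<in> A" by (induction k rule: int_induct[of _ 0]) (auto simp: 0 1 a d)
qed

text \<open>A subring that is maximal among those without 1/p turns out to be the ring of a
  valuation above p; no prime ideal or localisation has to be constructed.\<close>

locale maximal_subring =
  fixes p :: int and A :: "'k::field_char_0 set"
  assumes K: "quadratic_field TYPE('k)" and p: "prime p"
    and A: "is_subring A" and inv_p: "1 / of_int p \<notin> A"
    and maximal: "\<And>B. is_subring B \<Longrightarrow> A \<subseteq> B \<Longrightarrow> 1 / of_int p \<notin> B \<Longrightarrow> B = A"
begin

lemmas A_closed = is_subring_closed[OF A]

lemma p_nz: "(of_int p :: 'k) \<noteq> 0"
  using p not_prime_0 by (metis of_int_eq_0_iff)

lemma one_notin: "c \<in> A \<Longrightarrow> of_int p * c \<noteq> 1"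
  using inv_p p_nz by (metis nonzero_eq_divide_eq mult.commute)

text \<open>Adjoining 1/a enlarges the ring, so by maximality 1/p appears, in the form c / a^n. Thus
  nonunits are nilpotent modulo p.\<close>

lemma power_in_ideal:
  assumes "a \<in> A" "a \<noteq> 0" "1 / a \<notin> A"
  shows "\<exists>n. \<exists>c\<in>A. a ^ n = of_int p * c"
proof -
  define B where "B = {c / a ^ n | c n. c \<in> A}"
  have BI: "c / a ^ n \<in> B" if "c \<in> A" for c n unfolding B_def using that by blast
  have "is_subring B" unfolding is_subring_def
  proof (intro conjI ballI)
    show "1 \<in> B" using BI[of 1 0] A_closed(2) by simp
    fix x y assume "x \<in> B" "y \<in> B"
    then obtain c n d m where *: "x = c / a ^ n" "c \<in> A" "y = d / a ^ m" "d \<in> A"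
      unfolding B_def by blast
    have "x - y = (c * a ^ m - d * a ^ n) / a ^ (n + m)"
      using assms(2) by (simp add: * power_add field_simps)
    also have "\<dots> \<in> B" using * assms(1) by (intro BI A_closed)
    finally show "x - y \<in> B" .
    have "x * y = (c * d) / a ^ (n + m)" by (simp add: * power_add)
    also have "\<dots> \<in> B" using * by (intro BI A_closed)
    finally show "x * y \<in> B" .
  qed
  moreover have "A \<subseteq> B" using BI[of _ 0] by auto
  moreover have "1 / a \<in> B" using BI[of 1 1] A_closed(2) by simp
  ultimately have "1 / of_int p \<in> B" using maximal assms(3) by blast
  then obtain c n where "1 / of_int p = c / a ^ n" "c \<in> A" unfolding B_def by blast
  then have "a ^ n = of_int p * c" using p_nz assms(2) by (simp add: field_simps)
  then show ?thesis using \<open>c \<in> A\<close> by blast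
qed

text \<open>All powers of 1 - p e are congruent to 1 modulo p, so none lies in p A, whereas some
  power of a nonunit does.\<close>

lemma one_minus_unit:
  assumes "e \<in> A"
  shows "1 - of_int p * e \<noteq> 0" "1 / (1 - of_int p * e) \<in> A"
proof -
  define a where "a = 1 - of_int p * e"
  show "1 - of_int p * e \<noteq> 0" using one_notin[OF assms] by auto
  then have nz: "a \<noteq> 0" by (simp add: a_def)
  have aA: "a \<in> A" unfolding a_def using assms by (intro A_closed)
  have "\<exists>f\<in>A. a ^ n = 1 - of_int p * f" for n
  proof (induction n)
    case 0 then show ?case using A_closed(1) by (intro bexI[of _ 0]) auto
  next
    case (Suc n)
    then obtain f where f: "f \<in> A" "a ^ n = 1 - of_int p * f" by blast
    have "a ^ Suc n = 1 - of_int p * (e + f - of_int p * e * f)"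
      by (simp add: f(2)) (simp add: a_def algebra_simps)
    moreover have "e + f - of_int p * e * f \<in> A" using assms f by (simp add: A_closed)
    ultimately show ?case by blast
  qed
  then have "\<not> (\<exists>c\<in>A. a ^ n = of_int p * c)" for n
    using one_notin A_closed(3) by (metis add.commute add_diff_cancel_right' diff_add_cancel distrib_left)
  then show "1 / (1 - of_int p * e) \<in> A" using power_in_ideal[OF aA nz] by (auto simp: a_def)
qed

definition U :: "'k set" where "U = {x. x \<in> A \<and> 1 / x \<in> A \<and> x \<noteq> 0}"

lemma U_mult: "x \<in> U \<Longrightarrow> y \<in> U \<Longrightarrow> x * y \<in> U"
  using A_closed(5)[of "1/x" "1/y"] A_closed(5)[of x y] by (auto simp: U_def)

lemma U_inverse: "x \<in> U \<Longrightarrow> 1 / x \<in> U"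
  by (auto simp: U_def)

lemma U_minus: "x \<in> U \<Longrightarrow> - x \<in> U"
  using A_closed(6)[of x] A_closed(6)[of "1/x"] by (auto simp: U_def)

lemma U_one: "1 \<in> U"
  using A_closed(2) by (auto simp: U_def)

lemma U_power: "x \<in> U \<Longrightarrow> x ^ n \<in> U"
  by (induction n) (auto simp: U_one U_mult)

lemma of_int_unit:
  assumes "\<not> p dvd k"
  shows "of_int k \<in> U"
proof -
  have "coprime k p" using assms p by (metis coprime_commute prime_imp_coprime)
  then obtain j e where "j * k + e * p = 1" using bezout_int[of k p] by auto
  then have e: "k * j = 1 - p * e" by (simp add: algebra_simps)
  have "of_int k * of_int j = (1 - of_int p * of_int e :: 'k)"
    using arg_cong[OF e, of "of_int :: int \<Rightarrow> 'k"] by simp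
  moreover note one_minus_unit[of "of_int e", OF A_closed(8)]
  moreover have "k \<noteq> 0" using assms by auto
  ultimately have "1 / of_int k = of_int j * (1 / (1 - of_int p * of_int e :: 'k))" by (simp add: field_simps)
  then have "1 / of_int k \<in> A" using one_minus_unit(2)[of "of_int e", OF A_closed(8)] A_closed(5,8) by metis
  then show ?thesis using A_closed(8) \<open>k \<noteq> 0\<close> by (simp add: U_def)
qed

lemma of_int_eq_unit:
  assumes "k \<noteq> 0"
  shows "\<exists>n. \<exists>u\<in>U. (of_int k :: 'k) = of_int p ^ n * u"
proof -
  obtain n k' where "k = p ^ n * k'" "\<not> p dvd k'"
    using multiplicity_decompose'[of k p] assms p not_prime_unit by metis
  then show ?thesis using of_int_unit[of k'] by (intro exI[of _ n] bexI[of _ "of_int k'"]) auto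
qed

text \<open>Otherwise \<open>A + A x\<close> is a larger ring and contains 1/p = a + b x. Then u = 1
  - p a is a unit equal to p b x, and the quadratic equation puts u^2 into p A, which is
  absurd.\<close>

lemma integral_in:
  assumes "s \<in> A" "t \<in> A" "x ^ 2 = s * x + t"
  shows "x \<in> A"
proof (rule ccontr)
  assume "x \<notin> A"
  define B where "B = {a + b * x | a b. a \<in> A \<and> b \<in> A}"
  have BI: "a + b * x \<in> B" if "a \<in> A" "b \<in> A" for a b unfolding B_def using that by blast
  have "is_subring B" unfolding is_subring_def
  proof (intro conjI ballI)
    show "1 \<in> B" using BI[of 1 0] A_closed(1,2) by simp
    fix y z assume "y \<in> B" "z \<in> B"
    then obtain a b c d where *: "y = a + b * x" "z = c + d * x" "a \<in> A" "b \<in> A" "c \<in> A" "d \<in> A"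
      unfolding B_def by blast
    have "y - z = (a - c) + (b - d) * x" by (simp add: * algebra_simps)
    also have "\<dots> \<in> B" using * by (intro BI A_closed)
    finally show "y - z \<in> B" .
    have "y * z = (a * c) + (a * d + b * c) * x + b * d * x^2" by (simp add: * algebra_simps power2_eq_square)
    then have "y * z = (a * c + b * d * t) + (a * d + b * c + b * d * s) * x"
      unfolding assms(3) by (simp add: algebra_simps)
    moreover have "a * c + b * d * t \<in> A" "a * d + b * c + b * d * s \<in> A"
      using * assms by (simp_all add: A_closed)
    ultimately show "y * z \<in> B" using BI by simp
  qed
  moreover have "A \<subseteq> B" using BI[OF _ A_closed(1)] by auto
  moreover have "x \<in> B" using BI[OF A_closed(1,2)] by simp
  ultimately have "1 / of_int p \<in> B" using maximal \<open>x \<notin> A\<close> by blast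
  then obtain a b where ab: "1 / of_int p = a + b * x" "a \<in> A" "b \<in> A" unfolding B_def by blast
  define u where "u = 1 - of_int p * a"
  have u: "u \<noteq> 0" "1 / u \<in> A" "u \<in> A"
    using one_minus_unit[OF ab(2)] ab(2) by (simp_all add: u_def A_closed)
  have ux: "u = of_int p * b * x"
    using ab(1) p_nz by (simp add: u_def field_simps)
  have "u ^ 2 = of_int p ^ 2 * b ^ 2 * (s * x + t)"
    unfolding ux assms(3)[symmetric] by (simp add: power_mult_distrib)
  also have "\<dots> = of_int p * (b * s * (of_int p * b * x) + of_int p * b ^ 2 * t)"
    by (simp add: algebra_simps power2_eq_square)
  also have "\<dots> = of_int p * (b * s * u + of_int p * b ^ 2 * t)" by (simp add: ux)
  finally have "u ^ 2 = of_int p * (b * s * u + of_int p * b ^ 2 * t)" .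
  moreover have "(1 / u) ^ 2 * u ^ 2 = 1" using u(1) by (simp add: power_divide)
  ultimately have "1 = of_int p * ((1 / u) ^ 2 * (b * s * u + of_int p * b ^ 2 * t))"
    by (metis mult.left_commute)
  moreover have "(1 / u) ^ 2 * (b * s * u + of_int p * b ^ 2 * t) \<in> A"
    using u ab assms by (simp add: A_closed)
  ultimately show False using one_notin by metis
qed

text \<open>Take a primitive relation a x^2 + b x + c = 0. If a or c is prime to p, then x or 1/x is
  integral. Otherwise b is prime to p, and \<open>y = a x\<close> and \<open>z = c / x\<close> are
  integral with sum - b and product a c; whichever of them is a unit decides.\<close>

lemma in_or_inverse_in:
  assumes "x \<noteq> 0"
  shows "x \<in> A \<or> 1 / x \<in> A"
proof -
  obtain a b c :: int where g: "gcd a (gcd b c) = 1"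
    and eq: "of_int a * x^2 + of_int b * x + of_int c * 1 = 0"
    using quadratic_field_coprime_relation[OF K] by metis
  have UA: "(of_int n :: 'k) \<noteq> 0" "of_int m / (of_int n :: 'k) \<in> A" if "\<not> p dvd n" for m n
  proof -
    have "1 / of_int n \<in> A" "(of_int n :: 'k) \<noteq> 0" using of_int_unit[OF that] by (simp_all add: U_def)
    then show "(of_int n :: 'k) \<noteq> 0" "of_int m / (of_int n :: 'k) \<in> A"
      using A_closed(5)[OF A_closed(8), of "1 / of_int n" m] by auto
  qed
  consider "\<not> p dvd a" | "\<not> p dvd c" | "\<not> p dvd b" "p dvd a" "p dvd c"
    using g p by (metis gcd_greatest not_prime_unit)
  then show ?thesis
  proof cases
    case 1
    have "x ^ 2 = of_int (-b) / of_int a * x + of_int (-c) / of_int a"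
      using eq UA(1)[OF 1] by (simp add: field_simps eq_neg_iff_add_eq_0)
    then show ?thesis using integral_in UA(2)[OF 1] by blast
  next
    case 2
    have "(1 / x) ^ 2 = of_int (-b) / of_int c * (1 / x) + of_int (-a) / of_int c"
      using eq UA(1)[OF 2] assms by (simp add: field_simps eq_neg_iff_add_eq_0 power2_eq_square)
    then show ?thesis using integral_in UA(2)[OF 2] by blast
  next
    case 3
    define y z where "y = of_int a * x" and "z = of_int c / x"
    have "y ^ 2 = of_int (-b) * y + of_int (- (a * c))"
    proof -
      have "y^2 + of_int b * y + of_int (a * c) = of_int a * (of_int a * x^2 + of_int b * x + of_int c * 1)"
        by (simp add: y_def algebra_simps power2_eq_square)
      also have "\<dots> = 0" using eq by simp
      finally have "y^2 + (of_int b * y + of_int (a * c)) = 0" by (simp only: add.assoc)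
      then have "y^2 = - (of_int b * y + of_int (a * c))" by (simp only: eq_neg_iff_add_eq_0)
      then show ?thesis by simp
    qed
    then have yA: "y \<in> A" using integral_in A_closed(8) by blast
    have yz: "y + z = - of_int b"
    proof -
      have "x * (y + z) = x * (- of_int b)"
        using eq assms by (simp add: y_def z_def algebra_simps power2_eq_square eq_neg_iff_add_eq_0)
      then show ?thesis using assms mult_left_cancel by blast
    qed
    then have zA: "z \<in> A" using yA A_closed(4,6,8) by (metis add_diff_cancel_left')
    \<comment> \<open>If both were nonunits they would be nilpotent modulo p; by the binomial
      theorem so would their sum, which is the unit - b.\<close>
    have "y \<in> U \<or> z \<in> U"
    proof (rule ccontr)
      assume neg: "\<not> (y \<in> U \<or> z \<in> U)"
      have pow: "\<exists>n. \<exists>c\<in>A. w ^ n = of_int p * c" if "w \<in> A" "w \<notin> U" for w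
      proof (cases "w = 0")
        case True then show ?thesis using A_closed(1) by (intro exI[of _ 1] bexI[of _ 0]) auto
      next
        case False then show ?thesis using power_in_ideal that by (simp add: U_def)
      qed
      obtain n c' where n: "c' \<in> A" "y ^ n = of_int p * c'" using pow yA neg by blast
      obtain m d where m: "d \<in> A" "z ^ m = of_int p * d" using pow zA neg by blast
      have yz_pow: "\<exists>e\<in>A. y ^ i * z ^ j = of_int p * e" if "i \<ge> n \<or> j \<ge> m" for i j
      proof (cases "i \<ge> n")
        case True
        then have "y ^ i = y ^ n * y ^ (i - n)" by (simp flip: power_add)
        then have "y ^ i * z ^ j = of_int p * (c' * y ^ (i - n) * z ^ j)"
          by (simp add: n(2) mult.assoc)
        moreover have "c' * y ^ (i - n) * z ^ j \<in> A" "d * z ^ (j - m) * y ^ i \<in> A"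
          using n m yA zA by (simp_all add: A_closed)
        ultimately show ?thesis by blast
      next
        case False
        then have "z ^ j = z ^ m * z ^ (j - m)" using that by (simp flip: power_add)
        then have "y ^ i * z ^ j = of_int p * (d * z ^ (j - m) * y ^ i)"
          by (simp add: m(2) algebra_simps)
        moreover have "c' * y ^ (i - n) * z ^ j \<in> A" "d * z ^ (j - m) * y ^ i \<in> A"
          using n m yA zA by (simp_all add: A_closed)
        ultimately show ?thesis by blast
      qed
      have "\<exists>e\<in>A. of_nat ((n + m) choose i) * y ^ i * z ^ (n + m - i) = of_int p * e" for i
      proof -
        have "\<exists>e\<in>A. y ^ i * z ^ (n + m - i) = of_int p * e"
          by (rule yz_pow) linarith
        then obtain e where "e \<in> A" "y ^ i * z ^ (n + m - i) = of_int p * e" by blast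
        then have "of_nat ((n + m) choose i) * y ^ i * z ^ (n + m - i) = of_int p * (of_nat ((n + m) choose i) * e)"
          by (simp add: algebra_simps)
        moreover have "of_nat ((n + m) choose i) * e \<in> A"
          using A_closed(5)[OF A_closed(8)[of "int ((n + m) choose i)"] \<open>e \<in> A\<close>] by simp
        ultimately show ?thesis by blast
      qed
      then obtain f where f: "\<And>i. f i \<in> A" "\<And>i. of_nat ((n + m) choose i) * y ^ i * z ^ (n + m - i) = of_int p * f i"
        by metis
      have "(y + z) ^ (n + m) = of_int p * (\<Sum>i\<le>n + m. f i)"
        by (simp add: binomial_ring f(2) sum_distrib_left)
      moreover have "(\<Sum>i\<in>S. f i) \<in> A" if "finite S" for S
        using that by (induction rule: finite_induct) (auto simp: f A_closed)
      then have "(\<Sum>i\<le>n + m. f i) \<in> A" by blast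
      moreover have "(y + z) ^ (n + m) \<in> U" using U_power U_minus of_int_unit[OF 3(1)] yz by metis
      ultimately obtain g where g: "g \<in> A" "of_int p * g \<in> U" by auto
      then have "of_int p * (g * (1 / (of_int p * g))) = 1" by (auto simp: U_def)
      moreover have "g * (1 / (of_int p * g)) \<in> A" using A_closed(5) g unfolding U_def by blast
      ultimately show False using one_notin by blast
    qed
    then show ?thesis
    proof
      assume "y \<in> U"
      then have "1 / y \<in> A" "a \<noteq> 0" by (auto simp: U_def y_def)
      then have "of_int a * (1 / y) \<in> A" using A_closed(5)[OF A_closed(8)] by blast
      moreover have "of_int a * (1 / y) = 1 / x" using \<open>a \<noteq> 0\<close> by (simp add: y_def)
      ultimately show ?thesis by metis
    next
      assume "z \<in> U"
      then have "1 / z \<in> A" "c \<noteq> 0" by (auto simp: U_def z_def)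
      then have "of_int c * (1 / z) \<in> A" using A_closed(5)[OF A_closed(8)] by blast
      moreover have "of_int c * (1 / z) = x" using \<open>c \<noteq> 0\<close> by (simp add: z_def)
      ultimately show ?thesis by metis
    qed
  qed
qed

abbreviation (input) pp :: "int \<Rightarrow> 'k" where "pp k \<equiv> of_int p powi k"

lemma of_int_eq_pp: "k \<noteq> 0 \<Longrightarrow> \<exists>n. \<exists>u\<in>U. (of_int k :: 'k) = pp n * u"
  using of_int_eq_unit[of k] by (metis power_int_of_nat)

lemma inverse_U: "u \<in> U \<Longrightarrow> inverse u \<in> U"
  using U_inverse by (simp add: inverse_eq_divide)

lemma U_nz: "u \<in> U \<Longrightarrow> u \<noteq> 0"
  by (simp add: U_def)

text \<open>This makes \<open>A\<close> a local ring. Its purpose is to show that in a vanishing sum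
  of three nonzero terms two have a unit as quotient.\<close>

lemma one_plus_nonunit:
  assumes "x \<in> A" "x \<notin> U"
  shows "1 + x \<in> U"
proof -
  have nz: "1 + x \<noteq> 0"
  proof
    assume "1 + x = 0"
    then have "x = - 1" by (metis add_eq_0_iff)
    then show False using assms(2) U_minus[OF U_one] by simp
  qed
  moreover have "1 / (1 + x) \<in> A"
  proof (rule ccontr)
    assume "1 / (1 + x) \<notin> A"
    then have x0: "x \<noteq> 0" using A_closed(2) by auto
    from assms x0 have x1: "1 / x \<notin> A" by (simp add: U_def)
    obtain n c where n: "c \<in> A" "x ^ n = of_int p * c"
      using power_in_ideal[OF assms(1) x0 x1] by blast
    obtain m d where m: "d \<in> A" "(1 + x) ^ m = of_int p * d"
      using power_in_ideal[OF A_closed(3)[OF A_closed(2) assms(1)] nz \<open>1 / (1 + x) \<notin> A\<close>] by blast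
    \<comment> \<open>\<open>1 - x^n\<close> is a unit divisible by \<open>1 + x\<close>, up to replacing \<open>n\<close> by \<open>2 * n\<close>\<close>
    have "\<exists>e\<in>A. 1 - x ^ (2 * n) = (1 + x) * e"
    proof -
      have "1 - (x^2) ^ n = (1 - x^2) * (\<Sum>i<n. (x^2) ^ i)" by (rule one_diff_power_eq)
      then have "1 - x ^ (2 * n) = (1 + x) * ((1 - x) * (\<Sum>i<n. (x^2) ^ i))"
        by (simp add: power_mult algebra_simps power2_eq_square)
      moreover have "(\<Sum>i\<in>S. (x^2) ^ i) \<in> A" if "finite S" for S
        using that by (induction rule: finite_induct) (simp_all add: A_closed assms)
      then have "(1 - x) * (\<Sum>i<n. (x^2) ^ i) \<in> A" using assms(1) by (intro A_closed) auto
      ultimately show ?thesis by blast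
    qed
    then obtain e where e: "e \<in> A" "1 - x ^ (2 * n) = (1 + x) * e" by blast
    have "x ^ (2 * n) = of_int p * (c * (of_int p * c))"
      unfolding power_even_eq n(2) by (simp add: power2_eq_square algebra_simps)
    then have u: "1 / ((1 + x) * e) \<in> A" "(1 + x) * e \<noteq> 0"
      using one_minus_unit[of "c * (of_int p * c)"] n(1) A_closed(5,8) e(2) by auto
    then have "e * (1 / ((1 + x) * e)) \<in> A" using e A_closed(5) by blast
    moreover have "e * (1 / ((1 + x) * e)) = 1 / (1 + x)" using u(2) by simp
    ultimately show False using \<open>1 / (1 + x) \<notin> A\<close> by simp
  qed
  ultimately show ?thesis using assms A_closed(2,3) by (simp add: U_def)
qed

text \<open>Among the three terms of a quadratic relation for \<open>x\<close>, two are associates.\<close>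

lemma square_eq_pp:
  assumes "x \<noteq> 0"
  shows "\<exists>k. \<exists>u\<in>U. x ^ 2 = pp k * u"
proof -
  \<comment> \<open>These elements form a multiplicative group that contains all units and all
    nonzero integers, so it suffices to write x or x^2 as a product or quotient of such
    elements.\<close>
  define good where "good y \<longleftrightarrow> (\<exists>k. \<exists>u\<in>U. y = pp k * u)" for y
  have good_int: "good (of_int k)" if "k \<noteq> 0" for k using of_int_eq_pp[OF that] by (simp add: good_def)
  have good_mult: "good (y * z)" if yz: "good y" "good z" for y z
  proof -
    obtain k u where "y = pp k * u" "u \<in> U" using yz(1) unfolding good_def by blast
    moreover obtain l w where "z = pp l * w" "w \<in> U" using yz(2) unfolding good_def by blast
    ultimately have "y * z = pp (k + l) * (u * w)" "u * w \<in> U"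
      using p_nz U_mult by (simp_all add: power_int_add)
    then show ?thesis by (auto simp: good_def)
  qed
  have good_inverse: "good (inverse y)" if gy: "good y" for y
  proof -
    obtain k u where "y = pp k * u" "u \<in> U" using gy unfolding good_def by blast
    then have "inverse y = pp (- k) * inverse u" "inverse u \<in> U"
      using inverse_U by (simp_all add: power_int_minus)
    then show ?thesis by (auto simp: good_def)
  qed
  have good_U: "good u" if "u \<in> U" for u
    using that by (auto simp: good_def intro!: exI[of _ 0])
  have good_div: "good (y / z)" if "good y" "good z" for y z
    using good_mult[OF that(1) good_inverse[OF that(2)]] by (simp add: divide_inverse)
  have good_sq: "good (y ^ 2)" if "good y" for y
    using good_mult[OF that that] by (simp add: power2_eq_square)
  obtain a b c :: int where nz: "a \<noteq> 0 \<or> b \<noteq> 0 \<or> c \<noteq> 0"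
    and eq: "of_int a * x^2 + of_int b * x + of_int c * 1 = 0"
    using quadratic_field_dependent[OF K] by metis
  have "good (x ^ 2)"
  proof -
    consider "a = 0" | "a \<noteq> 0" "b = 0" | "a \<noteq> 0" "c = 0" | "a \<noteq> 0" "b \<noteq> 0" "c \<noteq> 0" by blast
    then show ?thesis
    proof cases
      case 1
      then have "b \<noteq> 0" "c \<noteq> 0" using nz eq assms by auto
      then have "x = of_int (-c) / of_int b" using eq 1 by (simp add: field_simps eq_neg_iff_add_eq_0)
      then show ?thesis using good_sq good_div good_int \<open>b \<noteq> 0\<close> \<open>c \<noteq> 0\<close> by (metis neg_equal_0_iff_equal)
    next
      case 2
      then have "c \<noteq> 0" using eq assms by auto
      moreover have "x^2 = of_int (-c) / of_int a" using eq 2 by (simp add: field_simps eq_neg_iff_add_eq_0)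
      ultimately show ?thesis using good_div good_int 2 by (metis neg_equal_0_iff_equal)
    next
      case 3
      have "x * (of_int a * x + of_int b) = 0" using eq 3 by (simp add: algebra_simps power2_eq_square)
      then have "of_int a * x + of_int b = 0" using assms by simp
      then have "x = of_int (-b) / of_int a" using 3 by (simp add: field_simps eq_neg_iff_add_eq_0)
      moreover from this have "b \<noteq> 0" using assms by auto
      ultimately show ?thesis using good_sq good_div good_int 3 by (metis neg_equal_0_iff_equal)
    next
      case 4
      define t1 t2 t3 where t: "t1 = of_int a * x^2" "t2 = of_int b * x" "t3 = (of_int c :: 'k)"
      have tnz: "t1 \<noteq> 0" "t2 \<noteq> 0" "t3 \<noteq> 0" using 4 assms by (simp_all add: t)
      have sum: "t1 + t2 + t3 = 0" using eq by (simp add: t)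
      have "t1 / t3 \<in> U \<or> t2 / t3 \<in> U \<or> t2 / t1 \<in> U"
      proof (cases "t1 / t3 \<in> U")
        case False
        have "1 / (t1 / t3) = t3 / t1" by simp
        with in_or_inverse_in[of "t1 / t3"] tnz have "t1 / t3 \<in> A \<or> t3 / t1 \<in> A" by simp
        then show ?thesis
        proof
          assume "t1 / t3 \<in> A"
          then have "- (1 + t1 / t3) \<in> U" using one_plus_nonunit False U_minus by blast
          moreover have "t2 / t3 = - (1 + t1 / t3)"
            using sum tnz by (simp add: field_simps eq_neg_iff_add_eq_0)
          ultimately show ?thesis by simp
        next
          assume *: "t3 / t1 \<in> A"
          have "t3 / t1 \<notin> U" using False U_inverse by fastforce
          then have "- (1 + t3 / t1) \<in> U" using one_plus_nonunit * U_minus by blast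
          moreover have "t2 / t1 = - (1 + t3 / t1)"
            using sum tnz by (simp add: field_simps eq_neg_iff_add_eq_0)
          ultimately show ?thesis by simp
        qed
      qed blast
      then consider "t1 / t3 \<in> U" | "t2 / t3 \<in> U" | "t2 / t1 \<in> U" by blast
      then show ?thesis
      proof cases
        case 1
        have "x^2 = (of_int c / of_int a) * (t1 / t3)" using 4 by (simp add: t)
        then show ?thesis using 4 1 good_U good_mult good_div good_int by metis
      next
        case 2
        have "x = (of_int c / of_int b) * (t2 / t3)" using 4 by (simp add: t)
        then show ?thesis using 4 2 good_U good_mult good_div good_int good_sq by metis
      next
        case 3
        have "x = (of_int b / of_int a) / (t2 / t1)"
          using 4 assms by (simp add: t power2_eq_square)
        then show ?thesis using 4 3 good_U good_mult good_div good_int good_sq by metis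
      qed
    qed
  qed
  then show ?thesis by (simp add: good_def)
qed

text \<open>With a negative exponent, multiplication by a power of p and by the inverse of u would
  produce 1/p in \<open>A\<close>.\<close>

lemma pp_unit_nonneg:
  assumes "pp k * u \<in> A" "u \<in> U"
  shows "k \<ge> 0"
proof (rule ccontr)
  assume "\<not> k \<ge> 0"
  then obtain n where n: "k = - int (Suc n)" by (metis not_le nonneg_int_cases zless_iff_Suc_zadd negD)
  have "of_int p ^ n * (pp k * u) * (1 / u) \<in> A"
    using assms(2) by (intro A_closed(5) assms(1) A_closed) (simp add: U_def)
  moreover have "of_int p ^ n * (pp k * u) * (1 / u) = 1 / of_int p"
    using p_nz U_nz[OF assms(2)] unfolding n by (simp add: power_int_minus field_simps del: of_nat_Suc)
  ultimately show False using inv_p by simp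
qed

lemma pp_unique:
  assumes "pp k * u = pp l * w" "u \<in> U" "w \<in> U"
  shows "k = l"
proof -
  have "l \<le> k" if "pp k * u = pp l * w" "u \<in> U" "w \<in> U" for k l u w
  proof -
    have "pp (k - l) * u = w" using that(1) p_nz by (simp add: power_int_diff field_simps)
    then have "pp (k - l) * u \<in> A" using that(3) by (simp add: U_def)
    then show ?thesis using pp_unit_nonneg that(2) by fastforce
  qed
  from this[OF assms] this[OF assms(1)[symmetric] assms(3,2)] show ?thesis by simp
qed

text \<open>The ramification index is at most 2, so x^2, though perhaps not x, is an integral power
  of p times a unit; its exponent is the valuation with value 2 at p. The value at 0 is arbitrary,
  and every later statement excludes that case.\<close>

definition val :: "'k \<Rightarrow> int" where "val x = (THE k. \<exists>u\<in>U. x ^ 2 = pp k * u)"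

lemma val_eqI: "u \<in> U \<Longrightarrow> x ^ 2 = pp k * u \<Longrightarrow> val x = k"
  unfolding val_def by (rule the_equality) (auto dest: pp_unique)

lemma val_spec: "x \<noteq> 0 \<Longrightarrow> \<exists>u\<in>U. x ^ 2 = pp (val x) * u"
  using square_eq_pp val_eqI by metis

lemma val_mult:
  assumes "x \<noteq> 0" "y \<noteq> 0"
  shows "val (x * y) = val x + val y"
proof -
  obtain u w where "x ^ 2 = pp (val x) * u" "y ^ 2 = pp (val y) * w" "u \<in> U" "w \<in> U"
    using val_spec assms by metis
  then have "(x * y) ^ 2 = pp (val x + val y) * (u * w)" "u * w \<in> U"
    using p_nz U_mult by (simp_all add: power_int_add power_mult_distrib)
  then show ?thesis using val_eqI by blast
qed

lemma val_nonneg: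
  assumes "x \<in> A" "x \<noteq> 0"
  shows "val x \<ge> 0"
proof -
  obtain u where "x ^ 2 = pp (val x) * u" "u \<in> U" using val_spec assms by metis
  then show ?thesis using pp_unit_nonneg A_closed(7) assms(1) by metis
qed

lemma val_add:
  assumes "x \<noteq> 0" "y \<noteq> 0" "x + y \<noteq> 0"
  shows "val (x + y) \<ge> min (val x) (val y)"
proof -
  have *: "val (x + y) \<ge> val y" if "x / y \<in> A" "x \<noteq> 0" "y \<noteq> 0" "x + y \<noteq> 0" for x y
  proof -
    have "(1 + x / y) * y = x + y" using that by (simp add: field_simps)
    moreover have "1 + x / y \<in> A" using that A_closed by simp
    moreover have "1 + x / y \<noteq> 0" using that(4) \<open>(1 + x / y) * y = x + y\<close> by auto
    ultimately show ?thesis using val_mult[of "1 + x / y" y] val_nonneg[of "1 + x / y"] that by simp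
  qed
  have "x / y \<in> A \<or> y / x \<in> A" using in_or_inverse_in[of "x / y"] assms by simp
  then show ?thesis using *[of x y] *[of y x] assms by (auto simp: add.commute)
qed

lemma val_p: "val (of_int p) = 2"
  by (rule val_eqI[OF U_one]) (simp add: power_int_numeral)

end

text \<open>The normalisation \<open>v p = 2\<close> makes \<open>v\<close> integral whether \<open>p\<close> ramifies or not.\<close>

locale quadratic_valuation =
  fixes p :: int and v :: "'k::field_char_0 \<Rightarrow> int"
  assumes K: "quadratic_field TYPE('k)" and p: "prime p"
    and v_mult: "\<And>x y. x \<noteq> 0 \<Longrightarrow> y \<noteq> 0 \<Longrightarrow> v (x * y) = v x + v y"
    and v_add: "\<And>x y. x \<noteq> 0 \<Longrightarrow> y \<noteq> 0 \<Longrightarrow> x + y \<noteq> 0 \<Longrightarrow> min (v x) (v y) \<le> v (x + y)"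
    and v_p: "v (of_int p) = 2"

theorem exists_quadratic_valuation:
  assumes K: "quadratic_field TYPE('k::field_char_0)" and p: "prime p"
  shows "\<exists>v :: 'k \<Rightarrow> int. quadratic_valuation p v"
proof -
  define C where "C = {B :: 'k set. is_subring B \<and> 1 / of_int p \<notin> B}"
  \<comment> \<open>The integers show that the family to which Zorn's lemma is applied is
    nonempty.\<close>
  have "range of_int \<in> C"
  proof -
    have "1 / of_int p \<noteq> (of_int k :: 'k)" for k
    proof
      assume "1 / of_int p = (of_int k :: 'k)"
      moreover have "p \<noteq> 0" using p by auto
      ultimately have "(of_int (k * p) :: 'k) = of_int 1" by (simp add: field_simps)
      then have "k * p = 1" by (simp only: of_int_eq_iff)
      then have "is_unit p" by (metis dvd_triv_right)
      then show False using p not_prime_unit by blast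
    qed
    moreover have "is_subring (range (of_int :: int \<Rightarrow> 'k))"
      unfolding is_subring_def
      by (auto simp flip: of_int_diff of_int_mult)
    ultimately show ?thesis by (auto simp: C_def)
  qed
  moreover have "\<Union>D \<in> C" if D: "D \<noteq> {}" "subset.chain C D" for D
  proof -
    have dir: "\<exists>B\<in>D. x \<in> B \<and> y \<in> B" if "x \<in> \<Union>D" "y \<in> \<Union>D" for x y
      using that D(2) by (meson UnionE subsetD subset_chain_def)
    have sub: "is_subring B" "1 / of_int p \<notin> B" if "B \<in> D" for B
      using D(2) that by (auto simp: subset_chain_def C_def)
    have "is_subring (\<Union>D)" unfolding is_subring_def
    proof (intro conjI ballI)
      obtain B where "B \<in> D" using D(1) by blast
      then show "1 \<in> \<Union>D" using sub(1) is_subring_closed(2) by blast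
      fix x y assume "x \<in> \<Union>D" "y \<in> \<Union>D"
      then obtain B where "B \<in> D" "x \<in> B" "y \<in> B" using dir by blast
      then show "x - y \<in> \<Union>D" "x * y \<in> \<Union>D"
        using is_subring_closed(4,5)[OF sub(1)] by blast+
    qed
    then show ?thesis using sub(2) by (auto simp: C_def)
  qed
  ultimately obtain A where A: "A \<in> C" "\<forall>B\<in>C. A \<subseteq> B \<longrightarrow> B = A"
    using subset_Zorn_nonempty[of C] by blast
  then interpret maximal_subring p A
    using K p by unfold_locales (auto simp: C_def)
  have "quadratic_valuation p val"
    using K p val_mult val_add val_p by unfold_locales auto
  then show ?thesis by blast
qed

section \<open>Calculus of valuations and residues\<close>

context quadratic_valuation
begin

text \<open>\<open>vge\<close> treats 0 as having infinite valuation and \<open>veq\<close> never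
  holds for 0, so the arbitrary value \<open>v 0\<close> cannot enter a statement.\<close>

definition vge :: "'k \<Rightarrow> int \<Rightarrow> bool" where "vge x n \<longleftrightarrow> x = 0 \<or> n \<le> v x"
definition veq :: "'k \<Rightarrow> int \<Rightarrow> bool" where "veq x n \<longleftrightarrow> x \<noteq> 0 \<and> v x = n"

lemma v_one [simp]: "v 1 = 0"
  using v_mult[of 1 1] by simp

lemma v_minus [simp]: "v (- x) = v x"
proof (cases "x = 0")
  case False
  have "v (- 1) + v (- 1) = 0" using v_mult[of "-1" "-1"] by simp
  then show ?thesis using v_mult[of "-1" x] False by simp
qed simp

lemma v_power: "x \<noteq> 0 \<Longrightarrow> v (x ^ n) = int n * v x"
  by (induction n) (auto simp: v_mult algebra_simps)

lemma v_inverse: "x \<noteq> 0 \<Longrightarrow> v (inverse x) = - v x"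
  using v_mult[of x "inverse x"] by simp

lemma v_divide: "x \<noteq> 0 \<Longrightarrow> y \<noteq> 0 \<Longrightarrow> v (x / y) = v x - v y"
  by (simp add: divide_inverse v_mult v_inverse)

lemma vge_0 [simp]: "vge 0 n"
  by (simp add: vge_def)

lemma vge_mono: "vge x m \<Longrightarrow> n \<le> m \<Longrightarrow> vge x n"
  by (auto simp: vge_def)

lemma vge_add: "vge x n \<Longrightarrow> vge y n \<Longrightarrow> vge (x + y) n"
  using v_add[of x y] by (auto simp: vge_def) force

lemma vge_minus [simp]: "vge (- x) n \<longleftrightarrow> vge x n"
  by (auto simp: vge_def)

lemma vge_diff: "vge x n \<Longrightarrow> vge y n \<Longrightarrow> vge (x - y) n"
  using vge_add[of x n "-y"] by simp

lemma vge_mult: "vge x m \<Longrightarrow> vge y n \<Longrightarrow> k \<le> m + n \<Longrightarrow> vge (x * y) k"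
  by (cases "x = 0"; cases "y = 0") (auto simp: vge_def v_mult)

lemma vge_power: "vge x m \<Longrightarrow> k \<le> int n * m \<Longrightarrow> n > 0 \<Longrightarrow> vge (x ^ n) k"
proof -
  assume *: "vge x m" "k \<le> int n * m" "n > 0"
  show "vge (x ^ n) k"
  proof (cases "x = 0")
    case False
    then have "int n * m \<le> int n * v x" using * by (simp add: vge_def mult_left_mono)
    then have "k \<le> int n * v x" using *(2) by linarith
    then show ?thesis using False by (simp add: vge_def v_power)
  qed (use * in \<open>simp add: zero_power\<close>)
qed

lemma vge_monom:
  assumes "vge c a" "vge x m" "k \<le> a + int n * m"
  shows "vge (c * x ^ n) k"
proof (cases "n = 0")
  case True then show ?thesis using assms vge_mono by auto
next
  case False then show ?thesis using vge_mult[OF assms(1) vge_power[OF assms(2) order_refl] assms(3)] by simp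
qed

lemma veq_vge: "veq x n \<Longrightarrow> m \<le> n \<Longrightarrow> vge x m"
  by (simp add: veq_def vge_def)

lemma veq_nz: "veq x n \<Longrightarrow> x \<noteq> 0"
  by (simp add: veq_def)

lemma veq_mult: "veq x m \<Longrightarrow> veq y n \<Longrightarrow> k = m + n \<Longrightarrow> veq (x * y) k"
  by (simp add: veq_def v_mult)

lemma veq_power: "veq x m \<Longrightarrow> k = int n * m \<Longrightarrow> veq (x ^ n) k"
  by (simp add: veq_def v_power)

lemma veq_divide: "veq x m \<Longrightarrow> veq y n \<Longrightarrow> k = m - n \<Longrightarrow> veq (x / y) k"
  by (simp add: veq_def v_divide)

lemma vge_divide: "vge x m \<Longrightarrow> veq y n \<Longrightarrow> k \<le> m - n \<Longrightarrow> vge (x / y) k"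
  by (cases "x = 0"; cases "y = 0") (auto simp: veq_def vge_def v_divide)

lemma veq_minus [simp]: "veq (- x) n \<longleftrightarrow> veq x n"
  by (auto simp: veq_def)

lemma vge_veq_unique: "vge x m \<Longrightarrow> veq x n \<Longrightarrow> m \<le> n"
  by (auto simp: veq_def vge_def)

lemma veq_add: "veq x n \<Longrightarrow> vge y m \<Longrightarrow> n < m \<Longrightarrow> veq (x + y) n"
proof -
  assume *: "veq x n" "vge y m" "n < m"
  have "x + y \<noteq> 0"
  proof
    assume "x + y = 0"
    then have "y = - x" by (simp add: eq_neg_iff_add_eq_0 add.commute)
    then show False using * vge_veq_unique by fastforce
  qed
  moreover have "n \<le> v (x + y)"
    using vge_add[of x n y] * veq_vge vge_mono[of y m n] \<open>x + y \<noteq> 0\<close> by (auto simp: vge_def)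
  moreover have "v (x + y) \<le> n"
  proof (rule ccontr)
    assume "\<not> v (x + y) \<le> n"
    then have "vge (x + y) (n + 1)" "vge y (n + 1)" using * vge_mono by (auto simp: vge_def)
    then have "vge x (n + 1)" using vge_diff by fastforce
    then show False using *(1) vge_veq_unique by fastforce
  qed
  ultimately show ?thesis by (simp add: veq_def)
qed

lemma veq_add': "vge x m \<Longrightarrow> veq y n \<Longrightarrow> n < m \<Longrightarrow> veq (x + y) n"
  using veq_add[of y n x m] by (simp add: add.commute)

lemma veq_diff: "veq x n \<Longrightarrow> vge y m \<Longrightarrow> n < m \<Longrightarrow> veq (x - y) n"
  using veq_add[of x n "-y" m] by simp

lemma veq_cong: "veq x n \<Longrightarrow> vge (x - y) m \<Longrightarrow> n < m \<Longrightarrow> veq y n"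
  using veq_add[of x n "y - x" m] vge_minus[of "x - y" m] by simp

lemma not_vge: "\<not> vge x n \<longleftrightarrow> (\<exists>m < n. veq x m)"
  by (auto simp: veq_def vge_def)

lemma vge_Suc: "vge x n \<Longrightarrow> \<not> vge x (n + 1) \<Longrightarrow> veq x n"
  by (auto simp: veq_def vge_def)

lemma vge_int [simp]: "vge (of_int k) 0"
proof -
  have "vge (of_nat n) 0" for n
    by (induction n) (auto intro!: vge_add simp: vge_def[of 1])
  then show ?thesis by (cases k rule: int_cases2) simp_all
qed

lemma vge_numeral [simp]: "vge (numeral n) 0" "vge 1 0"
  using vge_int[of "numeral n"] vge_int[of 1] by simp_all

lemma p_gt1: "p > 1"
  using p prime_gt_1_int by blast

lemma veq_p: "veq (of_int p) 2"
  using v_p p_gt1 by (auto simp: veq_def)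

lemma vge_intI: "p ^ n dvd k \<Longrightarrow> m \<le> 2 * int n \<Longrightarrow> vge (of_int k) m"
proof (elim dvdE)
  fix l assume *: "k = p ^ n * l" "m \<le> 2 * int n"
  have "veq (of_int p ^ n) (int n * 2)" using veq_power[OF veq_p] by simp
  then have "vge (of_int p ^ n * of_int l) m" using *(2) by (intro vge_mult[OF veq_vge vge_int]) auto
  then show "vge (of_int k) m" by (simp add: *)
qed

lemma veq_unit: "\<not> p dvd k \<Longrightarrow> veq (of_int k) 0"
proof -
  assume "\<not> p dvd k"
  then have "coprime k p" using p by (metis coprime_commute prime_imp_coprime)
  then obtain j e where "j * k + e * p = 1" using bezout_int[of k p] by auto
  then have "of_int (j * k + e * p) = (1 :: 'k)" by simp
  then have e: "(of_int j * of_int k + of_int e * of_int p :: 'k) = 1" by simp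
  show ?thesis
  proof (rule ccontr)
    assume "\<not> veq (of_int k) 0"
    then have "vge (of_int k) 1" using vge_int[of k] by (auto simp: veq_def vge_def)
    then have "vge (of_int j * of_int k) 1" "vge (of_int e * of_int p) 1"
      using vge_mult[OF vge_int] vge_mult[OF vge_int veq_vge[OF veq_p order_refl]] by auto
    then have "vge 1 1" using vge_add e by metis
    then show False by (simp add: vge_def)
  qed
qed

lemma veq_intI: "k = p ^ n * l \<Longrightarrow> \<not> p dvd l \<Longrightarrow> m = 2 * int n \<Longrightarrow> veq (of_int k) m"
  using veq_mult[OF veq_power[OF veq_p refl] veq_unit[of l], of m n] by simp

lemma vge_int_1_iff: "vge (of_int k) 1 \<longleftrightarrow> p dvd k"
  using veq_unit[of k] vge_veq_unique[of "of_int k" 1 0] vge_intI[of 1 k 1] by auto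

lemma vge_prod_1:
  assumes "vge (x * y) 1" "vge x 0" "vge y 0"
  shows "vge x 1 \<or> vge y 1"
  using assms by (cases "x = 0"; cases "y = 0") (auto simp: vge_def v_mult)

lemma vge_power_1: "vge (x ^ n) 1 \<Longrightarrow> vge x 0 \<Longrightarrow> n > 0 \<Longrightarrow> vge x 1"
  by (cases "x = 0"; cases "v x = 0") (auto simp: vge_def v_power)

text \<open>An inverse of \<open>a\<close> modulo \<open>p\<close> solves the congruence: a
  remainder of degree one forces the residue of x into the prime field.\<close>

lemma residue_int:
  assumes "\<not> p dvd a" "vge (of_int a * x + of_int b) 1" "vge x 0"
  shows "\<exists>r\<in>{0..<p}. vge (x - of_int r) 1"
proof -
  have "coprime a p" using assms(1) p by (metis coprime_commute prime_imp_coprime)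
  then obtain j e where je: "j * a + e * p = 1" using bezout_int[of a p] by auto
  define r where "r = (- (j * b)) mod p"
  obtain d where d: "r = - (j * b) + p * d"
    unfolding r_def by (metis add.commute minus_mult_div_eq_mod mult_minus_right uminus_add_conv_diff)
  have "x - of_int r = of_int j * (of_int a * x + of_int b) + of_int p * (of_int e * x - of_int d)"
  proof -
    have "x = of_int (j * a + e * p) * x" using je by simp
    then have "x = of_int j * of_int a * x + of_int e * of_int p * x" by (simp add: algebra_simps)
    then show ?thesis by (simp add: d algebra_simps)
  qed
  moreover have "vge (of_int j * (of_int a * x + of_int b)) 1"
    using vge_mult[OF vge_int assms(2)] by simp
  moreover have "vge (of_int p * (of_int e * x - of_int d)) 1"
    by (rule vge_mult[OF veq_vge[OF veq_p order_refl] vge_diff[OF vge_mult[OF vge_int assms(3)] vge_int]]) auto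
  ultimately have "vge (x - of_int r) 1" using vge_add by metis
  moreover have "r \<in> {0..<p}" using p_gt1 by (simp add: r_def)
  ultimately show ?thesis by blast
qed

text \<open>The residue field has at most \<open>p^2\<close> elements.\<close>

lemma residue_cases:
  assumes x: "vge x 0"
  obtains r where "r \<in> {0..<p}" "vge (x - of_int r) 1"
  | s t where "s \<in> {0..<p}" "t \<in> {0..<p}" "vge (x ^ 2 - (of_int s * x + of_int t)) 1"
proof -
  obtain a b c :: int where g: "gcd a (gcd b c) = 1"
    and eq: "of_int a * x^2 + of_int b * x + of_int c * 1 = 0"
    using quadratic_field_coprime_relation[OF K] by metis
  have x2: "vge (x ^ 2) 0" using vge_power[OF x, of 0 2] by simp
  have dvd: "vge (of_int k * y) 1" if "p dvd k" "vge y 0" for k y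
    using vge_mult[OF vge_intI[of 1 k 1] that(2)] that(1) by simp
  consider "\<not> p dvd a" | "p dvd a" "\<not> p dvd b" | "p dvd a" "p dvd b" "\<not> p dvd c"
    using g p by (metis gcd_greatest not_prime_unit)
  then show thesis
  proof cases
    case 1
    have "coprime a p" using 1 p by (metis coprime_commute prime_imp_coprime)
    then obtain j e where je: "j * a + e * p = 1" using bezout_int[of a p] by auto
    define s t where "s = (- (j * b)) mod p" and "t = (- (j * c)) mod p"
    have md: "\<exists>d. u mod p = u + p * d" for u
      by (rule exI[of _ "- (u div p)"]) (simp add: minus_mult_div_eq_mod)
    obtain d where d: "s = - (j * b) + p * d" using md unfolding s_def by blast
    obtain f where f: "t = - (j * c) + p * f" using md unfolding t_def by blast
    have "x ^ 2 - (of_int s * x + of_int t)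
      = of_int j * (of_int a * x^2 + of_int b * x + of_int c * 1) + of_int p * (of_int e * x^2 - of_int d * x - of_int f)"
    proof -
      have "x^2 = of_int (j * a + e * p) * x^2" using je by simp
      then have "x^2 = of_int j * of_int a * x^2 + of_int e * of_int p * x^2" by (simp add: algebra_simps)
      then show ?thesis by (simp add: d f algebra_simps)
    qed
    also have "\<dots> = of_int p * (of_int e * x^2 - of_int d * x - of_int f)" using eq by simp
    finally have "vge (x ^ 2 - (of_int s * x + of_int t)) 1"
      using dvd[OF dvd_refl vge_diff[OF vge_diff[OF vge_mult[OF vge_int x2] vge_mult[OF vge_int x]] vge_int]]
      by simp
    moreover have "s \<in> {0..<p}" "t \<in> {0..<p}" using p_gt1 by (simp_all add: s_def t_def)
    ultimately show thesis using that(2) by blast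
  next
    case 2
    have "of_int b * x + of_int c = - (of_int a * x^2)" using eq by (simp add: eq_neg_iff_add_eq_0 algebra_simps)
    then have "vge (of_int b * x + of_int c) 1" using dvd[OF 2(1) x2] by simp
    then show thesis using residue_int 2(2) x that(1) by blast
  next
    case 3
    have "of_int c = - (of_int a * x^2 + of_int b * x)" using eq by (simp add: eq_neg_iff_add_eq_0 algebra_simps)
    then have "vge (of_int c) 1"
      using vge_add[OF dvd[OF 3(1) x2] dvd[OF 3(2) x]] by (simp only: vge_minus)
    then show thesis using 3(3) by (simp add: vge_int_1_iff)
  qed
qed

end

section \<open>The group law\<close>

text \<open>In characteristic 0 the coefficients a1 and a3 can be removed by completing the square.
  The x^2 term is kept: it allows small integral points, and at 2 it absorbs the term X Y of a model
  with good or multiplicative reduction.\<close>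

locale short_weierstrass =
  fixes a b c :: "'k::field_char_0"
  assumes disc: "discriminant (Weierstrass 0 a 0 b c) \<noteq> 0"
begin

abbreviation E :: "'k weierstrass" where "E \<equiv> Weierstrass 0 a 0 b c"
abbreviation F :: "'k \<Rightarrow> 'k" where "F x \<equiv> x ^ 3 + a * x ^ 2 + b * x + c"
text \<open>The divided difference of \<open>F\<close>: \<open>F x - F y = (x - y) * Q x y\<close>,
  and \<open>Q x x\<close> is the derivative.\<close>

abbreviation Q :: "'k \<Rightarrow> 'k \<Rightarrow> 'k" where
  "Q x y \<equiv> x ^ 2 + x * y + y ^ 2 + a * (x + y) + b"

fun neg :: "'k ec_point \<Rightarrow> 'k ec_point" where
  "neg Point_At_Infinity = Point_At_Infinity"
| "neg (Affine x y) = Affine x (- y)"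

text \<open>\<open>l\<close> is the slope of the line through two points; the second equation determines it for the
  tangent, and both always hold.\<close>

definition chord :: "'k \<Rightarrow> 'k \<Rightarrow> 'k \<Rightarrow> 'k \<Rightarrow> 'k \<Rightarrow> bool" where
  "chord x1 y1 x2 y2 l \<longleftrightarrow> l * (x2 - x1) = y2 - y1 \<and> l * (y1 + y2) = Q x1 x2"

lemma chordD: "chord x1 y1 x2 y2 l \<Longrightarrow> l * (x2 - x1) = y2 - y1"
  "chord x1 y1 x2 y2 l \<Longrightarrow> l * (y1 + y2) = Q x1 x2"
  by (auto simp: chord_def)

lemma nonsingular:
  assumes "F x = 0" "3 * x ^ 2 + 2 * a * x + b = 0"
  shows False
proof -
  have b: "b = - (3 * x ^ 2 + 2 * a * x)" using assms(2) by (simp add: eq_neg_iff_add_eq_0 algebra_simps)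
  have c: "c = - (x ^ 3 + a * x ^ 2 + b * x)" using assms(1) by (simp add: eq_neg_iff_add_eq_0 algebra_simps)
  have "discriminant E = 0"
    unfolding c b by (simp add: Let_def algebra_simps power2_eq_square power3_eq_cube)
  then show False using disc by simp
qed

lemma on_curve_iff [simp]: "on_curve E (Affine x y) \<longleftrightarrow> y ^ 2 = F x"
  by simp

text \<open>The line meets the curve over x1 and x2, and the coefficient of x^2 gives the third
  root. The second equation in \<open>chord\<close> makes the identity valid for tangents as
  well.\<close>

lemma line_identity:
  assumes "y1 ^ 2 = F x1" "chord x1 y1 x2 y2 l"
  shows "F x - (y1 + l * (x - x1)) ^ 2 = (x - x1) * (x - x2) * (x - (l ^ 2 - a - x1 - x2))"
proof -
  have "Q x1 x2 = l * (2 * y1 + l * (x2 - x1))"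
    using chordD[OF assms(2)] by Groebner_Basis.algebra
  moreover have "F x - (y1 + l * (x - x1)) ^ 2 = (x - x1) * (x - x2) * (x - (l ^ 2 - a - x1 - x2))
      + (F x1 - y1 ^ 2) + (x - x1) * (Q x1 x2 - l * (2 * y1 + l * (x2 - x1)))"
    by (simp add: algebra_simps power2_eq_square power3_eq_cube)
  ultimately show ?thesis using assms(1) by simp
qed

lemma chord_exists:
  assumes "y1 ^ 2 = F x1" "y2 ^ 2 = F x2" "\<not> (x1 = x2 \<and> y1 + y2 = 0)"
  shows "chord x1 y1 x2 y2 (if x1 = x2 then (3 * x1 ^ 2 + 2 * a * x1 + b) / (2 * y1) else (y2 - y1) / (x2 - x1))"
proof (cases "x1 = x2")
  case True
  have "y1 ^ 2 = y2 ^ 2" using assms True by simp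
  then have "y1 = y2" using assms(3) True by (auto simp: power2_eq_iff)
  moreover have "y1 \<noteq> 0" using calculation assms(3) True by auto
  ultimately show ?thesis using True
    by (simp add: chord_def field_simps power2_eq_square)
next
  case False
  have "(y2 - y1) * (y1 + y2) = (x2 - x1) * Q x1 x2"
  proof -
    have "(y2 - y1) * (y1 + y2) = y2 ^ 2 - y1 ^ 2" by (simp add: algebra_simps power2_eq_square)
    then show ?thesis unfolding assms by (simp add: algebra_simps power2_eq_square power3_eq_cube)
  qed
  then show ?thesis using False by (simp add: chord_def nonzero_divide_eq_eq mult.commute)
qed

lemma chord_unique:
  assumes "chord x1 y1 x2 y2 l" "chord x1 y1 x2 y2 m" "\<not> (x1 = x2 \<and> y1 + y2 = 0)"
  shows "l = m"
proof (cases "x1 = x2")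
  case True
  then have "y1 + y2 \<noteq> 0" using assms(3) by simp
  moreover have "l * (y1 + y2) = m * (y1 + y2)" using assms by (simp add: chord_def)
  ultimately show ?thesis by simp
next
  case False
  moreover have "l * (x2 - x1) = m * (x2 - x1)" using assms by (simp add: chord_def)
  ultimately show ?thesis by simp
qed

lemma add_chord:
  assumes "y1 ^ 2 = F x1" "y2 ^ 2 = F x2" "chord x1 y1 x2 y2 l" "\<not> (x1 = x2 \<and> y1 + y2 = 0)"
  shows "ec_add E (Affine x1 y1) (Affine x2 y2)
    = Affine (l ^ 2 - a - x1 - x2) (- (l * (l ^ 2 - a - x1 - x2 - x1) + y1))"
proof -
  have l: "l = (if x1 = x2 then (3 * x1 ^ 2 + 2 * a * x1 + b) / (2 * y1) else (y2 - y1) / (x2 - x1))"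
    by (rule chord_unique[OF assms(3) chord_exists[OF assms(1,2,4)] assms(4)])
  show ?thesis using assms(4) by (simp add: Let_def l)
qed

lemma add_infinity [simp]: "ec_add E P Point_At_Infinity = P" "ec_add E Point_At_Infinity P = P"
  by (cases P; simp)+

lemma chord_sym: "chord x1 y1 x2 y2 l \<Longrightarrow> chord x2 y2 x1 y1 l"
  unfolding chord_def by (simp add: algebra_simps)

lemma add_commute:
  assumes "on_curve E P" "on_curve E R"
  shows "ec_add E P R = ec_add E R P"
proof (cases P; cases R)
  fix x1 y1 x2 y2 assume PR: "P = Affine x1 y1" "R = Affine x2 y2"
  show ?thesis
  proof (cases "x1 = x2 \<and> y1 + y2 = 0")
    case True
    then show ?thesis unfolding PR by (simp add: add.commute)
  next
    case False
    then have False': "\<not> (x2 = x1 \<and> y2 + y1 = 0)" by (simp add: add.commute)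
    have on: "y1 ^ 2 = F x1" "y2 ^ 2 = F x2" using assms PR by auto
    obtain l where l: "chord x1 y1 x2 y2 l" using chord_exists False on by blast
    have "l * (x2 - x1) = y2 - y1" using chordD(1)[OF l] .
    then show ?thesis
      using add_chord[OF _ _ l False] add_chord[OF _ _ chord_sym[OF l] False'] assms PR
      by (simp add: algebra_simps)
  qed
qed auto

lemma add_on_curve:
  assumes "on_curve E P" "on_curve E R"
  shows "on_curve E (ec_add E P R)"
proof (cases P; cases R)
  fix x1 y1 x2 y2 assume PR: "P = Affine x1 y1" "R = Affine x2 y2"
  show ?thesis
  proof (cases "x1 = x2 \<and> y1 + y2 = 0")
    case True
    then show ?thesis unfolding PR by simp
  next
    case False
    have on: "y1 ^ 2 = F x1" "y2 ^ 2 = F x2" using assms PR by auto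
    obtain l where l: "chord x1 y1 x2 y2 l" using chord_exists False on by blast
    define x where "x = l ^ 2 - a - x1 - x2"
    have "F x - (y1 + l * (x - x1)) ^ 2 = 0"
      using line_identity[OF on(1) l, of x] by (simp add: x_def)
    moreover have "(- (l * (x - x1) + y1)) ^ 2 = (y1 + l * (x - x1)) ^ 2" by Groebner_Basis.algebra
    ultimately have "(- (l * (x - x1) + y1)) ^ 2 = F x" by simp
    then show ?thesis using add_chord[OF on l False] PR unfolding x_def by simp
  qed
qed (use assms in auto)

lemma neg_on_curve: "on_curve E P \<Longrightarrow> on_curve E (neg P)"
  by (cases P) auto

lemma neg_neg [simp]: "neg (neg P) = P"
  by (cases P) auto

lemma add_neg: "ec_add E P (neg P) = Point_At_Infinity" "ec_add E (neg P) P = Point_At_Infinity"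
  by (cases P; simp)+

lemma neg_add:
  assumes "on_curve E P" "on_curve E R"
  shows "ec_add E (neg P) (neg R) = neg (ec_add E P R)"
proof (cases P; cases R)
  fix x1 y1 x2 y2 assume PR: "P = Affine x1 y1" "R = Affine x2 y2"
  have on: "y1 ^ 2 = F x1" "y2 ^ 2 = F x2" using assms PR by auto
  show ?thesis
  proof (cases "x1 = x2 \<and> y1 + y2 = 0")
    case True
    then have "y2 = - y1" by (simp add: add_eq_0_iff)
    then show ?thesis unfolding PR using True by simp
  next
    case False
    then have False': "\<not> (x1 = x2 \<and> - y1 + - y2 = 0)" 
      by (auto simp: add_eq_0_iff)
    obtain l where l: "chord x1 y1 x2 y2 l" using chord_exists False on by blast
    have "chord x1 (- y1) x2 (- y2) (- l)" using l unfolding chord_def by (auto simp: algebra_simps)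
    from add_chord[OF _ _ this False'] on add_chord[OF on l False]
    show ?thesis unfolding PR by (simp add: algebra_simps)
  qed
qed auto

lemma add_eq_infinity:
  assumes "ec_add E P R = Point_At_Infinity"
  shows "R = neg P"
  using assms by (cases P; cases R) (auto simp: Let_def add_eq_0_iff split: if_splits)

text \<open>The points \<open>-P\<close>, \<open>-R\<close> and \<open>P + R\<close> are collinear.\<close>

lemma add_cancel:
  assumes P: "on_curve E P" and R: "on_curve E R"
  shows "ec_add E (ec_add E P R) (neg R) = P"
proof (cases P; cases R)
  fix x1 y1 x2 y2 assume PR: "P = Affine x1 y1" "R = Affine x2 y2"
  have on: "y1 ^ 2 = F x1" "y2 ^ 2 = F x2" using assms PR by auto
  show ?thesis
  proof (cases "x1 = x2 \<and> y1 + y2 = 0")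
    case True
    then have "y1 = - y2" by (simp add: add_eq_0_iff2)
    then show ?thesis unfolding PR using True by simp
  next
    case False
    obtain l where l: "chord x1 y1 x2 y2 l" using chord_exists False on by blast
    define x3 where "x3 = l ^ 2 - a - x1 - x2"
    define y3 where "y3 = - (l * (x3 - x1) + y1)"
    have add: "ec_add E P R = Affine x3 y3" using add_chord[OF on l False] by (simp add: PR x3_def y3_def)
    then have on3: "y3 ^ 2 = F x3" using add_on_curve[OF P R] by simp
    have l1: "l * (x2 - x1) = y2 - y1" and l2: "l * (y1 + y2) = Q x1 x2" using chordD[OF l] .
    have y3': "y3 = - (l * (x3 - x2) + y2)" using l1 by (simp add: y3_def algebra_simps)
    have a: "a = l ^ 2 - x1 - x2 - x3" by (simp add: x3_def)
    \<comment> \<open>In the excluded case P + R = R the ordinate \<open>y2\<close> vanishes and the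
      line meets the curve doubly at \<open>x2\<close>, so \<open>F\<close> would have a double root
      there.\<close>
    have nc: "\<not> (x3 = x2 \<and> y3 + - y2 = 0)"
    proof
      assume *: "x3 = x2 \<and> y3 + - y2 = 0"
      then have e: "x3 = x2" "y3 = y2" by simp_all
      have "y3 = - y2" using y3' unfolding e(1) by simp
      then have "y2 = - y2" unfolding e(2) .
      then have "2 * y2 = 0" by Groebner_Basis.algebra
      then have y2: "y2 = 0" by simp
      have "3 * x2 ^ 2 + 2 * a * x2 + b = Q x1 x2 - l * (y1 + y2) + l * (l * (x2 - x1) - (y2 - y1)) + 2 * l * y2"
        unfolding a using * by (simp add: algebra_simps power2_eq_square)
      also have "\<dots> = 0" using l1 l2 y2 by simp
      finally show False using nonsingular[of x2] on(2) y2 by simp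
    qed
    have "chord x3 y3 x2 (- y2) (- l)" unfolding chord_def
    proof
      show "- l * (x2 - x3) = - y2 - y3" using y3' by (simp add: algebra_simps)
      have "- l * (y3 + - y2) - Q x3 x2 = l * (y1 + y2) - Q x1 x2 + l * (y2 - y1 - l * (x2 - x1))"
        unfolding y3' a by (simp add: algebra_simps power2_eq_square)
      then show "- l * (y3 + - y2) = Q x3 x2" using l1 l2 by simp
    qed
    from add_chord[OF on3 _ this nc] on(2)
    have "ec_add E (Affine x3 y3) (Affine x2 (- y2)) = Affine (l^2 - a - x3 - x2) (l * (l^2 - a - x3 - x2 - x3) - y3)"
      by (simp add: algebra_simps)
    also have "l^2 - a - x3 - x2 = x1" by (simp add: x3_def)
    also have "l * (x1 - x3) - y3 = y1" by (simp add: y3_def algebra_simps)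
    finally show ?thesis using add PR by simp
  qed
qed (auto simp: add_neg)

lemma add_cancel':
  assumes "on_curve E P" "on_curve E R"
  shows "ec_add E P (ec_add E (neg P) R) = R"
  using add_cancel[of R "neg P"] assms add_commute add_on_curve neg_on_curve neg_neg by metis

text \<open>With \<open>l12\<close>, \<open>l23\<close> and \<open>m\<close> the slopes through \<open>P1, P2\<close>, through \<open>P2, P3\<close> and through
  \<open>P1 + P2, P3\<close>, the parabola through \<open>P1, P2, P3\<close> has leading coefficient \<open>1 / (l12 + m)\<close>; this
  is the corresponding divided difference.\<close>

lemma divided_difference:
  assumes on: "y1 ^ 2 = F x1" "y2 ^ 2 = F x2" "y3 ^ 2 = F x3"
    and l12: "chord x1 y1 x2 y2 l12" and l23: "chord x2 y2 x3 y3 l23"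
    and x: "x = l12 ^ 2 - a - x1 - x2" and y: "y = - (l12 * (x - x1) + y1)"
    and m: "chord x y x3 y3 m" and n: "\<not> (x = x3 \<and> y + y3 = 0)"
  shows "(l12 + m) * (l23 - l12) = x3 - x1"
proof -
  note e = chordD[OF l12] chordD[OF l23]
  have 1: "(y1 + y3 + l12 * (x3 - x1)) * (l23 - l12) = (x3 - x1) * (x3 - x)"
  proof -
    have "(y1 + y3 + l12 * (x3 - x1)) * (l23 - l12) - (x3 - x1) * (x3 - x)
      = (l23 * (y2 + y3) - Q x2 x3) - (l12 * (y1 + y2) - Q x1 x2)
        + l23 * (l12 * (x2 - x1) - (y2 - y1)) + l12 * (l23 * (x3 - x2) - (y3 - y2))"
      unfolding x by (simp add: algebra_simps power2_eq_square)
    then show ?thesis using e by simp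
  qed
  show ?thesis
  proof (cases "x = x3")
    case False
    have "(l12 + m) * (x3 - x) = y1 + y3 + l12 * (x3 - x1)"
      using chordD(1)[OF m] by (simp add: y algebra_simps)
    then have "(l12 + m) * (l23 - l12) * (x3 - x) = (x3 - x1) * (x3 - x)"
      using 1 by (metis mult.assoc mult.commute)
    then show ?thesis using False by simp
  next
    case True
    have y3: "y3 = y" and "y3 \<noteq> 0"
    proof -
      have "F x - (y1 + l12 * (x - x1)) ^ 2 = 0"
        using line_identity[OF on(1) l12, of x] by (simp add: x)
      moreover have "y ^ 2 = (y1 + l12 * (x - x1)) ^ 2" unfolding y by Groebner_Basis.algebra
      ultimately have "y ^ 2 = y3 ^ 2" using on(3) True by simp
      then show "y3 = y" using n True by (auto simp: power2_eq_iff)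
      then show "y3 \<noteq> 0" using n True by auto
    qed
    have "(l12 + m) * (2 * y3) = (x3 - x1) * (x3 - x2)"
    proof -
      have "m * (2 * y3) = Q x3 x3" using chordD(2)[OF m] True y3 by simp
      moreover have "Q x3 x3 + l12 * (2 * y3) = (x3 - x1) * (x3 - x2)
        + (Q x1 x2 - l12 * (y1 + y2)) + l12 * (y2 - y1 - l12 * (x2 - x1))"
        unfolding y3 y True[symmetric] unfolding x by (simp add: algebra_simps power2_eq_square)
      moreover have "Q x1 x2 - l12 * (y1 + y2) = 0" "y2 - y1 - l12 * (x2 - x1) = 0" using e by simp_all
      ultimately show ?thesis by Groebner_Basis.algebra
    qed
    moreover have "(x3 - x2) * (l23 - l12) = 2 * y3"
    proof -
      have "y3 = - (l12 * (x3 - x1) + y1)" using y y3 True by simp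
      then show ?thesis using e(1,3) by Groebner_Basis.algebra
    qed
    ultimately have "(l12 + m) * (l23 - l12) * (2 * y3) = (x3 - x1) * (2 * y3)"
      by (metis mult.assoc mult.commute)
    then show ?thesis using \<open>y3 \<noteq> 0\<close> by simp
  qed
qed

text \<open>Comparing (P1 + P2) + P3 with (P3 + P2) + P1 makes the problem symmetric. By
  \<open>divided_difference\<close> both sums of slopes, l + m and k + n, equal (x3 - x1) / (k - l);
  from l + m = k + n the two coordinates of the results agree by direct computation.\<close>

lemma add_assoc_affine:
  assumes on: "y1 ^ 2 = F x1" "y2 ^ 2 = F x2" "y3 ^ 2 = F x3"
    and ne: "\<not> (x1 = x2 \<and> y1 + y2 = 0)" "\<not> (x2 = x3 \<and> y2 + y3 = 0)" "x1 \<noteq> x3"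
    and n12: "ec_add E (ec_add E (Affine x1 y1) (Affine x2 y2)) (Affine x3 y3) \<noteq> Point_At_Infinity"
    and n23: "ec_add E (ec_add E (Affine x3 y3) (Affine x2 y2)) (Affine x1 y1) \<noteq> Point_At_Infinity"
  shows "ec_add E (ec_add E (Affine x1 y1) (Affine x2 y2)) (Affine x3 y3)
    = ec_add E (ec_add E (Affine x3 y3) (Affine x2 y2)) (Affine x1 y1)"
proof -
  have ne': "\<not> (x3 = x2 \<and> y3 + y2 = 0)" using ne(2) by (auto simp: add.commute)
  obtain l where l: "chord x1 y1 x2 y2 l" using chord_exists on ne by blast
  obtain k where k: "chord x3 y3 x2 y2 k" using chord_exists on ne' by blast
  define x y where "x = l ^ 2 - a - x1 - x2" and "y = - (l * (x - x1) + y1)"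
  define z w where "z = k ^ 2 - a - x3 - x2" and "w = - (k * (z - x3) + y3)"
  have xy: "ec_add E (Affine x1 y1) (Affine x2 y2) = Affine x y"
    using add_chord[OF on(1,2) l ne(1)] by (simp add: x_def y_def)
  have zw: "ec_add E (Affine x3 y3) (Affine x2 y2) = Affine z w"
    using add_chord[OF on(3,2) k ne'] by (simp add: z_def w_def)
  have on': "y ^ 2 = F x" "w ^ 2 = F z"
    using add_on_curve[of "Affine x1 y1" "Affine x2 y2"] add_on_curve[of "Affine x3 y3" "Affine x2 y2"]
      xy zw on by simp_all
  have nx: "\<not> (x = x3 \<and> y + y3 = 0)" using n12 xy by auto
  have nz: "\<not> (z = x1 \<and> w + y1 = 0)" using n23 zw by auto
  obtain m where m: "chord x y x3 y3 m" using chord_exists on(3) on'(1) nx by blast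
  obtain n where n: "chord z w x1 y1 n" using chord_exists on(1) on'(2) nz by blast
  have d1: "(l + m) * (k - l) = x3 - x1"
    using divided_difference[OF on l chord_sym[OF k] x_def y_def m nx] .
  have d2: "(k + n) * (l - k) = x1 - x3"
    using divided_difference[OF on(3,2,1) k chord_sym[OF l] z_def w_def n nz] .
  have "(l + m) * (k - l) = (k + n) * (k - l)" using d1 d2 by Groebner_Basis.algebra
  moreover have "k - l \<noteq> 0" using d1 ne(3) by auto
  ultimately have s: "l + m = k + n" by simp
  define s where "s = l + m"
  have m': "m = s - l" by (simp add: s_def)
  have n': "n = s - k" unfolding s_def s by simp
  have d: "s * (k - l) = x3 - x1" using d1 by (simp add: s_def)
  have X: "m ^ 2 - a - x - x3 = n ^ 2 - a - z - x1"
  proof -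
    have "(m ^ 2 - a - x - x3) - (n ^ 2 - a - z - x1) = 2 * (s * (k - l) - (x3 - x1))"
      unfolding m' n' x_def z_def by (simp add: algebra_simps power2_eq_square)
    also have "\<dots> = 0" using d by simp
    finally show ?thesis by (rule iffD1[OF right_minus_eq])
  qed
  define X where "X = m ^ 2 - a - x - x3"
  have "m * (X - x) + y = n * (X - z) + w"
  proof -
    have 1: "m * (X - x) + y = m * (X - x3) + y3" using chordD(1)[OF m] by (simp add: algebra_simps)
    have 2: "n * (X - z) + w = n * (X - x1) + y1" using chordD(1)[OF n] by (simp add: algebra_simps)
    have "(m * (X - x3) + y3) - (n * (X - x1) + y1)
      = (s * (k - l) - (x3 - x1)) * s - 2 * l * (s * (k - l) - (x3 - x1)) 
         + (k * (x2 - x3) - (y2 - y3)) - (l * (x2 - x1) - (y2 - y1))"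
      unfolding X_def m' n' x_def by (simp add: algebra_simps power2_eq_square)
    then show ?thesis using 1 2 d chordD(1)[OF l] chordD(1)[OF k] by simp
  qed
  then show ?thesis
    unfolding xy zw add_chord[OF on'(1) on(3) m nx] add_chord[OF on'(2) on(1) n nz]
    unfolding X X_def by (simp only:)
qed

text \<open>Every degenerate position left out by \<open>add_assoc_affine\<close> follows from
  cancellation and commutativity alone.\<close>

lemma add_assoc:
  assumes P: "on_curve E P" and R: "on_curve E R" and S: "on_curve E S"
  shows "ec_add E (ec_add E P R) S = ec_add E P (ec_add E R S)"
proof -
  note cl = add_on_curve neg_on_curve
  consider "P = Point_At_Infinity \<or> R = Point_At_Infinity \<or> S = Point_At_Infinity"
    | "R = neg P" | "R = neg S" | "S = P" | "S = neg P"
    | "ec_add E (ec_add E P R) S = Point_At_Infinity" | "ec_add E (ec_add E S R) P = Point_At_Infinity"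
    | x1 y1 x2 y2 x3 y3 where "P = Affine x1 y1" "R = Affine x2 y2" "S = Affine x3 y3"
      "R \<noteq> neg P" "R \<noteq> neg S" "S \<noteq> P" "S \<noteq> neg P"
      "ec_add E (ec_add E P R) S \<noteq> Point_At_Infinity" "ec_add E (ec_add E S R) P \<noteq> Point_At_Infinity"
    by (cases P; cases R; cases S) auto
  then show ?thesis
  proof cases
    case 1 then show ?thesis by auto
  next
    case 2 then show ?thesis using add_cancel'[OF P S] by (simp add: add_neg)
  next
    case 3 then show ?thesis using add_cancel[OF P neg_on_curve[OF S]] by (simp add: add_neg)
  next
    case 4 then show ?thesis using add_commute P R cl by metis
  next
    case 5
    have "ec_add E (ec_add E P R) S = R"
      using 5 add_cancel[OF R P] add_commute[OF P R] by simp
    moreover have "ec_add E P (ec_add E R S) = R"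
      using 5 add_cancel'[OF P R] add_commute[OF R S] by simp
    ultimately show ?thesis by simp
  next
    case 6
    then have "S = neg (ec_add E P R)" by (rule add_eq_infinity)
    then have "ec_add E P R = neg S" by simp
    then have "P = neg (ec_add E S R)" using add_cancel[OF P R] neg_add[OF S R] by simp
    then have "ec_add E P (ec_add E R S) = Point_At_Infinity"
      using add_commute[OF R S] by (simp add: add_neg)
    then show ?thesis using 6 by simp
  next
    case 7
    then have P': "P = neg (ec_add E S R)" by (rule add_eq_infinity)
    then have "ec_add E P R = neg S"
      using add_cancel[OF neg_on_curve[OF S] neg_on_curve[OF R]] neg_add[OF S R] by simp
    moreover have "ec_add E P (ec_add E R S) = Point_At_Infinity"
      using add_commute[OF R S] P' by (simp add: add_neg)
    ultimately show ?thesis by (simp add: add_neg)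
  next
    case 8
    have on: "y1 ^ 2 = F x1" "y2 ^ 2 = F x2" "y3 ^ 2 = F x3" using P R S 8 by auto
    have "\<not> (x1 = x2 \<and> y1 + y2 = 0)" "\<not> (x2 = x3 \<and> y2 + y3 = 0)"
      using 8 by (auto simp: eq_neg_iff_add_eq_0 add.commute)
    moreover have "x1 \<noteq> x3"
    proof
      assume "x1 = x3"
      then have "y1 ^ 2 = y3 ^ 2" using on by simp
      then show False using 8 \<open>x1 = x3\<close> by (auto simp: power2_eq_iff)
    qed
    ultimately have "ec_add E (ec_add E P R) S = ec_add E (ec_add E S R) P"
      using add_assoc_affine[OF on] 8 by simp
    then show ?thesis using add_commute P R S cl by metis
  qed
qed

lemma comm_group_ec: "comm_group (ec_group E)"
proof (rule comm_groupI)
  fix P assume "P \<in> carrier (ec_group E)"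
  then show "\<exists>R\<in>carrier (ec_group E). R \<otimes>\<^bsub>ec_group E\<^esub> P = \<one>\<^bsub>ec_group E\<^esub>"
    using add_neg(2) neg_on_curve by (auto simp: ec_group_def intro!: bexI[of _ "neg P"])
qed (auto simp: ec_group_def add_assoc add_on_curve simp del: ec_add.simps intro: add_commute)

end

section \<open>Torsion of abelian groups\<close>

context comm_group
begin

text \<open>The elements whose order is finite and prime to q; on them the q-th power map is a
  bijection, which drives both the descents and the extraction of roots.\<close>

definition coprime_torsion :: "nat \<Rightarrow> 'a \<Rightarrow> bool" where
  "coprime_torsion q x \<longleftrightarrow> x \<in> carrier G \<and> (\<exists>n > 0. coprime n q \<and> x [^] (n::nat) = \<one>)"

lemma pow_mult_add: "x \<in> carrier G \<Longrightarrow> x [^] (n * w + d :: nat) = (x [^] n) [^] w \<otimes> x [^] d"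
  by (simp add: nat_pow_mult nat_pow_pow)

lemma coprime_torsion_carrier: "coprime_torsion q x \<Longrightarrow> x \<in> carrier G"
  by (simp add: coprime_torsion_def)

lemma coprime_torsion_one: "coprime_torsion q \<one>"
  unfolding coprime_torsion_def by (auto intro!: exI[of _ 1])

lemma coprime_torsion_mult:
  assumes "coprime_torsion q x" "coprime_torsion q y"
  shows "coprime_torsion q (x \<otimes> y)"
proof -
  obtain n m :: nat where *: "n > 0" "coprime n q" "x [^] n = \<one>" "m > 0" "coprime m q" "y [^] m = \<one>"
    "x \<in> carrier G" "y \<in> carrier G"
    using assms by (auto simp: coprime_torsion_def)
  have "x [^] (n * m) = \<one>" "y [^] (m * n) = \<one>" using * by (simp_all flip: nat_pow_pow)
  then have "(x \<otimes> y) [^] (n * m) = \<one>" using * by (simp add: nat_pow_distrib mult.commute)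
  moreover have "n * m > 0" "coprime (n * m) q" using * by simp_all
  ultimately show ?thesis using * unfolding coprime_torsion_def by blast
qed

lemma coprime_torsion_inv:
  assumes "coprime_torsion q x"
  shows "coprime_torsion q (inv x)"
proof -
  obtain n :: nat where *: "n > 0" "coprime n q" "x [^] n = \<one>" "x \<in> carrier G"
    using assms by (auto simp: coprime_torsion_def)
  then have "inv x [^] n = \<one>" by (metis inv_one nat_pow_inv)
  then show ?thesis using * unfolding coprime_torsion_def by blast
qed

lemma coprime_torsion_pow:
  assumes "coprime_torsion q x"
  shows "coprime_torsion q (x [^] (k::nat))"
  using assms coprime_torsion_one
  by (induction k) (auto intro: coprime_torsion_mult)

lemma coprime_torsion_root1:
  assumes "coprime_torsion q x"
  shows "\<exists>y. coprime_torsion q y \<and> y [^] q = x"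
proof -
  obtain n :: nat where *: "n > 0" "coprime n q" "x [^] n = \<one>" "x \<in> carrier G"
    using assms by (auto simp: coprime_torsion_def)
  show ?thesis
  proof (cases "q = 0")
    case True
    then have "x = \<one>" using * by simp
    then show ?thesis using assms True by auto
  next
    case False
    obtain d u w where d: "d dvd q" "d dvd n" "q * u = n * w + d" using bezout_add_strong_nat[OF False] by blast
    then have "d = 1" using *(2) coprime_common_divisor_nat by blast
    have "(x [^] u) [^] q = x [^] (n * w + d)" using * d(3) by (simp add: nat_pow_pow mult.commute)
    also have "\<dots> = (x [^] n) [^] w \<otimes> x [^] d" using * by (rule_tac pow_mult_add)
    also have "\<dots> = x" using * \<open>d = 1\<close> by simp
    finally show ?thesis using coprime_torsion_pow[OF assms] by blast
  qed
qed

lemma coprime_torsion_root: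
  assumes "coprime_torsion q x"
  obtains y where "coprime_torsion q y" "y [^] (q ^ k) = x"
proof -
  have "\<exists>y. coprime_torsion q y \<and> y [^] (q ^ k) = x"
  proof (induction k)
    case 0 then show ?case using assms coprime_torsion_carrier by (auto intro!: exI[of _ x])
  next
    case (Suc k)
    then obtain y where y: "coprime_torsion q y" "y [^] (q ^ k) = x" by blast
    then obtain z where "coprime_torsion q z" "z [^] q = y" using coprime_torsion_root1 by blast
    then show ?case using y coprime_torsion_carrier by (intro exI[of _ z]) (auto simp: nat_pow_pow)
  qed
  then show thesis using that by blast
qed

lemma coprime_torsion_eq_one:
  assumes "coprime_torsion q x" "x [^] (q ^ k) = \<one>"
  shows "x = \<one>"
proof -
  obtain n :: nat where *: "n > 0" "coprime n q" "x [^] n = \<one>" "x \<in> carrier G"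
    using assms by (auto simp: coprime_torsion_def)
  have "ord x dvd n" "ord x dvd q ^ k" using * assms pow_eq_id by auto
  moreover have "coprime n (q ^ k)" using *(2) by (cases "k = 0") auto
  ultimately have "ord x = 1" by (metis coprime_common_divisor_nat nat_dvd_1_iff_1)
  then show ?thesis using *(4) ord_eq_1 by blast
qed

text \<open>Some power of \<open>q\<close> fixes \<open>x\<close>, so nothing can decrease forever under \<open>x \<mapsto> x^q\<close>.\<close>

lemma coprime_torsion_descent:
  fixes f :: "'a \<Rightarrow> int"
  assumes x: "coprime_torsion q x" and "Z x"
    and step: "\<And>y. coprime_torsion q y \<Longrightarrow> Z y \<Longrightarrow> Z (y [^] q) \<and> f (y [^] q) < f y"
  shows False
proof -
  obtain n :: nat where *: "n > 0" "x [^] n = \<one>" "x \<in> carrier G"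
    using x by (auto simp: coprime_torsion_def)
  define T where "T = {y. Z y \<and> (\<exists>k::nat. y = x [^] k)}"
  have "T \<subseteq> (\<lambda>k. x [^] k) ` {..<n}"
  proof
    fix y assume "y \<in> T"
    then obtain k :: nat where k: "y = x [^] k" by (auto simp: T_def)
    have "x [^] k = x [^] (n * (k div n) + k mod n)" by simp
    also have "\<dots> = (x [^] n) [^] (k div n) \<otimes> x [^] (k mod n)" using *(3) by (rule pow_mult_add)
    finally show "y \<in> (\<lambda>k. x [^] k) ` {..<n}" using * k by (intro image_eqI[of _ _ "k mod n"]) auto
  qed
  then have fin: "finite T" by (rule finite_subset) simp
  moreover have "x [^] (1::nat) \<in> T" using assms(2) * by (auto simp: T_def intro: exI[of _ 1])
  then have ne: "T \<noteq> {}" by blast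
  ultimately obtain y where y: "y \<in> T" "\<And>z. z \<in> T \<Longrightarrow> f y \<le> f z"
    by (metis arg_min_least arg_min_if_finite(1))
  then obtain k :: nat where k: "y = x [^] k" "Z y" by (auto simp: T_def)
  then have "y [^] q = x [^] (k * q)" using * by (simp add: nat_pow_pow)
  moreover have "coprime_torsion q y" using coprime_torsion_pow[OF x] k(1) by simp
  ultimately have "y [^] q \<in> T" "f (y [^] q) < f y" using step[of y] k(2) unfolding T_def by blast+
  then show False using y(2) by fastforce
qed

text \<open>Induction on k: x^q is in H and has a q-th root h in H, and x / h is killed by q, hence
  in H.\<close>

lemma q_power_torsion_in:
  fixes q :: nat
  assumes H: "subgroup H G"
    and "\<And>x. x \<in> carrier G \<Longrightarrow> x [^] q = \<one> \<Longrightarrow> x \<in> H"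
    and "\<And>x. x \<in> carrier G \<Longrightarrow> x [^] q \<in> H \<Longrightarrow> \<exists>h\<in>H. h [^] q = x [^] q"
    and "x \<in> carrier G" "x [^] (q ^ k) = \<one>"
  shows "x \<in> H"
  using assms(4,5)
proof (induction k arbitrary: x)
  case 0 then show ?case using subgroup.one_closed[OF H] by (simp add: nat_pow_eone)
next
  case (Suc k)
  have "(x [^] q) [^] (q ^ k) = \<one>" using Suc.prems by (simp add: nat_pow_pow)
  then have "x [^] q \<in> H" using Suc by simp
  then obtain h where h: "h \<in> H" "h [^] q = x [^] q" using assms(3) Suc.prems(1) by blast
  have hc: "h \<in> carrier G" using h H subgroup.mem_carrier by metis
  have "(x \<otimes> inv h) [^] q = \<one>"
    using Suc.prems(1) hc h(2) by (simp add: nat_pow_distrib nat_pow_inv)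
  then have "x \<otimes> inv h \<in> H" using assms(2) Suc.prems(1) hc by simp
  then have "x \<otimes> inv h \<otimes> h \<in> H" using h H subgroup.m_closed by metis
  then show ?case using Suc.prems(1) hc by (simp add: m_assoc)
qed

text \<open>A Bezout identity for n = q^k m writes x as a product of an element of order prime to q
  and one of q-power order.\<close>

lemma torsion_in:
  assumes H: "subgroup H G" and q: "prime q"
    and 1: "\<And>x. coprime_torsion q x \<Longrightarrow> x \<in> H"
    and 2: "\<And>x k. x \<in> carrier G \<Longrightarrow> x [^] (q ^ k) = \<one> \<Longrightarrow> x \<in> H"
    and x: "x \<in> carrier G" "x [^] (n::nat) = \<one>" "n > 0"
  shows "x \<in> H"
proof -
  obtain k m where n: "n = q ^ k * m" "\<not> q dvd m"
    using multiplicity_decompose'[of n q] q x(3) not_prime_unit by (metis less_numeral_extra(3))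
  have cop: "coprime m q" using n(2) q by (metis coprime_commute prime_imp_coprime)
  then have "coprime (int (q ^ k)) (int m)"
    by (simp add: coprime_commute)
  then obtain u w where "u * int (q ^ k) + w * int m = 1" using bezout_int[of "int (q ^ k)" "int m"] by auto
  then have "x = x [^] (u * int (q ^ k) + w * int m)" using x(1) by (simp add: int_pow_1)
  also have "\<dots> = (x [^] (q ^ k)) [^] u \<otimes> (x [^] m) [^] w"
    using x(1) by (simp add: int_pow_mult int_pow_pow int_pow_int mult.commute flip: int_pow_int)
  finally have eq: "x = (x [^] (q ^ k)) [^] u \<otimes> (x [^] m) [^] w" .
  have "(x [^] (q ^ k)) [^] m = \<one>" using x n(1) by (simp add: nat_pow_pow)
  moreover have "m > 0" using x(3) n by (cases m) auto
  ultimately have "x [^] (q ^ k) \<in> H" using 1[of "x [^] (q ^ k)"] x(1) cop unfolding coprime_torsion_def by blast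
  moreover have "(x [^] m) [^] (q ^ k) = \<one>" using x n(1) by (simp add: nat_pow_pow mult.commute)
  then have "x [^] m \<in> H" using 2[of "x [^] m" k] x(1) by simp
  ultimately show ?thesis using eq H subgroup_int_pow_closed subgroup.m_closed by metis
qed

definition gen2 :: "'a \<Rightarrow> 'a \<Rightarrow> 'a set" where "gen2 x t = {x [^] (i::int) \<otimes> t [^] (j::int) | i j. True}"

lemma gen2I: "x [^] (i::int) \<otimes> t [^] (j::int) \<in> gen2 x t"
  by (auto simp: gen2_def)

lemma gen2_mem:
  assumes "x \<in> carrier G" "t \<in> carrier G"
  shows "x \<in> gen2 x t" "t \<in> gen2 x t" "\<one> \<in> gen2 x t"
  using gen2I[of x 1 t 0] gen2I[of x 0 t 1] gen2I[of x 0 t 0] assms by (simp_all add: int_pow_1)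

lemma gen2_subgroup:
  assumes "x \<in> carrier G" "t \<in> carrier G"
  shows "subgroup (gen2 x t) G"
proof (rule subgroupI)
  show "gen2 x t \<subseteq> carrier G" using assms by (auto simp: gen2_def)
  show "gen2 x t \<noteq> {}" using gen2_mem assms by blast
  fix a assume "a \<in> gen2 x t"
  then obtain i j where a: "a = x [^] (i::int) \<otimes> t [^] (j::int)" by (auto simp: gen2_def)
  have "inv a = x [^] (-i) \<otimes> t [^] (-j)" using assms by (simp add: a inv_mult int_pow_neg)
  then show "inv a \<in> gen2 x t" using gen2I by simp
  fix b assume "b \<in> gen2 x t"
  then obtain k l where b: "b = x [^] (k::int) \<otimes> t [^] (l::int)" by (auto simp: gen2_def)
  have "a \<otimes> b = x [^] (i + k) \<otimes> t [^] (j + l)"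
    using assms by (simp add: a b int_pow_mult m_ac)
  then show "a \<otimes> b \<in> gen2 x t" using gen2I by simp
qed

lemma gen2_one: "x \<in> carrier G \<Longrightarrow> gen2 x \<one> = {x [^] (i::int) | i. True}"
  by (auto simp: gen2_def int_pow_one)

lemma int_pow_nat: "x [^] (int n) = x [^] n"
  by (simp add: int_pow_int)

text \<open>If y^q = x^i with i prime to q, a Bezout combination of x and y is a q-th root of x. So
  q divides i, and a power of x is the required root.\<close>

lemma cyclic_divisible:
  assumes x: "x \<in> carrier G" and q: "prime q"
    and nx: "\<And>y. y \<in> carrier G \<Longrightarrow> y [^] q \<noteq> x"
    and y: "y \<in> carrier G" "y [^] (q::nat) \<in> gen2 x \<one>"
  shows "\<exists>h\<in>gen2 x \<one>. h [^] q = y [^] q"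
proof -
  obtain i where i: "y [^] q = x [^] (i::int)" using y x by (auto simp: gen2_one)
  show ?thesis
  proof (cases "int q dvd i")
    case True
    then obtain j where "i = j * int q" by (metis dvdE mult.commute)
    have "(x [^] j) [^] q = (x [^] j) [^] int q" by (simp add: int_pow_int)
    also have "\<dots> = y [^] q" using x i \<open>i = j * int q\<close> by (simp only: int_pow_pow)
    finally have "(x [^] j) [^] q = y [^] q" .
    then show ?thesis using gen2_one x by blast
  next
    case False
    then have "coprime (int q) i" using q by (simp add: prime_imp_coprime)
    then obtain u w where uw: "u * int q + w * i = 1" using bezout_int[of "int q" i] by auto
    have "(x [^] u \<otimes> y [^] w) [^] q = x [^] (u * int q) \<otimes> (y [^] q) [^] w"
      using x y(1) by (simp add: int_pow_distrib int_pow_pow mult.commute flip: int_pow_nat)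
    also have "\<dots> = x [^] (u * int q + w * i)" using x by (simp add: i int_pow_pow int_pow_mult mult.commute)
    also have "\<dots> = x" using x uw by (simp add: int_pow_1)
    finally show ?thesis using nx x y(1) by auto
  qed
qed

text \<open>Dividing y by suitable powers of x and t reduces the exponents of y^2 modulo 2; of the
  four remaining values 1, x, t and x t, only 1 is a square.\<close>

lemma gen2_halvable:
  assumes x: "x \<in> carrier G" and t: "t \<in> carrier G"
    and nx: "\<And>y. y \<in> carrier G \<Longrightarrow> y [^] (2::nat) \<noteq> x"
    and nt: "\<And>y. y \<in> carrier G \<Longrightarrow> y [^] (2::nat) \<noteq> t"
    and nxt: "\<And>y. y \<in> carrier G \<Longrightarrow> y [^] (2::nat) \<noteq> x \<otimes> t"
    and y: "y \<in> carrier G" "y [^] (2::nat) \<in> gen2 x t"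
  shows "\<exists>h\<in>gen2 x t. h [^] (2::nat) = y [^] (2::nat)"
proof -
  obtain i j where ij: "y [^] (2::nat) = x [^] (i::int) \<otimes> t [^] (j::int)" using y by (auto simp: gen2_def)
  define k l where "k = i div 2" and "l = j div 2"
  have sq: "(x [^] k \<otimes> t [^] l) [^] (2::nat) = x [^] (2 * k) \<otimes> t [^] (2 * l)"
    using x t by (simp add: int_pow_distrib int_pow_pow mult.commute flip: int_pow_nat)
  have kl: "x [^] (- k) \<otimes> t [^] (- l) \<in> carrier G" using x t by simp
  have "(y \<otimes> (x [^] (- k) \<otimes> t [^] (- l))) [^] (2::nat)
      = (x [^] i \<otimes> t [^] j) \<otimes> (x [^] (- 2 * k) \<otimes> t [^] (- 2 * l))"
    using x t y(1) kl
    by (simp add: nat_pow_distrib ij) (simp add: int_pow_distrib int_pow_pow mult.commute flip: int_pow_nat)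
  also have "\<dots> = x [^] (i - 2 * k) \<otimes> t [^] (j - 2 * l)"
  proof -
    have "(x [^] i \<otimes> t [^] j) \<otimes> (x [^] (- 2 * k) \<otimes> t [^] (- 2 * l))
      = (x [^] i \<otimes> x [^] (- 2 * k)) \<otimes> (t [^] j \<otimes> t [^] (- 2 * l))" using x t by (simp add: m_ac)
    also have "\<dots> = x [^] (i + - 2 * k) \<otimes> t [^] (j + - 2 * l)" using x t by (simp only: int_pow_mult)
    finally show ?thesis by simp
  qed
  also have "i - 2 * k = i mod 2" by (simp add: k_def minus_mult_div_eq_mod)
  also have "j - 2 * l = j mod 2" by (simp add: l_def minus_mult_div_eq_mod)
  finally have red: "(y \<otimes> (x [^] (- k) \<otimes> t [^] (- l))) [^] (2::nat) = x [^] (i mod 2) \<otimes> t [^] (j mod 2)" .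
  have yc: "y \<otimes> (x [^] (- k) \<otimes> t [^] (- l)) \<in> carrier G" using y(1) kl by simp
  consider "i mod 2 = 0" "j mod 2 = 0" | "i mod 2 = 1" "j mod 2 = 0" | "i mod 2 = 0" "j mod 2 = 1"
    | "i mod 2 = 1" "j mod 2 = 1" by (metis parity_cases mod2_eq_if)
  then show ?thesis
  proof cases
    case 1
    then have "2 * k = i" "2 * l = j" by (auto simp: k_def l_def)
    then show ?thesis using sq ij gen2I[of x k t l] by metis
  qed (use red nx[OF yc] nt[OF yc] nxt[OF yc] x t in \<open>auto simp: int_pow_1\<close>)
qed

definition is_torsion :: "'a \<Rightarrow> bool" where
  "is_torsion x \<longleftrightarrow> x \<in> carrier G \<and> (\<exists>n::nat. n > 0 \<and> x [^] n = \<one>)"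

lemma torsion_subgroup_simps:
  "carrier (torsion_subgroup G) = {x. is_torsion x}"
  "x \<otimes>\<^bsub>torsion_subgroup G\<^esub> y = x \<otimes> y"
  by (auto simp: torsion_subgroup_def is_torsion_def)

lemma int_pow_mod_ord:
  assumes "x \<in> carrier G" "x [^] n = \<one>"
  shows "x [^] (i mod int n) = x [^] (i::int)"
proof -
  have "x [^] i = x [^] (int n * (i div int n) + i mod int n)" by simp
  also have "\<dots> = (x [^] int n) [^] (i div int n) \<otimes> x [^] (i mod int n)"
    using assms(1) by (simp only: int_pow_mult int_pow_pow)
  finally show ?thesis using assms by (simp add: int_pow_int int_pow_one)
qed

lemma cyclic_torsion_iso:
  assumes x: "x \<in> carrier G" and n: "ord x = n" "n > 0"
    and all: "\<And>y. is_torsion y \<Longrightarrow> y \<in> gen2 x \<one>"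
  shows "torsion_subgroup G \<cong> integer_mod_group n"
proof -
  have xn: "x [^] n = \<one>" using x n pow_ord_eq_1 by blast
  define h where "h = (\<lambda>i::int. x [^] i)"
  have "h \<in> iso (integer_mod_group n) (torsion_subgroup G)"
  proof (rule isoI)
    have tors: "is_torsion (x [^] (i::int))" for i
    proof -
      have "(x [^] i) [^] n = (x [^] n) [^] i" using x by (simp add: int_pow_pow mult.commute flip: int_pow_nat)
      then show ?thesis using x n xn by (auto simp: is_torsion_def int_pow_one)
    qed
    then show "h \<in> hom (integer_mod_group n) (torsion_subgroup G)"
      using x xn by (auto simp: hom_def h_def torsion_subgroup_simps int_pow_mod_ord int_pow_mult)
    show "bij_betw h (carrier (integer_mod_group n)) (carrier (torsion_subgroup G))"
      unfolding bij_betw_def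
    proof
      show "inj_on h (carrier (integer_mod_group n))"
      proof (rule inj_onI)
        fix i j assume ij: "i \<in> carrier (integer_mod_group n)" "j \<in> carrier (integer_mod_group n)" "h i = h j"
        then have "x [^] (i - j) = \<one>" using x by (simp add: h_def int_pow_diff)
        then have "int n dvd i - j" using int_pow_eq_id x n by blast
        then have "i mod int n = j mod int n" by (simp add: mod_eq_dvd_iff)
        then show "i = j" using ij(1,2) n by (simp add: carrier_integer_mod_group)
      qed
      show "h ` carrier (integer_mod_group n) = carrier (torsion_subgroup G)"
      proof
        show "h ` carrier (integer_mod_group n) \<subseteq> carrier (torsion_subgroup G)"
          using tors by (auto simp: h_def torsion_subgroup_simps)
        show "carrier (torsion_subgroup G) \<subseteq> h ` carrier (integer_mod_group n)"
        proof
          fix y assume "y \<in> carrier (torsion_subgroup G)"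
          then obtain i where "y = x [^] (i::int)" using all x by (auto simp: torsion_subgroup_simps gen2_one)
          then have "y = h (i mod int n)" using int_pow_mod_ord x xn by (simp add: h_def)
          then show "y \<in> h ` carrier (integer_mod_group n)"
            using n by (auto simp: carrier_integer_mod_group)
        qed
      qed
    qed
  qed
  then have "integer_mod_group n \<cong> torsion_subgroup G" by (auto simp: is_iso_def)
  then show ?thesis by (simp add: group.iso_sym)
qed

lemma bicyclic_torsion_iso:
  assumes x: "x \<in> carrier G" and n: "ord x = 2 * n" "n > 0"
    and t: "t \<in> carrier G" "t [^] (2::nat) = \<one>" "t \<noteq> \<one>" "t \<noteq> x [^] n"
    and all: "\<And>y. is_torsion y \<Longrightarrow> y \<in> gen2 x t"
  shows "torsion_subgroup G \<cong> integer_mod_group 2 \<times>\<times> integer_mod_group (2 * n)"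
proof -
  have xn: "x [^] (2 * n) = \<one>" using x n pow_ord_eq_1 by metis
  define M where "M = integer_mod_group 2 \<times>\<times> integer_mod_group (2 * n)"
  define h where "h = (\<lambda>(j, i). x [^] (i::int) \<otimes> t [^] (j::int))"
  have M: "carrier M = {0..<2} \<times> {0..<int (2 * n)}" using n by (simp add: M_def carrier_integer_mod_group)
  have "h \<in> iso M (torsion_subgroup G)"
  proof (rule isoI)
    have tors: "is_torsion (x [^] (i::int) \<otimes> t [^] (j::int))" for i j
    proof -
      have "(x [^] i \<otimes> t [^] j) [^] (2 * n) = (x [^] (2 * n)) [^] i \<otimes> ((t [^] (2::nat)) [^] n) [^] j"
        using x t(1) by (simp add: int_pow_distrib int_pow_pow mult_ac flip: int_pow_nat)
      then show ?thesis using x t n xn unfolding is_torsion_def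
        by (intro conjI exI[of _ "2 * n"]) (simp_all add: int_pow_one)
    qed
    show "h \<in> hom M (torsion_subgroup G)"
    proof (rule homI)
      fix p assume "p \<in> carrier M"
      then show "h p \<in> carrier (torsion_subgroup G)" using tors by (auto simp: h_def torsion_subgroup_simps split: prod.split)
    next
      fix p p' assume "p \<in> carrier M" "p' \<in> carrier M"
      obtain j i j' i' where p: "p = (j, i)" "p' = (j', i')" by (cases p; cases p')
      have "h (p \<otimes>\<^bsub>M\<^esub> p') = x [^] ((i + i') mod int (2 * n)) \<otimes> t [^] ((j + j') mod int 2)"
        by (simp add: p M_def h_def)
      also have "\<dots> = x [^] (i + i') \<otimes> t [^] (j + j')"
        using int_pow_mod_ord[OF x xn] int_pow_mod_ord[OF t(1,2)] by simp
      also have "\<dots> = h p \<otimes> h p'" using x t(1) by (simp add: p h_def int_pow_mult m_ac)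
      finally show "h (p \<otimes>\<^bsub>M\<^esub> p') = h p \<otimes>\<^bsub>torsion_subgroup G\<^esub> h p'" by (simp add: torsion_subgroup_simps)
    qed
    show "bij_betw h (carrier M) (carrier (torsion_subgroup G))"
      unfolding bij_betw_def
    proof
      have key: "j = j' \<and> i = i'" if "j \<in> {0..<2}" "j' \<in> {0..<2}" "i \<in> {0..<int (2 * n)}" "i' \<in> {0..<int (2 * n)}"
        and eq: "x [^] i \<otimes> t [^] j = x [^] i' \<otimes> t [^] j'" and le: "j' \<le> j" for i i' j j' :: int
      proof -
        have "x [^] (i - i') \<otimes> t [^] (j - j') = \<one>"
        proof -
          have "x [^] (i - i') \<otimes> t [^] (j - j') = (x [^] i \<otimes> t [^] j) \<otimes> inv (x [^] i' \<otimes> t [^] j')"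
            using x t(1) by (simp add: int_pow_diff inv_mult m_ac)
          then show ?thesis using eq x t(1) by simp
        qed
        moreover have "j - j' = 0 \<or> j - j' = 1" using that by auto
        \<comment> \<open>Otherwise t is a power of x. The only powers of x killed by 2 are 1 and
          x^n, and both are excluded for t.\<close>
        moreover have "j - j' \<noteq> 1"
        proof
          assume "j - j' = 1"
          then have e: "x [^] (i - i') \<otimes> t = \<one>" using calculation t(1) by (simp add: int_pow_1)
          then have "inv t = x [^] (i - i')" using inv_equality x t(1) by simp
          then have "t = inv (x [^] (i - i'))" using t(1) by (metis inv_inv)
          then have e': "t = x [^] (i' - i)" using x by (simp flip: int_pow_neg)
          then have "x [^] (2 * (i' - i)) = \<one>" using t(2) x by (simp add: int_pow_pow mult.commute flip: int_pow_nat)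
          then have "int (2 * n) dvd 2 * (i' - i)" using int_pow_eq_id x n by metis
          then have "int n dvd i' - i" by (simp only: of_nat_mult of_nat_numeral dvd_mult_cancel_left) simp
          then obtain d where d: "i' - i = int n * d" by blast
          have "\<bar>i' - i\<bar> < 2 * int n" using that by auto
          then have "\<bar>d\<bar> * int n < 2 * int n" using d by (simp add: abs_mult mult.commute)
          then have "d = 0 \<or> d = 1 \<or> d = -1" using n(2) by (simp add: mult_less_cancel_right) linarith
          then show False
          proof (elim disjE)
            assume "d = 0" then show False using e' d t(3) by simp
          next
            assume "d = 1" then show False using e' d t(4) by (simp add: int_pow_int)
          next
            assume "d = -1"
            then have "t = x [^] (- int n)" using e' d by simp
            also have "\<dots> = x [^] (- int n) \<otimes> x [^] (int (2 * n))" using x xn by (simp only: int_pow_int) simp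
            also have "\<dots> = x [^] (int n)" using x by (simp flip: int_pow_mult)
            finally show False using t(4) by (simp add: int_pow_int)
          qed
        qed
        ultimately have j: "j - j' = 0" and "x [^] (i - i') = \<one>" using x by auto
        then have "int (2 * n) dvd i - i'" using int_pow_eq_id x n by metis
        then have "i mod int (2 * n) = i' mod int (2 * n)" by (simp only: mod_eq_dvd_iff)
        then show ?thesis using that j by simp
      qed
      show "inj_on h (carrier M)"
      proof (rule inj_onI)
        fix p p' assume *: "p \<in> carrier M" "p' \<in> carrier M" "h p = h p'"
        obtain j i j' i' where p: "p = (j, i)" "p' = (j', i')" by (cases p; cases p')
        show "p = p'" using * key[of j j' i i'] key[of j' j i' i] unfolding p M h_def by fastforce
      qed
      show "h ` carrier M = carrier (torsion_subgroup G)"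
      proof
        show "h ` carrier M \<subseteq> carrier (torsion_subgroup G)"
          using tors by (auto simp: h_def torsion_subgroup_simps)
        show "carrier (torsion_subgroup G) \<subseteq> h ` carrier M"
        proof
          fix y assume "y \<in> carrier (torsion_subgroup G)"
          then obtain i j where y: "y = x [^] (i::int) \<otimes> t [^] (j::int)"
            using all[of y] unfolding torsion_subgroup_simps gen2_def by blast
          have "y = h (j mod 2, i mod int (2 * n))"
            using int_pow_mod_ord[OF x xn] int_pow_mod_ord[OF t(1,2)] by (simp add: h_def y)
          then show "y \<in> h ` carrier M" using n by (intro image_eqI) (auto simp: M)
        qed
      qed
    qed
  qed
  then have "M \<cong> torsion_subgroup G" by (auto simp: is_iso_def)
  moreover have "group M" unfolding M_def by (simp add: DirProd_group)
  ultimately show ?thesis by (simp add: group.iso_sym M_def)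
qed

end

section \<open>Multiplication formulas\<close>

context short_weierstrass
begin

abbreviation G :: "'k ec_point monoid" where "G \<equiv> ec_group E"

sublocale grp: comm_group G by (rule comm_group_ec)

lemma G_simps: "P \<otimes>\<^bsub>G\<^esub> R = ec_add E P R" "\<one>\<^bsub>G\<^esub> = Point_At_Infinity" "P \<in> carrier G \<longleftrightarrow> on_curve E P"
  by (simp_all add: ec_group_def)

lemma inv_G: "on_curve E P \<Longrightarrow> inv\<^bsub>G\<^esub> P = neg P"
  by (rule grp.inv_equality) (simp_all add: G_simps add_neg neg_on_curve)

lemma pow_2: "on_curve E P \<Longrightarrow> P [^]\<^bsub>G\<^esub> (2::nat) = ec_add E P P"
  by (simp add: numeral_2_eq_2 G_simps del: ec_add.simps on_curve.simps)

lemma pow_3: "on_curve E P \<Longrightarrow> P [^]\<^bsub>G\<^esub> (3::nat) = ec_add E (ec_add E P P) P"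
  by (simp add: numeral_3_eq_3 G_simps del: ec_add.simps on_curve.simps)

lemma add_distinct:
  assumes "x1 \<noteq> x2"
  shows "ec_add E (Affine x1 y1) (Affine x2 y2)
    = Affine (((y2 - y1) / (x2 - x1)) ^ 2 - a - x1 - x2)
       (- ((y2 - y1) / (x2 - x1) * (((y2 - y1) / (x2 - x1)) ^ 2 - a - x1 - x2 - x1) + y1))"
  using assms by (simp add: Let_def)

lemma double:
  assumes on: "y ^ 2 = F x" and y: "y \<noteq> 0"
  obtains y' where "ec_add E (Affine x y) (Affine x y)
    = Affine (((x ^ 2 - b) ^ 2 - 4 * c * (2 * x + a)) / (4 * F x)) y'"
proof -
  define l where "l = (3 * x ^ 2 + 2 * a * x + b) / (2 * y)"
  have yy: "y + y \<noteq> 0" using y by (simp flip: mult_2)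
  have "4 * F x * (l ^ 2 - a - x - x) = (x ^ 2 - b) ^ 2 - 4 * c * (2 * x + a)"
  proof -
    have "4 * F x * l ^ 2 = (3 * x ^ 2 + 2 * a * x + b) ^ 2"
      using y by (simp add: l_def power_divide power_mult_distrib flip: on)
    moreover have "4 * F x * (l ^ 2 - a - x - x) = 4 * F x * l ^ 2 - 4 * F x * (a + 2 * x)"
      by (simp add: algebra_simps)
    ultimately show ?thesis by (simp add: algebra_simps power2_eq_square power3_eq_cube)
  qed
  then have "(l ^ 2 - a - x - x) * (4 * F x) = (x ^ 2 - b) ^ 2 - 4 * c * (2 * x + a)"
    by (simp only: mult.commute)
  moreover have "4 * F x \<noteq> 0" using y on by (metis mult_eq_0_iff power_eq_0_iff zero_neq_numeral)
  ultimately have "l ^ 2 - a - x - x = ((x ^ 2 - b) ^ 2 - 4 * c * (2 * x + a)) / (4 * F x)"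
    by (rule eq_divide_imp[rotated])
  moreover have "ec_add E (Affine x y) (Affine x y) = Affine (l ^ 2 - a - x - x) (- (l * (l ^ 2 - a - x - x - x) + y))"
    using yy by (simp add: Let_def l_def)
  ultimately show thesis using that by metis
qed

text \<open>The abscissas of P + R and P - R contain y1 y2 with opposite signs, so their sum and
  product are rational in x1 and x2 alone.\<close>

lemma sum_difference:
  assumes on: "y1 ^ 2 = F x1" "y2 ^ 2 = F x2" and x: "x1 \<noteq> x2"
  obtains u w u' w' where "ec_add E (Affine x1 y1) (Affine x2 y2) = Affine u w"
    "ec_add E (Affine x1 y1) (neg (Affine x2 y2)) = Affine u' w'"
    "(u + u') * (x1 - x2) ^ 2 = 2 * x1 * x2 * (x1 + x2) + 4 * a * x1 * x2 + 2 * b * (x1 + x2) + 4 * c"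
    "u * u' * (x1 - x2) ^ 2 = (x1 * x2 - b) ^ 2 - 4 * c * (x1 + x2 + a)"
proof -
  define l m where "l = (y2 - y1) / (x2 - x1)" and "m = (- y2 - y1) / (x2 - x1)"
  define d where "d = x2 - x1"
  have d: "d \<noteq> 0" using x by (simp add: d_def)
  have ld: "l * d = y2 - y1" "m * d = - y2 - y1" using d by (simp_all add: l_def m_def d_def)
  define s where "s = a + x1 + x2"
  have sq: "l ^ 2 * d ^ 2 = (y2 - y1) ^ 2" "m ^ 2 * d ^ 2 = (y2 + y1) ^ 2"
  proof -
    have "l ^ 2 * d ^ 2 = (l * d) ^ 2" "m ^ 2 * d ^ 2 = (m * d) ^ 2" by (simp_all add: power_mult_distrib)
    then show "l ^ 2 * d ^ 2 = (y2 - y1) ^ 2" "m ^ 2 * d ^ 2 = (y2 + y1) ^ 2"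
      unfolding ld by (simp_all add: power2_eq_square algebra_simps)
  qed
  have "((l ^ 2 - s) + (m ^ 2 - s)) * d ^ 2 = 2 * (y1 ^ 2 + y2 ^ 2) - 2 * s * d ^ 2"
    using sq by (simp add: algebra_simps power2_eq_square)
  also have "2 * (y1 ^ 2 + y2 ^ 2) - 2 * s * d ^ 2 = 2 * (F x1 + F x2) - 2 * s * d ^ 2" by (simp only: on)
  also have "\<dots> = 2 * x1 * x2 * (x1 + x2) + 4 * a * x1 * x2 + 2 * b * (x1 + x2) + 4 * c"
    by (simp add: s_def d_def algebra_simps power2_eq_square power3_eq_cube)
  finally have 1: "((l ^ 2 - s) + (m ^ 2 - s)) * d ^ 2 = \<dots>" .
  have "(l ^ 2 - s) * (m ^ 2 - s) * d ^ 2 * d ^ 2 = (l ^ 2 * d ^ 2 - s * d ^ 2) * (m ^ 2 * d ^ 2 - s * d ^ 2)"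
    by (simp add: algebra_simps)
  also have "\<dots> = (y2 ^ 2 - y1 ^ 2) ^ 2 - 2 * s * d ^ 2 * (y1 ^ 2 + y2 ^ 2) + s ^ 2 * d ^ 2 * d ^ 2"
    unfolding sq by (simp add: algebra_simps power2_eq_square)
  also have "\<dots> = ((x1 * x2 - b) ^ 2 - 4 * c * (x1 + x2 + a)) * d ^ 2"
    unfolding on by (simp add: s_def d_def algebra_simps power2_eq_square power3_eq_cube)
  finally have 2: "(l ^ 2 - s) * (m ^ 2 - s) * d ^ 2 = (x1 * x2 - b) ^ 2 - 4 * c * (x1 + x2 + a)"
    using d by simp
  have dd: "d ^ 2 = (x1 - x2) ^ 2" by (simp add: d_def power2_commute)
  have e: "l ^ 2 - s = l ^ 2 - a - x1 - x2" "m ^ 2 - s = m ^ 2 - a - x1 - x2" by (simp_all add: s_def)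
  from that[of "l ^ 2 - s" _ "m ^ 2 - s"] 1 2 show thesis
    unfolding dd e neg.simps add_distinct[OF x] l_def[symmetric] m_def[symmetric] by blast
qed

text \<open>The third division polynomial.\<close>

definition psi3 :: "'k \<Rightarrow> 'k" where
  "psi3 x = 3 * x ^ 4 + 4 * a * x ^ 3 + 6 * b * x ^ 2 + 12 * c * x + 4 * a * c - b ^ 2"

text \<open>\<open>4 y h6\<close> is the fourth division polynomial.\<close>

definition h6 :: "'k \<Rightarrow> 'k" where
  "h6 x = x ^ 6 + (2 * a * x ^ 5 + 5 * b * x ^ 4 + 20 * c * x ^ 3
     + (20 * a * c - 5 * b ^ 2) * x ^ 2 + (8 * a ^ 2 * c - 2 * a * b ^ 2 - 4 * b * c) * x ^ 1
     + (4 * a * b * c - b ^ 3 - 8 * c ^ 2))"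

text \<open>The numerator x psi_3^2 - psi_2 psi_4 of the tripling formula; here psi_2 psi_4 = 2 y *
  4 y h6 = 8 F h6.\<close>

definition phi3 :: "'k \<Rightarrow> 'k" where
  "phi3 x = x * psi3 x ^ 2 - 8 * F x * h6 x"

text \<open>Apply \<open>sum_difference\<close> to 2 P and P: their difference is P itself, so the
  formula for the sum of the two abscissas determines the abscissa of 3 P.\<close>

lemma triple:
  assumes on: "y ^ 2 = F x" and psi: "psi3 x \<noteq> 0"
  obtains y' where "ec_add E (ec_add E (Affine x y) (Affine x y)) (Affine x y)
    = Affine (phi3 x / psi3 x ^ 2) y'"
proof (cases "y = 0")
  case True
  then have "phi3 x / psi3 x ^ 2 = x" using on psi by (simp add: phi3_def)
  then show thesis using that[of y] True by simp
next
  case False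
  define z where "z = ((x ^ 2 - b) ^ 2 - 4 * c * (2 * x + a)) / (4 * F x)"
  obtain w where w: "ec_add E (Affine x y) (Affine x y) = Affine z w"
    using double[OF on False] unfolding z_def by blast
  have F: "F x \<noteq> 0" using on False by auto
  have "4 * F x \<noteq> 0" using F by (metis mult_eq_0_iff zero_neq_numeral)
  then have "z * (4 * F x) = (x ^ 2 - b) ^ 2 - 4 * c * (2 * x + a)"
    unfolding z_def by (rule nonzero_eq_divide_eq[THEN iffD1, OF _ refl])
  moreover have "4 * F x * (x - z) = x * (4 * F x) - z * (4 * F x)" by (simp only: algebra_simps)
  ultimately have "4 * F x * (x - z) = x * (4 * F x) - ((x ^ 2 - b) ^ 2 - 4 * c * (2 * x + a))" by (simp only:)
  then have zx: "4 * F x * (x - z) = psi3 x"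
    by (simp add: psi3_def algebra_simps power2_eq_square power3_eq_cube power4_eq_xxxx)
  then have ne: "z \<noteq> x" using psi by auto
  have onz: "w ^ 2 = F z" using add_on_curve[of "Affine x y" "Affine x y"] w on by simp
  obtain u v u' v' where s: "ec_add E (Affine z w) (Affine x y) = Affine u v"
    "ec_add E (Affine z w) (neg (Affine x y)) = Affine u' v'"
    "(u + u') * (z - x) ^ 2 = 2 * z * x * (z + x) + 4 * a * z * x + 2 * b * (z + x) + 4 * c"
    using sum_difference[OF onz on ne] by metis
  \<comment> \<open>This is 2 P - P = P.\<close>
  have "u' = x" using s(2) add_cancel[of "Affine x y" "Affine x y"] on w by simp
  define f where "f = F x"
  have f: "f \<noteq> 0" using F by (simp add: f_def)
  have "(x - z) * (4 * f) = psi3 x" using zx by (simp only: f_def mult.commute)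
  then have "x - z = psi3 x / (4 * f)" using f by (intro eq_divide_imp) auto
  then have z: "z = x - psi3 x / (4 * f)" by (simp add: algebra_simps)
  define p where "p = psi3 x"
  have p: "p \<noteq> 0" using psi by (simp add: p_def)
  have "(z - x) ^ 2 = (p / (4 * f)) ^ 2" using z by (simp add: p_def)
  then have "u * (p / (4 * f)) ^ 2 = 2 * z * x * (z + x) + 4 * a * z * x + 2 * b * (z + x) + 4 * c - x * (p / (4 * f)) ^ 2"
    using s(3) \<open>u' = x\<close> by (simp add: algebra_simps)
  then have "u * p ^ 2 = 16 * f ^ 2 * (2 * z * x * (z + x) + 4 * a * z * x + 2 * b * (z + x) + 4 * c) - x * p ^ 2"
    using f by (simp add: field_simps power_divide power_mult_distrib)
  also have "16 * f ^ 2 * (2 * z * x * (z + x) + 4 * a * z * x + 2 * b * (z + x) + 4 * c)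
     = 2 * x * p ^ 2 - 8 * f * p * (3 * x ^ 2 + 2 * a * x + b) + 64 * f ^ 3"
  proof -
    have "2 * (x - t) * x * ((x - t) + x) + 4 * a * (x - t) * x + 2 * b * ((x - t) + x) + 4 * c
      = 4 * F x + 2 * x * t ^ 2 - 2 * t * (3 * x ^ 2 + 2 * a * x + b)" for t
      by (simp add: algebra_simps power2_eq_square power3_eq_cube)
    from this[of "p / (4 * f)"]
    have "2 * z * x * (z + x) + 4 * a * z * x + 2 * b * (z + x) + 4 * c
      = 4 * f + 2 * x * (p / (4 * f)) ^ 2 - 2 * (p / (4 * f)) * (3 * x ^ 2 + 2 * a * x + b)"
      unfolding z p_def[symmetric] f_def[symmetric] by (simp only: f_def)
    moreover have "16 * f ^ 2 * (4 * f + 2 * x * t ^ 2 - 2 * t * D)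
      = 2 * x * (4 * f * t) ^ 2 - 8 * f * (4 * f * t) * D + 64 * f ^ 3" for t D
      by (simp add: algebra_simps power2_eq_square power3_eq_cube)
    moreover have "4 * f * (p / (4 * f)) = p" using f by simp
    ultimately show ?thesis by (simp only:)
  qed
  also have "2 * x * p ^ 2 - 8 * f * p * (3 * x ^ 2 + 2 * a * x + b) + 64 * f ^ 3 - x * p ^ 2 = phi3 x"
  proof -
    have "8 * f ^ 2 - p * (3 * x ^ 2 + 2 * a * x + b) = - h6 x"
      unfolding p_def f_def psi3_def h6_def by (simp add: algebra_simps eval_nat_numeral)
    moreover have "2 * x * p ^ 2 - 8 * f * p * D + 64 * f ^ 3 - x * p ^ 2
      = x * p ^ 2 - 8 * f * (- (8 * f ^ 2 - p * D))" for D
      by (simp add: algebra_simps power2_eq_square power3_eq_cube)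
    ultimately show ?thesis unfolding phi3_def p_def[symmetric] f_def[symmetric] by (simp only: minus_minus)
  qed
  finally have "u = phi3 x / psi3 x ^ 2" using p by (simp add: p_def field_simps)
  then show thesis using that s(1) w by simp
qed

lemma pow_2_eq_infinity:
  assumes "on_curve E P" "P [^]\<^bsub>G\<^esub> (2::nat) = Point_At_Infinity"
  shows "P = Point_At_Infinity \<or> (\<exists>x. P = Affine x 0 \<and> F x = 0)"
proof (cases P)
  case (Affine x y)
  have "neg P = P" using add_eq_infinity[of P P] assms by (simp add: pow_2 del: ec_add.simps)
  then have "y = 0" using Affine by (simp add: equation_minus_iff)
  then show ?thesis using Affine assms(1) by simp
qed simp

lemma pow_3_eq_infinity:
  assumes "on_curve E (Affine x y)" "Affine x y [^]\<^bsub>G\<^esub> (3::nat) = Point_At_Infinity"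
  shows "psi3 x = 0"
  using triple[of y x] assms pow_3[of "Affine x y"] by (metis ec_point.distinct(1) on_curve_iff)

text \<open>The 2-descent map \<open>x - e\<close> takes square values on doubles. A single root e
  for which x - e is not a square in K thus certifies that a point cannot be halved.\<close>

lemma double_minus_root:
  assumes e: "F e = 0" and R: "on_curve E R" and d: "R [^]\<^bsub>G\<^esub> (2::nat) = Affine x y"
  shows "\<exists>u. u ^ 2 = x - e"
proof (cases R)
  case Point_At_Infinity
  then show ?thesis using d by (simp add: pow_2)
next
  case (Affine z w)
  have on: "w ^ 2 = F z" using R Affine by simp
  have w: "w \<noteq> 0" using d R Affine by (auto simp: pow_2)
  have x: "x = ((z ^ 2 - b) ^ 2 - 4 * c * (2 * z + a)) / (4 * F z)"
    using double[OF on w] d R Affine pow_2[of R] by (metis ec_point.inject)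
  have c: "c = - (e ^ 3 + a * e ^ 2 + b * e)" using e by (simp add: eq_neg_iff_add_eq_0 algebra_simps)
  have "F z \<noteq> 0" using on w by auto
  then have f: "4 * F z \<noteq> 0" by (metis mult_eq_0_iff zero_neq_numeral)
  then have "x * (4 * F z) = (z ^ 2 - b) ^ 2 - 4 * c * (2 * z + a)"
    unfolding x by (rule nonzero_eq_divide_eq[THEN iffD1, OF _ refl])
  then have "(x - e) * (4 * F z) = (z ^ 2 - b) ^ 2 - 4 * c * (2 * z + a) - e * (4 * F z)"
    by (simp only: left_diff_distrib)
  also have "\<dots> = ((z - e) ^ 2 - (3 * e ^ 2 + 2 * a * e + b)) ^ 2"
    unfolding c by (simp add: algebra_simps power2_eq_square power3_eq_cube)
  finally have "x - e = ((z - e) ^ 2 - (3 * e ^ 2 + 2 * a * e + b)) ^ 2 / (4 * F z)"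
    by (rule eq_divide_imp[OF f])
  also have "4 * F z = (2 * w) ^ 2" by (simp add: power_mult_distrib on)
  finally have "(((z - e) ^ 2 - (3 * e ^ 2 + 2 * a * e + b)) / (2 * w)) ^ 2 = x - e"
    by (simp add: power_divide)
  then show ?thesis by blast
qed

end

section \<open>Torsion of odd order and reduction at 2\<close>

context quadratic_valuation
begin

lemma vge_mult0: "vge x 0 \<Longrightarrow> vge y 0 \<Longrightarrow> vge (x * y) 0"
  using vge_mult[of x 0 y 0 0] by simp

lemma vge_power0: "vge x 0 \<Longrightarrow> vge (x ^ n) 0"
  by (induction n) (simp_all add: vge_mult0)

lemmas integral_intros = vge_add vge_diff vge_mult0 vge_power0 vge_int vge_numeral

lemma vge_mult_left: "vge x n \<Longrightarrow> vge y 0 \<Longrightarrow> vge (x * y) n"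
  using vge_mult[of x n y 0 n] by simp

lemma vge_dvd: "p dvd k \<Longrightarrow> vge y 0 \<Longrightarrow> n \<le> 2 \<Longrightarrow> vge (of_int k * y) n"
  using vge_mult[OF vge_intI[of 1 k 2] , of y 0 n] by simp

text \<open>Of the four monic quadratics over the field with two elements, only x^2 + x + 1 is
  irreducible.\<close>

lemma residue2:
  assumes p2: "p = 2" and x: "vge x 0"
  shows "vge x 1 \<or> vge (x - 1) 1 \<or> vge (x ^ 2 - x - 1) 1"
  using x
proof (cases rule: residue_cases)
  case (1 r)
  then have "r = 0 \<or> r = 1" using p2 by auto
  then show ?thesis using 1 by auto
next
  case (2 s t)
  have 3: "vge (2 * y) 1" if "vge y 0" for y
    using vge_dvd[of 2 y 1] p2 that by simp
  have "s = 0 \<or> s = 1" "t = 0 \<or> t = 1" using 2 p2 by auto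
  then consider "vge (x ^ 2) 1" | "vge (x ^ 2 - 1) 1" | "vge (x ^ 2 - x) 1" | "vge (x ^ 2 - x - 1) 1"
    using 2(3) by (auto simp: diff_diff_eq)
  then show ?thesis
  proof cases
    case 1 then show ?thesis using vge_power_1[OF _ x] by simp
  next
    case 2
    have "(x - 1) * (x - 1) = (x ^ 2 - 1) - 2 * (x - 1)" by (simp add: algebra_simps power2_eq_square)
    then have "vge ((x - 1) * (x - 1)) 1" using vge_diff[OF 2 3[of "x - 1"]] x by (auto intro: integral_intros)
    then show ?thesis using vge_prod_1[of "x - 1" "x - 1"] x by (auto intro: integral_intros)
  next
    case 3
    have "x * (x - 1) = x ^ 2 - x" by (simp add: algebra_simps power2_eq_square)
    then show ?thesis using vge_prod_1[of x "x - 1"] 3 x by (auto intro: integral_intros)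
  qed blast
qed

end

context short_weierstrass
begin

text \<open>The points of finite order prime to \<open>q\<close>; the name is unrelated to cotorsion
  modules.\<close>

definition cotorsion :: "nat \<Rightarrow> 'k ec_point \<Rightarrow> bool" where
  "cotorsion q P \<longleftrightarrow> grp.coprime_torsion q P"

lemma equal_x:
  assumes "on_curve E (Affine x y1)" "on_curve E (Affine x y2)"
  shows "Affine x y1 = Affine x y2 \<or> Affine x y1 = neg (Affine x y2)"
proof -
  have "y1 ^ 2 = y2 ^ 2" using assms by simp
  then show ?thesis by (auto simp: power2_eq_iff)
qed

lemma cotorsion_on: "cotorsion q P \<Longrightarrow> on_curve E P"
  unfolding cotorsion_def by (drule grp.coprime_torsion_carrier) (simp only: G_simps)

lemma cotorsion_add: "cotorsion q P \<Longrightarrow> cotorsion q R \<Longrightarrow> cotorsion q (ec_add E P R)"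
  using grp.coprime_torsion_mult by (simp add: cotorsion_def G_simps del: ec_add.simps)

lemma cotorsion_neg: "cotorsion q P \<Longrightarrow> cotorsion q (neg P)"
  using grp.coprime_torsion_inv[of q P] inv_G cotorsion_on[of q P] by (simp add: cotorsion_def)

lemma cotorsion_pow: "cotorsion q P \<Longrightarrow> cotorsion q (P [^]\<^bsub>G\<^esub> (n::nat))"
  using grp.coprime_torsion_pow by (simp add: cotorsion_def)

lemma cotorsion_root:
  assumes "cotorsion q P"
  obtains R where "cotorsion q R" "R [^]\<^bsub>G\<^esub> (q ^ k) = P"
proof -
  from grp.coprime_torsion_root[OF assms[unfolded cotorsion_def], of k]
  show thesis using that unfolding cotorsion_def by metis
qed

lemma cotorsion_pow_eq_infinity:
  "cotorsion q P \<Longrightarrow> P [^]\<^bsub>G\<^esub> q = Point_At_Infinity \<Longrightarrow> P = Point_At_Infinity"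
  using grp.coprime_torsion_eq_one[of q P 1] by (simp add: cotorsion_def G_simps)

lemma cotorsion_descent:
  fixes f :: "'k ec_point \<Rightarrow> int"
  assumes "cotorsion q P" "Z P"
    and "\<And>R. cotorsion q R \<Longrightarrow> Z R \<Longrightarrow> Z (R [^]\<^bsub>G\<^esub> q) \<and> f (R [^]\<^bsub>G\<^esub> q) < f R"
  shows False
proof (rule grp.coprime_torsion_descent[of q P Z f])
  show "grp.coprime_torsion q P" using assms(1) by (simp only: cotorsion_def)
  show "Z P" by (rule assms(2))
  fix R assume "grp.coprime_torsion q R" "Z R"
  then show "Z (R [^]\<^bsub>G\<^esub> q) \<and> f (R [^]\<^bsub>G\<^esub> q) < f R" by (intro assms(3)) (simp_all only: cotorsion_def)
qed

lemma cotorsionI: "on_curve E P \<Longrightarrow> P [^]\<^bsub>G\<^esub> (n::nat) = Point_At_Infinity \<Longrightarrow> n > 0 \<Longrightarrow> coprime n q \<Longrightarrow> cotorsion q P"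
  unfolding cotorsion_def grp.coprime_torsion_def by (intro conjI exI[of _ n]) (simp_all only: G_simps)

end

text \<open>With \<open>x = 4 X\<close> and \<open>y = 8 Y + 4 X\<close> these are, for \<open>\<alpha> \<equiv> 1\<close> modulo 4, the curves
  \<open>Y^2 + X Y = X^3 + (\<alpha> - 1)/4 X^2 + \<beta> X + \<gamma>\<close>, which have good reduction at 2 if
  \<open>\<beta>^2 - \<alpha> \<gamma>\<close> is odd, and multiplicative reduction with node \<open>X = 0\<close> if \<open>\<beta>\<close> and \<open>\<gamma>\<close> are even.\<close>

locale two_adic_curve = quadratic_valuation "2::int" v
    + short_weierstrass a b c
  for v :: "'k::field_char_0 \<Rightarrow> int" and a b c :: 'k +
  fixes \<alpha> \<beta> \<gamma> :: int
  assumes abc: "a = of_int \<alpha>" "b = 16 * of_int \<beta>" "c = 64 * of_int \<gamma>" and odd_alpha: "odd \<alpha>"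
begin

text \<open>Numerator of the duplication formula in the coordinate X = x / 4, which belongs to the
  model with good or multiplicative reduction. The constant term is - b8 of that model; the
  denominator \<open>den\<close> is its 4 X^3 + b2 X^2 + 2 b4 X + b6.\<close>

definition num :: "'k \<Rightarrow> 'k" where
  "num X = X ^ 4 + of_int (- 2 * \<beta>) * X ^ 2 + of_int (- 8 * \<gamma>) * X ^ 1 + of_int (\<beta> ^ 2 - \<alpha> * \<gamma>)"

definition den :: "'k \<Rightarrow> 'k" where
  "den X = of_int 4 * X ^ 3 + of_int \<alpha> * X ^ 2 + of_int (4 * \<beta>) * X ^ 1 + of_int (4 * \<gamma>)"

lemma double_scaled:
  assumes on: "on_curve E (Affine (4 * X) y)" and y: "y \<noteq> 0"
  shows "den X \<noteq> 0" "\<exists>y'. Affine (4 * X) y [^]\<^bsub>G\<^esub> (2::nat) = Affine (4 * (num X / den X)) y'"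
proof -
  have F: "F (4 * X) = 16 * den X" by (simp add: den_def abc algebra_simps power2_eq_square power3_eq_cube)
  then show d: "den X \<noteq> 0" using on y by auto
  have n: "((4 * X) ^ 2 - b) ^ 2 - 4 * c * (2 * (4 * X) + a) = 256 * num X"
    by (simp add: num_def abc algebra_simps power2_eq_square power4_eq_xxxx)
  have "y ^ 2 = F (4 * X)" using on by simp
  then obtain y' where "ec_add E (Affine (4 * X) y) (Affine (4 * X) y) = Affine (256 * num X / (4 * (16 * den X))) y'"
    using double[of y "4 * X"] y unfolding n F by blast
  moreover have "256 * num X / (4 * (16 * den X)) = 4 * (num X / den X)" by simp
  ultimately show "\<exists>y'. Affine (4 * X) y [^]\<^bsub>G\<^esub> (2::nat) = Affine (4 * (num X / den X)) y'"
    unfolding pow_2[OF on] by metis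
qed

lemma odd_torsion_double:
  assumes "cotorsion 2 (Affine (4 * X) y)"
  shows "den X \<noteq> 0" "\<exists>y'. cotorsion 2 (Affine (4 * (num X / den X)) y') \<and>
     Affine (4 * X) y [^]\<^bsub>G\<^esub> (2::nat) = Affine (4 * (num X / den X)) y'"
proof -
  have on: "on_curve E (Affine (4 * X) y)" using assms cotorsion_on by blast
  have y: "y \<noteq> 0"
  proof
    assume "y = 0"
    then have "Affine (4 * X) y [^]\<^bsub>G\<^esub> (2::nat) = Point_At_Infinity" using pow_2[OF on] by simp
    then show False using cotorsion_pow_eq_infinity assms by blast
  qed
  show "den X \<noteq> 0" using double_scaled[OF on y] by simp
  show "\<exists>y'. cotorsion 2 (Affine (4 * (num X / den X)) y') \<and>
     Affine (4 * X) y [^]\<^bsub>G\<^esub> (2::nat) = Affine (4 * (num X / den X)) y'"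
    using double_scaled(2)[OF on y] cotorsion_pow[OF assms, of 2] by metis
qed

lemma den_lower:
  assumes "vge X n"
  shows "vge (den X) (min (min (4 + 3 * n) (2 * n)) (min (4 + n) 4))"
proof -
  define m where "m = min (min (4 + 3 * n) (2 * n)) (min (4 + n) 4)"
  have m: "m \<le> 4 + 3 * n" "m \<le> 2 * n" "m \<le> 4 + n" "m \<le> 4" by (simp_all add: m_def)
  have 4: "vge (of_int (4 * k)) 4" for k by (rule vge_intI[of 2]) simp_all
  have "vge (of_int 4 * X ^ 3) m" using vge_monom[OF 4[of 1] assms, of m 3] m by simp
  moreover have "vge (of_int \<alpha> * X ^ 2) m" using vge_monom[OF vge_int assms, of m 2] m by simp
  moreover have "vge (of_int (4 * \<beta>) * X ^ 1) m" by (rule vge_monom[OF 4 assms]) (use m in simp)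
  moreover have "vge (of_int (4 * \<gamma>)) m" by (rule vge_mono[OF 4 m(4)])
  ultimately show ?thesis unfolding den_def m_def[symmetric] by (intro vge_add)
qed

text \<open>If X has valuation n < 0, the numerator has valuation 4 n and the denominator at least
  min (4 + 3 n) (2 n), so doubling lowers n strictly.\<close>

lemma odd_torsion_integral:
  assumes "cotorsion 2 (Affine (4 * X) y)"
  shows "vge X 0"
proof (rule ccontr)
  assume "\<not> vge X 0"
  define Z where "Z P \<longleftrightarrow> (\<exists>X y. P = Affine (4 * X) y \<and> \<not> vge X 0)" for P :: "'k ec_point"
  define f where "f P = (case P of Point_At_Infinity \<Rightarrow> 0 | Affine x y \<Rightarrow> v (x / 4))" for P
  have step: "Z (P [^]\<^bsub>G\<^esub> (2::nat)) \<and> f (P [^]\<^bsub>G\<^esub> (2::nat)) < f P"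
    if P: "cotorsion 2 P" "Z P" for P
  proof -
    obtain X y where X: "P = Affine (4 * X) y" "\<not> vge X 0" using P(2) by (auto simp: Z_def)
    have T: "cotorsion 2 (Affine (4 * X) y)" using P X by simp
    obtain n where n: "n < 0" "veq X n" using X(2) not_vge by blast
    have vX: "vge X n" using n veq_vge by blast
    have "veq (num X) (4 * n)"
    proof -
      have "vge (of_int (- 2 * \<beta>) * X ^ 2 + of_int (- 8 * \<gamma>) * X ^ 1 + of_int (\<beta> ^ 2 - \<alpha> * \<gamma>)) (4 * n + 1)"
        using n(1) by (intro vge_add vge_monom[OF vge_int vX] vge_mono[OF vge_int]) auto
      then show ?thesis unfolding num_def add.assoc
        by (intro veq_add[OF veq_power[OF n(2)]]) (auto simp: add.assoc)
    qed
    moreover obtain d where d: "veq (den X) d" "d \<ge> min (4 + 3 * n) (2 * n)"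
      using den_lower[OF vX] odd_torsion_double(1)[OF T] n(1) by (auto simp: vge_def veq_def)
    ultimately have e: "veq (num X / den X) (4 * n - d)" by (intro veq_divide) auto
    have less: "4 * n - d < n" using d(2) n(1) by (auto simp: min_def split: if_splits)
    obtain y' where y': "P [^]\<^bsub>G\<^esub> (2::nat) = Affine (4 * (num X / den X)) y'"
      using odd_torsion_double(2)[OF T] X(1) by blast
    have "\<not> vge (num X / den X) 0" using e less n(1) not_vge by (metis less_trans)
    then have "Z (P [^]\<^bsub>G\<^esub> (2::nat))" unfolding Z_def y' by blast
    moreover have "f (P [^]\<^bsub>G\<^esub> (2::nat)) = 4 * n - d" unfolding y' using e by (simp add: f_def veq_def)
    moreover have "f P = n" using n(2) by (simp add: X(1) f_def veq_def)
    ultimately show ?thesis using less by simp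
  qed
  have "Z (Affine (4 * X) y)" using \<open>\<not> vge X 0\<close> by (auto simp: Z_def)
  then show False
    using cotorsion_descent[of 2 "Affine (4 * X) y" Z f] step assms by blast
qed

lemma double_integral:
  assumes "cotorsion 2 (Affine (4 * X) y)"
  shows "vge (num X / den X) 0"
proof -
  obtain y' where "cotorsion 2 (Affine (4 * (num X / den X)) y')" using odd_torsion_double(2)[OF assms] by blast
  then show ?thesis by (rule odd_torsion_integral)
qed

text \<open>On residues in the field with four elements, doubling maps a primitive cube root of
  unity to 1, maps 1 to 0, and maps 0 to infinity. So the doubles of any nonzero point eventually
  become nonintegral, against \<open>odd_torsion_integral\<close>.\<close>

lemma no_odd_torsion_of_good_reduction:
  assumes good: "odd (\<beta> ^ 2 - \<alpha> * \<gamma>)" and P: "cotorsion 2 P"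
  shows "P = Point_At_Infinity"
proof (cases P)
  case (Affine x y)
  have even1: "vge (of_int k * z) 1" if "even k" "vge z 0" for k z
    using vge_dvd[of k z 1] that by simp
  have den0: "veq (den X) 0" if "veq X 0" for X
  proof -
    have X: "vge X 0" using that veq_vge by blast
    have "den X = of_int \<alpha> * X ^ 2 + (of_int 4 * X ^ 3 + of_int (4 * \<beta>) * X + of_int (4 * \<gamma>) * 1)"
      by (simp add: den_def)
    moreover have "vge (of_int 4 * X ^ 3 + of_int (4 * \<beta>) * X + of_int (4 * \<gamma>) * 1) 1"
      using X by (intro vge_add even1) (auto intro: integral_intros)
    moreover have "veq (of_int \<alpha> * X ^ 2) 0"
      using odd_alpha that by (intro veq_mult[OF veq_unit veq_power]) auto
    ultimately show ?thesis using veq_add by fastforce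
  qed
  have 1: False if T: "cotorsion 2 (Affine (4 * X) y)" and X: "vge X 1" for X y
  proof -
    have X0: "vge X 0" using X vge_mono by fastforce
    have "num X = of_int (\<beta> ^ 2 - \<alpha> * \<gamma>) + X * (X ^ 3 + of_int (- 2 * \<beta>) * X + of_int (- 8 * \<gamma>))"
      by (simp add: num_def algebra_simps power2_eq_square power3_eq_cube power4_eq_xxxx)
    moreover have "vge (X * (X ^ 3 + of_int (- 2 * \<beta>) * X + of_int (- 8 * \<gamma>))) 1"
      using X X0 by (intro vge_mult_left) (auto intro!: integral_intros)
    ultimately have n: "veq (num X) 0" using veq_add[OF veq_unit] good by fastforce
    have "vge (den X) 2" using vge_mono[OF den_lower[OF X]] by simp
    then obtain d where d: "veq (den X) d" "d \<ge> 2"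
      using odd_torsion_double(1)[OF T] by (auto simp: vge_def veq_def)
    have "veq (num X / den X) (0 - d)" by (rule veq_divide[OF n d(1)]) simp
    then show False using double_integral[OF T] vge_veq_unique d(2) by fastforce
  qed
  have 2: False if T: "cotorsion 2 (Affine (4 * X) y)" and X: "vge (X - 1) 1" for X y
  proof -
    have u: "veq X 0" using veq_add[OF veq_unit[of 1] X] by simp
    then have X0: "vge X 0" using veq_vge by blast
    have "num X = (X - 1) * (X ^ 3 + X ^ 2 + X + 1) + (of_int (- 2 * \<beta>) * X ^ 2 + of_int (- 8 * \<gamma>) * X
        + of_int (1 + (\<beta> ^ 2 - \<alpha> * \<gamma>)) * 1)"
      by (simp add: num_def algebra_simps power2_eq_square power3_eq_cube power4_eq_xxxx)
    moreover have "vge \<dots> 1"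
      using X X0 good by (intro vge_add vge_mult_left[OF X] even1) (auto intro: integral_intros)
    ultimately have "vge (num X) 1" by simp
    then have "vge (num X / den X) 1" using vge_divide[OF _ den0[OF u]] by simp
    then show False using 1 odd_torsion_double(2)[OF T] by blast
  qed
  have 3: False if T: "cotorsion 2 (Affine (4 * X) y)" and X: "vge (X ^ 2 - X - 1) 1" for X y
  proof -
    have X0: "vge X 0" using odd_torsion_integral T by blast
    have "\<not> vge X 1" using 1 T by blast
    then have u: "veq X 0" using X0 vge_Suc by simp
    have "num X - den X = (X ^ 2 - X - 1) * (X ^ 2 + X + of_int (2 - \<alpha>)) +
      (of_int (3 - \<alpha>) * X + of_int (2 - \<alpha> + (\<beta> ^ 2 - \<alpha> * \<gamma>)) * 1 + of_int (- 4) * X ^ 3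
        + of_int (- 2 * \<beta>) * X ^ 2 + of_int (- 4 * (2 * \<gamma> + \<beta>)) * X + of_int (- 4 * \<gamma>) * 1)"
      by (simp add: num_def den_def algebra_simps power2_eq_square power3_eq_cube power4_eq_xxxx)
    moreover have "vge \<dots> 1"
      using X X0 good odd_alpha by (intro vge_add vge_mult_left[OF X] even1) (auto intro!: integral_intros)
    ultimately have "vge (num X - den X) 1" by simp
    then have "vge ((num X - den X) / den X) 1" using vge_divide[OF _ den0[OF u]] by simp
    then have "vge (num X / den X - 1) 1" using odd_torsion_double(1)[OF T] by (simp add: diff_divide_distrib)
    then show False using 2 odd_torsion_double(2)[OF T] by blast
  qed
  have "cotorsion 2 (Affine (4 * (x / 4)) y)" using P Affine by simp
  then have "vge (x / 4) 1 \<or> vge (x / 4 - 1) 1 \<or> vge ((x / 4) ^ 2 - x / 4 - 1) 1" "cotorsion 2 (Affine (4 * (x / 4)) y)"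
    using residue2[OF refl odd_torsion_integral] by simp_all
  then have False using 1[of "x / 4" y] 2[of "x / 4" y] 3[of "x / 4" y] by argo
  then show ?thesis by simp
next
  case Point_At_Infinity
  then show ?thesis by simp
qed

end

lemma (in comm_group) coprime_torsion_pow_mem:
  assumes H: "subgroup H G" and x: "coprime_torsion q x" "x [^] (q::nat) \<in> H"
  shows "x \<in> H"
proof -
  obtain n :: nat where n: "n > 0" "coprime n q" "x [^] n = \<one>" "x \<in> carrier G"
    using x(1) by (auto simp: coprime_torsion_def)
  have "coprime (int n) (int q)" using n(2) by simp
  then obtain u w where uw: "u * int n + w * int q = 1" using bezout_int[of "int n" "int q"] by auto
  have "x = x [^] (u * int n + w * int q)" using uw n(4) by (simp add: int_pow_1)
  also have "\<dots> = (x [^] int n) [^] u \<otimes> (x [^] int q) [^] w"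
    using n(4) by (simp add: int_pow_mult int_pow_pow mult.commute)
  also have "\<dots> = (x [^] q) [^] w" using n x(2) H by (simp add: int_pow_int int_pow_one)
  finally show ?thesis using subgroup_int_pow_closed[OF H x(2), of w] by metis
qed

context two_adic_curve
begin

lemma even1: "even k \<Longrightarrow> vge z 0 \<Longrightarrow> vge (of_int k * z) 1"
  using vge_dvd[of k z 1] by simp

lemma sum_difference_scaled:
  assumes "cotorsion 2 (Affine (4 * X1) y1)" "cotorsion 2 (Affine (4 * X2) y2)" "X1 \<noteq> X2"
  obtains U w U' w' where "ec_add E (Affine (4 * X1) y1) (Affine (4 * X2) y2) = Affine (4 * U) w"
    "ec_add E (Affine (4 * X1) y1) (neg (Affine (4 * X2) y2)) = Affine (4 * U') w'"
    "cotorsion 2 (Affine (4 * U) w)" "cotorsion 2 (Affine (4 * U') w')"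
    "(U + U') * (X1 - X2) ^ 2 = of_int 2 * (X1 * X2 * (X1 + X2)) + of_int \<alpha> * (X1 * X2)
       + of_int (2 * \<beta>) * (X1 + X2) + of_int (4 * \<gamma>) * 1"
    "\<gamma> = 0 \<Longrightarrow> U * U' * (X1 - X2) ^ 2 = (X1 * X2 - of_int \<beta>) ^ 2"
proof -
  have on: "y1 ^ 2 = F (4 * X1)" "y2 ^ 2 = F (4 * X2)"
    using cotorsion_on[OF assms(1)] cotorsion_on[OF assms(2)] by simp_all
  have ne: "4 * X1 \<noteq> 4 * X2" using assms(3) by simp
  obtain u w u' w' where *: "ec_add E (Affine (4 * X1) y1) (Affine (4 * X2) y2) = Affine u w"
    "ec_add E (Affine (4 * X1) y1) (neg (Affine (4 * X2) y2)) = Affine u' w'"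
    "(u + u') * (4 * X1 - 4 * X2) ^ 2 = 2 * (4 * X1) * (4 * X2) * (4 * X1 + 4 * X2) + 4 * a * (4 * X1) * (4 * X2)
       + 2 * b * (4 * X1 + 4 * X2) + 4 * c"
    "u * u' * (4 * X1 - 4 * X2) ^ 2 = ((4 * X1) * (4 * X2) - b) ^ 2 - 4 * c * (4 * X1 + 4 * X2 + a)"
    using sum_difference[OF on ne] by metis
  define U U' where "U = u / 4" and "U' = u' / 4"
  have u: "u = 4 * U" "u' = 4 * U'" by (simp_all add: U_def U'_def)
  have "64 * ((U + U') * (X1 - X2) ^ 2) = 64 * (of_int 2 * (X1 * X2 * (X1 + X2)) + of_int \<alpha> * (X1 * X2)
       + of_int (2 * \<beta>) * (X1 + X2) + of_int (4 * \<gamma>) * 1)"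
    using *(3) unfolding u abc by (simp add: algebra_simps power2_eq_square)
  then have 1: "(U + U') * (X1 - X2) ^ 2 = of_int 2 * (X1 * X2 * (X1 + X2)) + of_int \<alpha> * (X1 * X2)
       + of_int (2 * \<beta>) * (X1 + X2) + of_int (4 * \<gamma>) * 1" by (simp only: mult_left_cancel[OF zero_neq_numeral[symmetric]])
  have 2: "U * U' * (X1 - X2) ^ 2 = (X1 * X2 - of_int \<beta>) ^ 2" if "\<gamma> = 0"
  proof -
    have "256 * (U * U' * (X1 - X2) ^ 2) = 256 * (X1 * X2 - of_int \<beta>) ^ 2"
      using *(4) that unfolding u abc by (simp add: algebra_simps power2_eq_square)
    then show ?thesis by (simp only: mult_left_cancel[OF zero_neq_numeral[symmetric]])
  qed
  show thesis
  proof (rule that[OF _ _ _ _ 1 2])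
    show s: "ec_add E (Affine (4 * X1) y1) (Affine (4 * X2) y2) = Affine (4 * U) w"
      "ec_add E (Affine (4 * X1) y1) (neg (Affine (4 * X2) y2)) = Affine (4 * U') w'"
      using *(1,2) u by simp_all
    show "cotorsion 2 (Affine (4 * U) w)" using cotorsion_add[OF assms(1,2)] unfolding s(1) .
    show "cotorsion 2 (Affine (4 * U') w')" using cotorsion_add[OF assms(1) cotorsion_neg[OF assms(2)]] unfolding s(2) .
  qed
qed

text \<open>Two odd torsion points with the same residue differ by a sign: otherwise their sum and
  difference are integral, but the denominator in the sum formula is not a unit.\<close>

lemma congruent_odd_torsion:
  assumes T: "cotorsion 2 (Affine (4 * X1) y1)" "cotorsion 2 (Affine (4 * X2) y2)"
    and X: "veq X1 0" "vge (X1 - X2) 1"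
  shows "Affine (4 * X1) y1 = Affine (4 * X2) y2 \<or> Affine (4 * X1) y1 = neg (Affine (4 * X2) y2)"
proof (cases "X1 = X2")
  case True
  then show ?thesis using equal_x cotorsion_on[OF T(1)] cotorsion_on[OF T(2)] by blast
next
  case False
  obtain U w U' w' where s: "cotorsion 2 (Affine (4 * U) w)" "cotorsion 2 (Affine (4 * U') w')"
    "(U + U') * (X1 - X2) ^ 2 = of_int 2 * (X1 * X2 * (X1 + X2)) + of_int \<alpha> * (X1 * X2)
       + of_int (2 * \<beta>) * (X1 + X2) + of_int (4 * \<gamma>) * 1"
    using sum_difference_scaled[OF T False] by metis
  have X2: "veq X2 0" using veq_cong[OF X] by simp
  have i: "vge X1 0" "vge X2 0" using X(1) X2 veq_vge by blast+
  have "vge (of_int 2 * (X1 * X2 * (X1 + X2)) + (of_int (2 * \<beta>) * (X1 + X2) + of_int (4 * \<gamma>) * 1)) 1"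
    using i by (intro vge_add even1) (auto intro!: integral_intros)
  moreover have "veq (of_int \<alpha> * (X1 * X2)) 0"
    using odd_alpha X(1) X2 by (intro veq_mult[OF veq_unit veq_mult]) auto
  ultimately have "veq (of_int \<alpha> * (X1 * X2) + (of_int 2 * (X1 * X2 * (X1 + X2))
      + (of_int (2 * \<beta>) * (X1 + X2) + of_int (4 * \<gamma>) * 1))) 0" by (intro veq_add) auto
  then have r: "veq ((U + U') * (X1 - X2) ^ 2) 0" unfolding s(3) by (simp add: algebra_simps)
  have "vge ((U + U') * (X1 - X2) ^ 2) 2"
    using odd_torsion_integral[OF s(1)] odd_torsion_integral[OF s(2)]
    by (intro vge_monom[OF vge_add X(2)]) auto
  then show ?thesis using r vge_veq_unique by fastforce
qed

text \<open>For even \<beta> and \<gamma> the reduced equation divided by X^2 reads t^2 + t = X +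
  \<kappa>, where t = Y / X. On the field with four elements t^2 + t only takes the values 0 and 1,
  so the unit X has residue 1.\<close>

lemma unit_residue:
  assumes \<alpha>: "4 dvd \<alpha> - 1" and ev: "even \<beta>" "even \<gamma>"
    and on: "on_curve E (Affine (4 * X) y)" and X: "veq X 0"
  shows "vge (X - 1) 1"
proof -
  obtain \<kappa> where \<kappa>: "\<alpha> = 1 + 4 * \<kappa>" using \<alpha> by (metis add.commute diff_add_cancel dvd_def)
  have X0: "X \<noteq> 0" and i: "vge X 0" using X veq_nz veq_vge by blast+
  define t where "t = (y - 4 * X) / (8 * X)"
  have y: "y = 4 * X * (2 * t + 1)" using X0 by (simp add: t_def field_simps)
  define r where "r = X + of_int \<kappa> + (of_int \<beta> * X + of_int \<gamma> * 1) / X ^ 2"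
  have "y ^ 2 = 16 * (4 * X ^ 3 + of_int \<alpha> * X ^ 2 + 4 * of_int \<beta> * X + 4 * of_int \<gamma>)"
    using on by (simp add: abc algebra_simps power2_eq_square power3_eq_cube)
  then have "64 * (X ^ 2 * (t ^ 2 + t)) = 64 * (X ^ 3 + of_int \<kappa> * X ^ 2 + of_int \<beta> * X + of_int \<gamma>)"
    unfolding y \<kappa> by (simp add: algebra_simps power2_eq_square power3_eq_cube)
  then have "X ^ 2 * (t ^ 2 + t) = X ^ 3 + of_int \<kappa> * X ^ 2 + of_int \<beta> * X + of_int \<gamma>"
    by (simp only: mult_left_cancel[OF zero_neq_numeral[symmetric]])
  also have "\<dots> = X ^ 2 * r" using X0 by (simp add: r_def field_simps power2_eq_square power3_eq_cube)
  finally have tr: "t ^ 2 + t = r" using X0 by simp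
  have even_part: "vge ((of_int \<beta> * X + of_int \<gamma> * 1) / X ^ 2) 1"
  proof -
    have "vge (of_int \<beta> * X + of_int \<gamma> * 1) 1" using ev i by (intro vge_add even1) simp_all
    moreover have "veq (X ^ 2) 0" using veq_power[OF X] by simp
    ultimately show ?thesis using vge_divide by fastforce
  qed
  have ri: "vge r 0" unfolding r_def
    using i even_part vge_mono[OF even_part, of 0] by (auto intro: integral_intros)
  have t: "vge t 0"
  proof (rule ccontr)
    assume "\<not> vge t 0"
    then obtain n where n: "n < 0" "veq t n" using not_vge by blast
    have "veq (t ^ 2 + t) (2 * n)"
      using n by (intro veq_add[OF veq_power[OF n(2)] veq_vge[OF n(2) order_refl]]) auto
    then show False using tr ri n(1) vge_veq_unique by fastforce
  qed
  have "vge (t ^ 2 + t) 1 \<or> vge (t ^ 2 + t - 1) 1"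
    using residue2[OF refl t]
  proof (elim disjE)
    assume "vge t 1"
    then have "vge (t * (t + 1)) 1" using t by (intro vge_mult_left) (auto intro: integral_intros)
    then show ?thesis by (simp add: algebra_simps power2_eq_square)
  next
    assume *: "vge (t - 1) 1"
    have "vge ((t - 1) * (t + 2) + of_int 2 * 1) 1"
      using * t by (intro vge_add vge_mult_left even1) (auto intro: integral_intros)
    then show ?thesis by (simp add: algebra_simps power2_eq_square)
  next
    assume *: "vge (t ^ 2 - t - 1) 1"
    have "vge ((t ^ 2 - t - 1) + of_int 2 * t) 1" using * t by (intro vge_add even1) auto
    then show ?thesis by (simp add: algebra_simps power2_eq_square)
  qed
  then obtain e :: int where e: "vge (r - of_int e) 1" unfolding tr by (metis diff_zero of_int_0 of_int_1)
  have "X - of_int (e - \<kappa>) = (r - of_int e) - (of_int \<beta> * X + of_int \<gamma> * 1) / X ^ 2"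
    by (simp add: r_def)
  then have x: "vge (X - of_int (e - \<kappa>)) 1"
    using vge_diff[OF e even_part] by (simp only:)
  have "odd (e - \<kappa>)"
  proof
    assume "even (e - \<kappa>)"
    then have "vge (of_int (e - \<kappa>)) 1" by (simp only: vge_int_1_iff)
    then have "vge X 1" using vge_add[OF x] by fastforce
    then show False using X vge_veq_unique by fastforce
  qed
  then have "vge (of_int (e - \<kappa> - 1)) 1" unfolding vge_int_1_iff by simp
  then have "vge ((X - of_int (e - \<kappa>)) + of_int (e - \<kappa> - 1)) 1" using x vge_add by blast
  then show ?thesis by simp
qed

lemma odd_torsion_unique:
  assumes \<alpha>: "4 dvd \<alpha> - 1" and ev: "even \<beta>" "even \<gamma>"
    and T: "cotorsion 2 (Affine (4 * X1) y1)" "cotorsion 2 (Affine (4 * X2) y2)"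
    and X: "veq X1 0" "veq X2 0"
  shows "Affine (4 * X1) y1 = Affine (4 * X2) y2 \<or> Affine (4 * X1) y1 = neg (Affine (4 * X2) y2)"
proof -
  have 1: "vge (X1 - 1) 1" using unit_residue[OF \<alpha> ev cotorsion_on[OF T(1)] X(1)] .
  have 2: "vge (X2 - 1) 1" using unit_residue[OF \<alpha> ev cotorsion_on[OF T(2)] X(2)] .
  show ?thesis using congruent_odd_torsion[OF T X(1)] vge_diff[OF 1 2] by simp
qed

lemma double_unit:
  assumes ev: "even \<beta>" "even \<gamma>" and X: "veq X 0"
  shows "veq (num X / den X) 0"
proof -
  have i: "vge X 0" using X veq_vge by blast
  have "vge (of_int (- 2 * \<beta>) * X ^ 2 + of_int (- 8 * \<gamma>) * X ^ 1 + of_int (\<beta> ^ 2 - \<alpha> * \<gamma>) * 1) 1"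
    using i ev by (intro vge_add even1) (auto intro: integral_intros)
  then have n: "veq (X ^ 4 + (of_int (- 2 * \<beta>) * X ^ 2 + of_int (- 8 * \<gamma>) * X ^ 1 + of_int (\<beta> ^ 2 - \<alpha> * \<gamma>) * 1)) 0"
    by (intro veq_add[OF veq_power[OF X]]) auto
  have "vge (of_int 4 * X ^ 3 + of_int (4 * \<beta>) * X ^ 1 + of_int (4 * \<gamma>) * 1) 1"
    using i by (intro vge_add even1) (auto intro: integral_intros)
  then have d: "veq (of_int \<alpha> * X ^ 2 + (of_int 4 * X ^ 3 + of_int (4 * \<beta>) * X ^ 1 + of_int (4 * \<gamma>) * 1)) 0"
    using odd_alpha by (intro veq_add[OF veq_mult[OF veq_unit veq_power[OF X]]]) auto
  have "veq (num X) 0" using n unfolding num_def by (simp add: algebra_simps)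
  moreover have "veq (den X) 0" using d unfolding den_def by (simp add: algebra_simps)
  ultimately show ?thesis by (intro veq_divide) auto
qed

text \<open>The node splits off a component group of order 2 (or 4 if 2 ramifies), so quadruples of points
  reduce to nonsingular points.\<close>

lemma odd_torsion_unit:
  assumes ev: "even \<beta>" "even \<gamma>" and b8: "\<beta> ^ 2 - \<alpha> * \<gamma> = 4 * \<delta>" "odd \<delta>"
    and T: "cotorsion 2 (Affine (4 * X) y)"
  shows "veq X 0"
proof -
  have v4: "vge (of_int (4 * k)) 4" for k by (rule vge_intI[of 2]) simp_all
  have v4': "vge (of_int 4) 4" by (rule vge_intI[of 2]) simp_all
  have v8: "vge (of_int (- 8 * k)) 6" for k by (rule vge_intI[of 3]) simp_all
  have vb: "vge (of_int (- 2 * \<beta>)) 4" using ev(1) by (intro vge_intI[of 2]) auto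
  have vc: "vge (of_int (4 * \<gamma>)) 6" using ev(2) by (intro vge_intI[of 3]) auto
  have b: "veq (of_int (\<beta> ^ 2 - \<alpha> * \<gamma>)) 4" using b8 by (intro veq_intI[of _ 2 \<delta>]) simp_all
  \<comment> \<open>The constant term gives the numerator valuation exactly 4 and the denominator
    has at least 4; since the double is integral, the two are equal.\<close>
  have step2: "veq (num X / den X) 0" if T: "cotorsion 2 (Affine (4 * X) y)" and X: "vge X 2" for X y
  proof -
    have "vge (X ^ 4 + of_int (- 2 * \<beta>) * X ^ 2 + of_int (- 8 * \<gamma>) * X ^ 1) 8"
      by (intro vge_add vge_monom[OF vb X] vge_monom[OF v8 X] vge_power[OF X]) simp_all
    then have n: "veq (num X) 4" unfolding num_def by (rule veq_add'[OF _ b]) simp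
    have "vge (den X) 4" unfolding den_def
      by (intro vge_add vge_monom[OF v4' X] vge_monom[OF v4 X] vge_monom[OF vge_int X] vge_mono[OF vc])
        simp_all
    then obtain d where d: "veq (den X) d" "d \<ge> 4"
      using odd_torsion_double(1)[OF T] by (auto simp: vge_def veq_def)
    have e: "veq (num X / den X) (4 - d)" using veq_divide[OF n d(1)] by simp
    moreover have "0 \<le> 4 - d" using vge_veq_unique[OF double_integral[OF T] e] .
    ultimately show ?thesis using d(2) by simp
  qed
  have step1: "vge (num X / den X) 2" if X: "veq X 1" for X
  proof -
    have X1: "vge X 1" using X veq_vge by blast
    have n: "vge (num X) 4" unfolding num_def
      by (intro vge_add vge_monom[OF vb X1] vge_monom[OF v8 X1] vge_power[OF X1] veq_vge[OF b]) simp_all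
    have "vge (of_int 4 * X ^ 3 + of_int (4 * \<beta>) * X ^ 1 + of_int (4 * \<gamma>)) 3"
      by (intro vge_add vge_monom[OF v4' X1] vge_monom[OF v4 X1] vge_mono[OF vc]) simp_all
    then have "veq (of_int \<alpha> * X ^ 2 + (of_int 4 * X ^ 3 + of_int (4 * \<beta>) * X ^ 1 + of_int (4 * \<gamma>))) 2"
      using odd_alpha by (intro veq_add[OF veq_mult[OF veq_unit veq_power[OF X]]]) auto
    then have "veq (den X) 2" unfolding den_def by (simp add: algebra_simps)
    then show ?thesis using vge_divide[OF n] by simp
  qed
  \<comment> \<open>The given point is four times another odd torsion point, and two doublings make
    X a unit from valuation 0, 1 or at least 2.\<close>
  obtain R where R: "cotorsion 2 R" "R [^]\<^bsub>G\<^esub> ((2::nat) ^ 2) = Affine (4 * X) y" using cotorsion_root[OF T] by blast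
  have "(R [^]\<^bsub>G\<^esub> (2::nat)) [^]\<^bsub>G\<^esub> (2::nat) = Affine (4 * X) y"
    using R cotorsion_on[OF R(1)] grp.nat_pow_pow[of R 2 2] by (simp add: G_simps del: on_curve.simps)
  moreover have "R \<noteq> Point_At_Infinity" using calculation grp.nat_pow_one[of 2] by (auto simp: G_simps)
  ultimately obtain x0 y0 where R0: "R = Affine (4 * x0) y0"
    "(Affine (4 * x0) y0 [^]\<^bsub>G\<^esub> (2::nat)) [^]\<^bsub>G\<^esub> (2::nat) = Affine (4 * X) y"
    by (cases R) (auto intro: that[of "_ / 4"])
  have T0: "cotorsion 2 (Affine (4 * x0) y0)" using R(1) R0(1) by simp
  define x1 where "x1 = num x0 / den x0"
  obtain y1 where y1: "cotorsion 2 (Affine (4 * x1) y1)" "Affine (4 * x0) y0 [^]\<^bsub>G\<^esub> (2::nat) = Affine (4 * x1) y1"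
    using odd_torsion_double(2)[OF T0] unfolding x1_def by blast
  have "4 * X = 4 * (num x1 / den x1)"
    using odd_torsion_double(2)[OF y1(1)] R0(2) unfolding y1(2) by fastforce
  then have X: "X = num x1 / den x1" by (simp only: mult_left_cancel[OF zero_neq_numeral[symmetric]])
  note u = double_unit[OF ev]
  consider "veq x0 0" | "veq x0 1" | "vge x0 2"
    using odd_torsion_integral[OF T0] vge_Suc[of x0 0] vge_Suc[of x0 1] by auto
  then show ?thesis
  proof cases
    case 1 then show ?thesis unfolding X x1_def by (intro u)
  next
    case 2
    then have "vge x1 2" unfolding x1_def by (rule step1)
    then show ?thesis unfolding X by (rule step2[OF y1(1)])
  next
    case 3
    then have "veq x1 0" unfolding x1_def by (rule step2[OF T0])
    then show ?thesis unfolding X by (rule u)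
  qed
qed

text \<open>Every nonzero odd torsion point has unit X, hence residue 1 like \<open>T\<close>, and
  points with equal unit residue agree up to sign.\<close>

lemma odd_torsion_three_elements:
  assumes "4 dvd \<alpha> - 1" "even \<beta>" "even \<gamma>" "\<beta> ^ 2 - \<alpha> * \<gamma> = 4 * \<delta>" "odd \<delta>"
    and T: "cotorsion 2 T" "T \<noteq> Point_At_Infinity" and P: "cotorsion 2 P"
  shows "P = Point_At_Infinity \<or> P = T \<or> P = neg T"
proof (cases P; cases T)
  fix x1 y1 x2 y2 assume *: "P = Affine x1 y1" "T = Affine x2 y2"
  have PT: "cotorsion 2 (Affine (4 * (x1 / 4)) y1)" "cotorsion 2 (Affine (4 * (x2 / 4)) y2)"
    using P T * by simp_all
  show ?thesis
    using odd_torsion_unique[OF assms(1-3) PT odd_torsion_unit[OF assms(2-5) PT(1)] odd_torsion_unit[OF assms(2-5) PT(2)]]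
    by (simp add: *)
qed (use T in auto)

end

section \<open>Quartics without roots in a quadratic field\<close>

context quadratic_valuation
begin

text \<open>An integral quartic without roots in the field of \<open>p^2\<close> elements: its remainder modulo a monic
  quadratic polynomial \<open>x^2 - s x - t\<close> is \<open>A x + B\<close>.\<close>

lemma quartic_no_root:
  fixes c0 c1 c2 c3 c4 :: int and x :: 'k
  assumes c4: "\<not> p dvd c4"
    and lin': "\<forall>r\<in>set [0..p - 1]. \<not> p dvd c4 * r ^ 4 + c3 * r ^ 3 + c2 * r ^ 2 + c1 * r + c0"
    and quad': "\<forall>s\<in>set [0..p - 1]. \<forall>t\<in>set [0..p - 1]. p dvd c4 * (s ^ 3 + 2 * s * t) + c3 * (s ^ 2 + t) + c2 * s + c1
      \<longrightarrow> \<not> p dvd c4 * (s ^ 2 + t) * t + c3 * s * t + c2 * t + c0"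
    and x: "of_int c4 * x ^ 4 + of_int c3 * x ^ 3 + of_int c2 * x ^ 2 + of_int c1 * x + of_int c0 = 0"
  shows False
proof -
  \<comment> \<open>The hypotheses range over explicit lists so that they can be decided by
    evaluation.\<close>
  have set: "set [0..p - 1] = {0..<p}" by auto
  note lin = bspec[OF lin'[unfolded set]] and quad = bspec[OF bspec[OF quad'[unfolded set]], rule_format]
  have xi: "vge x 0"
  proof (rule ccontr)
    assume "\<not> vge x 0"
    then obtain n where n: "n < 0" "veq x n" using not_vge by blast
    have xn: "vge x n" using n veq_vge by blast
    have "vge (of_int c3 * x ^ 3 + of_int c2 * x ^ 2 + of_int c1 * x ^ 1 + of_int c0) (3 * n)"
      using n(1) by (intro vge_add vge_monom[OF vge_int xn] vge_mono[OF vge_int]) simp_all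
    then have "veq (of_int c4 * x ^ 4 + (of_int c3 * x ^ 3 + of_int c2 * x ^ 2 + of_int c1 * x ^ 1 + of_int c0)) (4 * n)"
      using n(1) by (intro veq_add[OF veq_mult[OF veq_unit[OF c4] veq_power[OF n(2)]]]) auto
    then show False using x by (simp add: add.assoc veq_def)
  qed
  have 1: False if r: "r \<in> {0..<p}" "vge (x - of_int r) 1" for r
  proof -
    define R where "R = (of_int r :: 'k)"
    have R: "vge R 0" by (simp add: R_def)
    define W where "W = of_int c4 * (x ^ 3 + x ^ 2 * R + x * R ^ 2 + R ^ 3) + of_int c3 * (x ^ 2 + x * R + R ^ 2) + of_int c2 * (x + R) + of_int c1"
    have "of_int (c4 * r ^ 4 + c3 * r ^ 3 + c2 * r ^ 2 + c1 * r + c0)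
      = (of_int c4 * x ^ 4 + of_int c3 * x ^ 3 + of_int c2 * x ^ 2 + of_int c1 * x + of_int c0) - (x - R) * W"
      by (simp add: W_def R_def algebra_simps power2_eq_square power3_eq_cube power4_eq_xxxx)
    also have "\<dots> = - ((x - R) * W)" using x by simp
    finally have e: "of_int (c4 * r ^ 4 + c3 * r ^ 3 + c2 * r ^ 2 + c1 * r + c0) = - ((x - R) * W)" .
    have "vge W 0" using xi R unfolding W_def by (intro integral_intros)
    then have "vge (- ((x - R) * W)) 1" using r(2) unfolding vge_minus R_def by (intro vge_mult_left)
    then show False using lin[OF r(1)] unfolding e[symmetric] vge_int_1_iff by blast
  qed
  from xi show False
  proof (cases rule: residue_cases)
    case (1 r) then show False using \<open>\<And>r. r \<in> {0..<p} \<Longrightarrow> vge (x - of_int r) 1 \<Longrightarrow> False\<close> by blast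
  next
    case (2 s t)
    \<comment> \<open>The remainder modulo x^2 - s x - t. If p divides A it would also divide B,
      which the hypothesis forbids; if not, x has its residue in the prime field, the case already
      excluded.\<close>
    define A B where "A = c4 * (s ^ 3 + 2 * s * t) + c3 * (s ^ 2 + t) + c2 * s + c1"
      and "B = c4 * (s ^ 2 + t) * t + c3 * s * t + c2 * t + c0"
    define W where "W = of_int c4 * x ^ 2 + of_int (c4 * s + c3) * x + of_int (c4 * (s ^ 2 + t) + c3 * s + c2)"
    have "of_int A * x + of_int B = (of_int c4 * x ^ 4 + of_int c3 * x ^ 3 + of_int c2 * x ^ 2 + of_int c1 * x + of_int c0)
      - (x ^ 2 - (of_int s * x + of_int t)) * W"
      by (simp add: W_def A_def B_def algebra_simps power2_eq_square power3_eq_cube power4_eq_xxxx)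
    also have "\<dots> = - ((x ^ 2 - (of_int s * x + of_int t)) * W)" using x by simp
    finally have e: "of_int A * x + of_int B = - ((x ^ 2 - (of_int s * x + of_int t)) * W)" .
    have "vge W 0" using xi unfolding W_def by (intro integral_intros)
    then have AB: "vge (of_int A * x + of_int B) 1" unfolding e vge_minus using 2(3) by (intro vge_mult_left)
    show False
    proof (cases "p dvd A")
      case True
      have "vge (of_int A * x) 1" using vge_dvd[OF True xi] by simp
      then have "vge (of_int B) 1" using vge_diff[OF AB, of "of_int A * x"] by simp
      then show False using quad[OF 2(1,2)] True unfolding A_def B_def vge_int_1_iff by blast
    next
      case False
      then show False using residue_int[OF False AB xi] 1 by blast
    qed
  qed
qed

end

text \<open>Doubling on the integers modulo 2 m up to sign, with representatives 0, ..., m.\<close>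

definition tent :: "int \<Rightarrow> int \<Rightarrow> int" where
  "tent m k = (if 2 * k < m then 2 * k else if 2 * k = m then m else 2 * m - 2 * k)"

context two_adic_curve
begin

text \<open>When \<beta> is even and \<gamma> = 0 the node of the reduction is X = 0, and the
  valuation of X names, up to sign, the component on which the point lies. Depth 0 means nonsingular
  reduction.\<close>

definition depth :: "'k ec_point \<Rightarrow> int \<Rightarrow> bool" where
  "depth P k \<longleftrightarrow> (\<exists>X y. P = Affine (4 * X) y \<and> cotorsion 2 P \<and> veq X k)"

lemma depthI: "cotorsion 2 (Affine (4 * X) y) \<Longrightarrow> veq X k \<Longrightarrow> depth (Affine (4 * X) y) k"
  unfolding depth_def by blast

lemma depthD: "depth (Affine (4 * X) y) k \<Longrightarrow> veq X k"
  unfolding depth_def by (metis ec_point.inject mult_left_cancel zero_neq_numeral)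

lemma depth_unique: "depth P k \<Longrightarrow> depth P l \<Longrightarrow> k = l"
  by (auto simp: depth_def veq_def)

context
  fixes m :: int
  assumes \<gamma>: "\<gamma> = 0" and m: "veq (of_int \<beta>) m" "m \<ge> 2"
begin

lemma num_den: "num X = (X ^ 2 - of_int \<beta>) ^ 2" "den X = X * (of_int 4 * X ^ 2 + of_int \<alpha> * X + of_int 4 * of_int \<beta>)"
  by (simp_all only: num_def den_def)
    (simp_all add: \<gamma> algebra_simps power2_eq_square power3_eq_cube power4_eq_xxxx)

lemma v4: "veq (of_int 4) 4"
  by (rule veq_intI[of 4 2 1 4]) simp_all

lemma even_beta: "even \<beta>"
  using vge_int_1_iff[of \<beta>] veq_vge[OF m(1)] m(2) by simp

lemma den_depth:
  assumes X: "veq X k" "0 \<le> k" "k < m + 4"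
  shows "veq (den X) (2 * k)"
proof -
  have "vge (of_int 4 * X ^ 2 + of_int 4 * of_int \<beta>) (k + 1)"
    using X m(2) by (intro vge_add vge_monom[OF veq_vge[OF v4 order_refl] veq_vge[OF X(1) order_refl]]
       vge_mult[OF veq_vge[OF v4 order_refl] veq_vge[OF m(1) order_refl]]) simp_all
  moreover have "veq (of_int \<alpha> * X) k" using odd_alpha X(1) by (intro veq_mult[OF veq_unit]) auto
  ultimately have "veq (of_int \<alpha> * X + (of_int 4 * X ^ 2 + of_int 4 * of_int \<beta>)) k" by (intro veq_add) auto
  then have "veq (X * (of_int \<alpha> * X + (of_int 4 * X ^ 2 + of_int 4 * of_int \<beta>))) (2 * k)"
    using X(1) by (intro veq_mult) auto
  then show ?thesis unfolding num_den by (simp add: algebra_simps)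
qed

text \<open>If v(X) exceeded m, the numerator of the double would have valuation 2 m and the
  denominator at least 2 m + 2, so the double would not be integral.\<close>

lemma depth_exists:
  assumes P: "cotorsion 2 P" "P \<noteq> Point_At_Infinity"
  shows "\<exists>k. 0 \<le> k \<and> k \<le> m \<and> depth P k"
proof (cases P)
  case (Affine x y)
  define X where "X = x / 4"
  have T: "cotorsion 2 (Affine (4 * X) y)" using P Affine by (simp add: X_def)
  have "\<not> vge X (m + 1)"
  proof
    assume X: "vge X (m + 1)"
    have "vge (of_int 4 * X ^ 2 + of_int \<alpha> * X + of_int 4 * of_int \<beta>) (m + 1)"
      using m(2) by (intro vge_add vge_monom[OF veq_vge[OF v4 order_refl] X] vge_mult[OF vge_int X]
         vge_mult[OF veq_vge[OF v4 order_refl] veq_vge[OF m(1) order_refl]]) simp_all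
    then have "vge (den X) (2 * m + 2)" unfolding num_den by (intro vge_mult[OF X]) auto
    then obtain d where d: "veq (den X) d" "d \<ge> 2 * m + 2"
      using odd_torsion_double(1)[OF T] by (auto simp: vge_def veq_def)
    have "veq (X ^ 2 - of_int \<beta>) m"
    proof -
      have "vge (X ^ 2) (m + 1)" using vge_power[OF X, of "m + 1" 2] m(2) by simp
      then have "veq (X ^ 2 + - of_int \<beta>) m" using m(1) by (intro veq_add'[of "X^2" "m + 1"]) auto
      then show ?thesis by simp
    qed
    then have "veq (num X) (2 * m)" unfolding num_den by (rule veq_power) simp
    then have e: "veq (num X / den X) (2 * m - d)" using d(1) by (intro veq_divide) auto
    show False using vge_veq_unique[OF double_integral[OF T] e] d(2) by simp
  qed
  then obtain k where "veq X k" "k < m + 1" using not_vge by blast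
  moreover have "0 \<le> k" using vge_veq_unique[OF odd_torsion_integral[OF T] calculation(1)] .
  ultimately show ?thesis using T Affine unfolding depth_def X_def
    by (intro exI[of _ k] conjI exI[of _ "x / 4"] exI[of _ y]) auto
qed (use P in simp)

lemma depth_le:
  assumes "depth P k"
  shows "0 \<le> k" "k \<le> m"
proof -
  have "cotorsion 2 P" "P \<noteq> Point_At_Infinity" using assms by (auto simp: depth_def)
  then show "0 \<le> k" "k \<le> m" using depth_exists depth_unique assms by blast+
qed

lemma depth_double:
  assumes P: "depth P k"
  shows "depth (P [^]\<^bsub>G\<^esub> (2::nat)) (tent m k)"
proof -
  obtain X y where X: "P = Affine (4 * X) y" "cotorsion 2 (Affine (4 * X) y)" "veq X k"
    using P by (auto simp: depth_def)
  note k = depth_le[OF P]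
  obtain y' where y': "cotorsion 2 (Affine (4 * (num X / den X)) y')" "P [^]\<^bsub>G\<^esub> (2::nat) = Affine (4 * (num X / den X)) y'"
    using odd_torsion_double(2)[OF X(2)] X(1) by blast
  have d: "veq (den X) (2 * k)" using den_depth[OF X(3)] k by simp
  have X2: "veq (X ^ 2) (2 * k)" by (rule veq_power[OF X(3)]) simp
  consider "2 * k < m" | "2 * k = m" | "m < 2 * k" by linarith
  then show ?thesis
  proof cases
    case 1
    have "veq (X ^ 2 - of_int \<beta>) (2 * k)" using veq_diff[OF X2 veq_vge[OF m(1) order_refl] 1] .
    then have "veq (num X) (4 * k)" unfolding num_den by (intro veq_power) auto
    then have "veq (num X / den X) (2 * k)" using d by (intro veq_divide) auto
    from depthI[OF y'(1) this] show ?thesis unfolding y'(2) tent_def using 1 by (simp only: if_True)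
  next
    case 2
    \<comment> \<open>In the middle X^2 and \<beta> may cancel, which leaves only the lower bound m;
      equality follows because no depth exceeds m.\<close>
    have "vge (X ^ 2 - of_int \<beta>) m" using veq_vge[OF X2, of m] veq_vge[OF m(1), of m] 2 by (intro vge_diff) auto
    then have "vge (num X) (2 * m)" unfolding num_den by (intro vge_power) auto
    then have n: "vge (num X / den X) m" using d 2 by (intro vge_divide) auto
    obtain l where l: "l \<le> m" "depth (P [^]\<^bsub>G\<^esub> (2::nat)) l" using depth_exists[OF y'(1)] unfolding y'(2) by blast
    then have "veq (num X / den X) l" unfolding y'(2) by (intro depthD)
    then have "l = m" using vge_veq_unique[OF n] l(1) by force
    then show ?thesis using l(2) 2 by (simp add: tent_def)
  next
    case 3
    have "veq (X ^ 2 + - of_int \<beta>) m" using 3 m(1) by (intro veq_add'[OF veq_vge[OF X2 order_refl]]) auto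
    then have "veq (num X) (2 * m)" unfolding num_den by (intro veq_power) auto
    then have "veq (num X / den X) (2 * m - 2 * k)" using d by (intro veq_divide) auto
    moreover have "tent m k = 2 * m - 2 * k" using 3 by (simp add: tent_def)
    ultimately show ?thesis unfolding y'(2) using depthI[OF y'(1)] by (simp only:)
  qed
qed

lemma depth_pow: "depth P k \<Longrightarrow> depth (P [^]\<^bsub>G\<^esub> ((2::nat) ^ j)) ((tent m ^^ j) k)"
proof (induction j)
  case 0
  then have "on_curve E P" using cotorsion_on by (auto simp: depth_def)
  then show ?case using 0 by (simp add: G_simps del: on_curve.simps)
next
  case (Suc j)
  have "on_curve E P" using cotorsion_on Suc.prems by (auto simp: depth_def)
  then have "P [^]\<^bsub>G\<^esub> ((2::nat) ^ Suc j) = (P [^]\<^bsub>G\<^esub> ((2::nat) ^ j)) [^]\<^bsub>G\<^esub> (2::nat)"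
    by (simp add: grp.nat_pow_pow G_simps mult.commute del: on_curve.simps)
  then show ?case using depth_double[OF Suc.IH[OF Suc.prems]] by simp
qed

text \<open>Every odd torsion point is a \<open>2^j\<close>-fold multiple.\<close>

lemma depth_periodic:
  assumes P: "cotorsion 2 P" "P \<noteq> Point_At_Infinity"
  shows "\<exists>k\<in>{0..m}. depth P ((tent m ^^ j) k)"
proof -
  obtain R where R: "cotorsion 2 R" "R [^]\<^bsub>G\<^esub> ((2::nat) ^ j) = P" using cotorsion_root[OF P(1)] by blast
  have "R \<noteq> Point_At_Infinity" using R(2) P(2) grp.nat_pow_one by (auto simp: G_simps)
  then obtain k where "0 \<le> k" "k \<le> m" "depth R k" using depth_exists[OF R(1)] by blast
  then show ?thesis using depth_pow[of R k j] R(2) by (intro bexI[of _ k]) auto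
qed

text \<open>P and 2 P both have unit X, so 2 P = P or 2 P = - P. The first is impossible for a
  finite point, and the second says that P has order 3.\<close>

lemma depth_0_three_torsion:
  assumes \<alpha>: "4 dvd \<alpha> - 1" and P: "depth P 0"
  shows "\<exists>x. psi3 x = 0"
proof -
  obtain X y where X: "P = Affine (4 * X) y" "cotorsion 2 (Affine (4 * X) y)" "veq X 0"
    using P by (auto simp: depth_def)
  have "depth (P [^]\<^bsub>G\<^esub> (2::nat)) 0" using depth_double[OF P] m(2) by (simp add: tent_def)
  then obtain U w where U: "P [^]\<^bsub>G\<^esub> (2::nat) = Affine (4 * U) w" "cotorsion 2 (Affine (4 * U) w)" "veq U 0"
    by (auto simp: depth_def)
  have on: "on_curve E P" using X cotorsion_on by blast
  have "P [^]\<^bsub>G\<^esub> (2::nat) = P \<or> P [^]\<^bsub>G\<^esub> (2::nat) = neg P"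
    using odd_torsion_unique[OF \<alpha> even_beta _ U(2) X(2) U(3) X(3)] \<gamma> X(1) U(1) by simp
  then have "P [^]\<^bsub>G\<^esub> (2::nat) = neg P"
  proof
    assume *: "P [^]\<^bsub>G\<^esub> (2::nat) = P"
    have "P = Point_At_Infinity"
      using add_cancel[OF on on] * unfolding pow_2[OF on] by (simp add: add_neg del: ec_add.simps)
    then show ?thesis using X(1) by simp
  qed
  then have "P [^]\<^bsub>G\<^esub> (3::nat) = Point_At_Infinity" using on by (simp add: pow_2 pow_3 add_neg)
  then show ?thesis using pow_3_eq_infinity on unfolding X(1) by blast
qed

text \<open>From the product formula U U' (X1 - X2)^2 = (X1 X2 - \<beta>)^2: since k + l < m, the
  term \<beta> is negligible and the right-hand side has valuation exactly 2 (k + l). So P + R and P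
  - R cannot both lie deep.\<close>

lemma depth_sum:
  assumes P: "depth P k" and R: "depth R l" and ne: "P \<noteq> R" "P \<noteq> neg R" and kl: "k + l < m"
  obtains i j where "depth (ec_add E P R) i" "depth (ec_add E P (neg R)) j" "i + j \<le> 2 * (k + l) - 2 * min k l"
proof -
  obtain X1 y1 where X1: "P = Affine (4 * X1) y1" "cotorsion 2 (Affine (4 * X1) y1)" "veq X1 k"
    using P by (auto simp: depth_def)
  obtain X2 y2 where X2: "R = Affine (4 * X2) y2" "cotorsion 2 (Affine (4 * X2) y2)" "veq X2 l"
    using R by (auto simp: depth_def)
  have x: "X1 \<noteq> X2" using equal_x[of "4 * X1" y1 y2] ne cotorsion_on X1(1,2) X2(1,2) by metis
  obtain U w U' w' where s: "ec_add E P R = Affine (4 * U) w" "ec_add E P (neg R) = Affine (4 * U') w'"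
    "cotorsion 2 (Affine (4 * U) w)" "cotorsion 2 (Affine (4 * U') w')"
    "U * U' * (X1 - X2) ^ 2 = (X1 * X2 - of_int \<beta>) ^ 2"
    using sum_difference_scaled[OF X1(2) X2(2) x] \<gamma> unfolding X1(1) X2(1) by metis
  obtain i where i: "depth (ec_add E P R) i" using depth_exists[OF s(3)] unfolding s(1) by blast
  obtain j where j: "depth (ec_add E P (neg R)) j" using depth_exists[OF s(4)] unfolding s(2) by blast
  have U: "veq U i" "veq U' j" using i j unfolding s(1,2) by (auto simp: depth_def)
  have "veq (X1 * X2) (k + l)" using X1(3) X2(3) by (intro veq_mult) auto
  then have "veq (X1 * X2 - of_int \<beta>) (k + l)" using kl by (intro veq_diff[OF _ veq_vge[OF m(1) order_refl]]) auto
  then have "veq ((X1 * X2 - of_int \<beta>) ^ 2) (2 * (k + l))" by (intro veq_power) auto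
  then have r: "veq (U * U' * (X1 - X2) ^ 2) (2 * (k + l))" unfolding s(5) .
  have "vge (X1 - X2) (min k l)" using X1(3) X2(3) by (intro vge_diff veq_vge) auto
  then have "vge (U * U' * (X1 - X2) ^ 2) (i + j + 2 * min k l)"
    using U by (intro vge_monom[OF vge_mult]) (auto intro: veq_vge)
  then have "i + j \<le> 2 * (k + l) - 2 * min k l" using vge_veq_unique[OF _ r] by force
  then show thesis using that i j by blast
qed

end

text \<open>As 8 is a power of 2, four doublings bring every depth down to 0. A nonzero point of
  depth 0 would supply a root of \<open>psi3\<close>.\<close>

lemma no_odd_torsion_of_depth_8:
  assumes \<gamma>: "\<gamma> = 0" and m: "veq (of_int \<beta>) 8" and \<alpha>: "4 dvd \<alpha> - 1"
    and psi: "\<And>x. psi3 x \<noteq> 0" and P: "cotorsion 2 P"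
  shows "P = Point_At_Infinity"
proof (rule ccontr)
  assume nz: "P \<noteq> Point_At_Infinity"
  have m2: "(8::int) \<ge> 2" by simp
  obtain k where k: "k \<in> {0..8}" "depth P ((tent 8 ^^ 4) k)"
    using depth_periodic[OF \<gamma> m m2 P nz] by blast
  have "\<forall>k\<in>set [0..8]. (tent 8 ^^ 4) k = 0" by code_simp
  then have "depth P 0" using k by auto
  then show False using depth_0_three_torsion[OF \<gamma> m m2 \<alpha>] psi by auto
qed

text \<open>The component group has odd part of order 5, and depth 4 means the components of \<open>\<plusminus> T\<close>.\<close>

lemma odd_torsion_of_depth_10:
  assumes \<gamma>: "\<gamma> = 0" and m: "veq (of_int \<beta>) 10" and \<alpha>: "4 dvd \<alpha> - 1"
    and psi: "\<And>x. psi3 x \<noteq> 0" and T: "depth T 4" and P: "cotorsion 2 P" "P \<noteq> Point_At_Infinity"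
  shows "P = T \<or> P = neg T \<or> P [^]\<^bsub>G\<^esub> (2::nat) = T \<or> P [^]\<^bsub>G\<^esub> (2::nat) = neg T"
proof -
  have m2: "(10::int) \<ge> 2" by simp
  have pos: "\<not> depth S 0" for S using depth_0_three_torsion[OF \<gamma> m m2 \<alpha>] psi by auto
  have dep: "depth S 4 \<or> depth S 8" if S: "cotorsion 2 S" "S \<noteq> Point_At_Infinity" for S
  proof -
    obtain k where k: "k \<in> {0..10}" "depth S ((tent 10 ^^ 3) k)"
      using depth_periodic[OF \<gamma> m m2 S] by blast
    \<comment> \<open>Doubling modulo sign on the depths 0 to 10 ends within three steps in the
      fixed point 0 or in the cycle of 4 and 8.\<close>
    have "\<forall>k\<in>set [0..10]. (tent 10 ^^ 3) k \<in> {0, 4, 8}" by code_simp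
    then have "(tent 10 ^^ 3) k = 0 \<or> (tent 10 ^^ 3) k = 4 \<or> (tent 10 ^^ 3) k = 8" using k(1) by auto
    then show ?thesis using k(2) pos by auto
  qed
  have d8: "depth (S [^]\<^bsub>G\<^esub> (2::nat)) 8" if "depth S 4" for S
    using depth_double[OF \<gamma> m m2 that] by (simp add: tent_def)
  have d4: "depth (S [^]\<^bsub>G\<^esub> (2::nat)) 4" if "depth S 8" for S
    using depth_double[OF \<gamma> m m2 that] by (simp add: tent_def)
  \<comment> \<open>If S differs from T' and - T', the bound 8 of \<open>depth_sum\<close> forces A
    = S + T' and B = S - T' to have depth 4 each. But A + B = 2 S and A - B = 2 T' have depth 8, and
    16 exceeds the same bound applied to A and B.\<close>
  have same: "S = T' \<or> S = neg T'" if S: "depth S 4" and T': "depth T' 4" for S T'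
  proof (rule ccontr)
    assume ne: "\<not> (S = T' \<or> S = neg T')"
    have on: "on_curve E S" "on_curve E T'" using S T' cotorsion_on by (auto simp: depth_def)
    obtain i j where ij: "depth (ec_add E S T') i" "depth (ec_add E S (neg T')) j" "i + j \<le> 2 * (4 + 4) - 2 * min 4 4"
      using depth_sum[OF \<gamma> m m2 S T'] ne pos by auto
    have cd: "i = 4 \<or> i = 8" "j = 4 \<or> j = 8"
      using dep depth_unique ij(1,2) by (metis depth_def ec_point.distinct(1))+
    then have d: "depth (ec_add E S T') 4" "depth (ec_add E S (neg T')) 4" using ij by auto
    define A B where "A = ec_add E S T'" and "B = ec_add E S (neg T')"
    have onA: "on_curve E A" "on_curve E B" using on add_on_curve neg_on_curve by (simp_all add: A_def B_def del: ec_add.simps)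
    have sum: "ec_add E A B = S [^]\<^bsub>G\<^esub> (2::nat)" "ec_add E A (neg B) = T' [^]\<^bsub>G\<^esub> (2::nat)"
    proof -
      have "ec_add E (ec_add E A (neg T')) S = ec_add E A B"
        using add_assoc[OF onA(1) neg_on_curve[OF on(2)] on(1)] add_commute[OF on(1) neg_on_curve[OF on(2)]]
        by (simp add: B_def del: ec_add.simps)
      then show "ec_add E A B = S [^]\<^bsub>G\<^esub> (2::nat)"
        using add_cancel[OF on] pow_2[OF on(1)] by (simp add: A_def del: ec_add.simps)
      have nB: "neg B = ec_add E T' (neg S)"
        using neg_add[OF on(1) neg_on_curve[OF on(2)]] add_commute[OF on(2) neg_on_curve[OF on(1)]]
        by (simp add: B_def del: ec_add.simps)
      have "ec_add E A (neg B) = ec_add E (ec_add E A (neg S)) T'"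
        using add_assoc[OF onA(1) neg_on_curve[OF on(1)] on(2)] add_commute[OF on(2) neg_on_curve[OF on(1)]] nB
        by (simp del: ec_add.simps)
      also have "ec_add E A (neg S) = T'"
        using add_cancel[OF on(2,1)] add_commute[OF on] by (simp add: A_def del: ec_add.simps)
      finally show "ec_add E A (neg B) = T' [^]\<^bsub>G\<^esub> (2::nat)" using pow_2[OF on(2)] by simp
    qed
    have neA: "A \<noteq> B" "A \<noteq> neg B"
    proof -
      show "A \<noteq> B"
      proof
        assume "A = B"
        then have "T' [^]\<^bsub>G\<^esub> (2::nat) = Point_At_Infinity" using sum(2) by (simp add: add_neg)
        then show False using d8[OF T'] by (simp add: depth_def)
      qed
      show "A \<noteq> neg B"
      proof
        assume "A = neg B"
        then have "S [^]\<^bsub>G\<^esub> (2::nat) = Point_At_Infinity" using sum(1) by (simp add: add_neg)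
        then show False using d8[OF S] by (simp add: depth_def)
      qed
    qed
    obtain i' j' where "depth (ec_add E A B) i'" "depth (ec_add E A (neg B)) j'" "i' + j' \<le> 2 * (4 + 4) - 2 * min 4 4"
      using depth_sum[OF \<gamma> m m2 d[folded A_def B_def] neA] pos by auto
    moreover from this have "i' = 8" "j' = 8" using d8[OF S] d8[OF T'] depth_unique unfolding sum by blast+
    ultimately show False by simp
  qed
  from dep[OF P] show ?thesis
  proof
    assume "depth P 4" then show ?thesis using same[OF _ T] by blast
  next
    assume "depth P 8" then show ?thesis using same[OF d4 T] by blast
  qed
qed

end

section \<open>Criteria for the torsion to be generated by known points\<close>

context short_weierstrass
begin

text \<open>\<open>multiples P P Ss\<close> is a checkable certificate: the list holds 2 P, 3 P, ...
  up to the last nonzero multiple, so the order of P is \<open>length Ss + 2\<close>.\<close>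

fun multiples :: "'k ec_point \<Rightarrow> 'k ec_point \<Rightarrow> 'k ec_point list \<Rightarrow> bool" where
  "multiples P R [] \<longleftrightarrow> ec_add E R P = Point_At_Infinity"
| "multiples P R (S # Ss) \<longleftrightarrow> ec_add E R P = S \<and> S \<noteq> Point_At_Infinity \<and> multiples P S Ss"

lemma multiples_pow:
  assumes "on_curve E P" "multiples P (P [^]\<^bsub>G\<^esub> (k::nat)) Ss"
  shows "\<forall>i < length Ss. P [^]\<^bsub>G\<^esub> (k + i + 1) = Ss ! i \<and> Ss ! i \<noteq> Point_At_Infinity"
    and "P [^]\<^bsub>G\<^esub> (k + length Ss + 1) = Point_At_Infinity"
proof -
  have "(\<forall>i < length Ss. P [^]\<^bsub>G\<^esub> (k + i + 1) = Ss ! i \<and> Ss ! i \<noteq> Point_At_Infinity)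
    \<and> P [^]\<^bsub>G\<^esub> (k + length Ss + 1) = Point_At_Infinity"
    using assms(2)
  proof (induction Ss arbitrary: k)
    case Nil
    then show ?case by (simp add: G_simps del: ec_add.simps)
  next
    case (Cons S Ss)
    then have S: "P [^]\<^bsub>G\<^esub> (Suc k) = S" "S \<noteq> Point_At_Infinity"
      by (simp_all add: G_simps del: ec_add.simps)
    then have "multiples P (P [^]\<^bsub>G\<^esub> (Suc k)) Ss" using Cons.prems by simp
    note IH = Cons.IH[OF this]
    have "P [^]\<^bsub>G\<^esub> (k + i + 1) = (S # Ss) ! i \<and> (S # Ss) ! i \<noteq> Point_At_Infinity"
      if "i < length (S # Ss)" for i
      using IH S that by (cases i) auto
    then show ?case using IH by simp
  qed
  then show "\<forall>i < length Ss. P [^]\<^bsub>G\<^esub> (k + i + 1) = Ss ! i \<and> Ss ! i \<noteq> Point_At_Infinity"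
    "P [^]\<^bsub>G\<^esub> (k + length Ss + 1) = Point_At_Infinity" by simp_all
qed

lemma multiples_ord:
  assumes P: "on_curve E P" "P \<noteq> Point_At_Infinity" and m: "multiples P P Ss"
  shows "grp.ord P = length Ss + 2" "S \<in> set Ss \<Longrightarrow> S \<in> grp.gen2 P Point_At_Infinity"
    "P [^]\<^bsub>G\<^esub> (length Ss + 2) = Point_At_Infinity"
    "i < length Ss \<Longrightarrow> P [^]\<^bsub>G\<^esub> (i + 2) = Ss ! i"
proof -
  have Pc: "P \<in> carrier G" using P(1) by (simp only: G_simps)
  have P1: "P [^]\<^bsub>G\<^esub> (1::nat) = P" using Pc by simp
  have t: "P [^]\<^bsub>G\<^esub> (1 + i + 1) = Ss ! i" "Ss ! i \<noteq> Point_At_Infinity" if "i < length Ss" for i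
    using multiples_pow(1)[OF P(1), of 1 Ss] m P1 that by simp_all
  then show 4: "P [^]\<^bsub>G\<^esub> (i + 2) = Ss ! i" if "i < length Ss" for i using that by fastforce
  have "P [^]\<^bsub>G\<^esub> (1 + length Ss + 1) = Point_At_Infinity"
    using multiples_pow(2)[OF P(1), of 1 Ss] m P1 by simp
  then show n: "P [^]\<^bsub>G\<^esub> (length Ss + 2) = Point_At_Infinity" by (simp only: one_add_one add.commute add.left_commute) (simp add: add.commute)
  have ne: "P [^]\<^bsub>G\<^esub> i \<noteq> Point_At_Infinity" if "0 < i" "i < length Ss + 2" for i
  proof (cases "i = 1")
    case True then show ?thesis using P1 P(2) by simp
  next
    case False
    define j where "j = i - 2"
    have "i = j + 2" "j < length Ss" using that False by (simp_all add: j_def)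
    then show ?thesis using 4 t(2) by simp
  qed
  have d: "grp.ord P dvd length Ss + 2" using n grp.pow_eq_id[OF Pc, of "length Ss + 2"] by (simp add: G_simps)
  have le: "grp.ord P \<le> length Ss + 2" "grp.ord P > 0"
    using dvd_imp_le[OF d] dvd_pos_nat[OF _ d] by simp_all
  moreover have "P [^]\<^bsub>G\<^esub> grp.ord P = Point_At_Infinity" using grp.pow_ord_eq_1[OF Pc] by (simp add: G_simps)
  ultimately show "grp.ord P = length Ss + 2" using ne by (metis le_neq_implies_less)
  show "S \<in> grp.gen2 P Point_At_Infinity" if S: "S \<in> set Ss"
  proof -
    obtain i where "i < length Ss" "S = Ss ! i" using S by (metis in_set_conv_nth)
    then have "S = P [^]\<^bsub>G\<^esub> int (i + 2)" using 4 by (simp only: int_pow_int)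
    then show ?thesis using grp.gen2_one[OF Pc] by (auto simp: G_simps)
  qed
qed

lemma multiples_infinity:
  "on_curve E P \<Longrightarrow> P \<noteq> Point_At_Infinity \<Longrightarrow> multiples P P Ss \<Longrightarrow> n = length Ss + 2 \<Longrightarrow>
    P [^]\<^bsub>G\<^esub> (n::nat) = Point_At_Infinity"
  using multiples_ord(3) by blast

lemma multiples_nth:
  "on_curve E P \<Longrightarrow> P \<noteq> Point_At_Infinity \<Longrightarrow> multiples P P Ss \<Longrightarrow> i < length Ss \<Longrightarrow> n = i + 2 \<Longrightarrow>
    P [^]\<^bsub>G\<^esub> (n::nat) = Ss ! i"
  using multiples_ord(4) by blast

lemma gen2_subgroup:
  "on_curve E P \<Longrightarrow> on_curve E T \<Longrightarrow> subgroup (grp.gen2 P T) G"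
  by (rule grp.gen2_subgroup) (simp_all only: G_simps)

lemma gen2_mem:
  assumes "on_curve E P" "on_curve E T"
  shows "P \<in> grp.gen2 P T" "T \<in> grp.gen2 P T" "Point_At_Infinity \<in> grp.gen2 P T"
  using grp.gen2_mem[of P T] assms by (simp_all add: G_simps del: on_curve.simps)

lemma gen2_neg: "on_curve E P \<Longrightarrow> on_curve E T \<Longrightarrow> R \<in> grp.gen2 P T \<Longrightarrow> neg R \<in> grp.gen2 P T"
  using subgroup.m_inv_closed[OF gen2_subgroup[of P T], of R] subgroup.mem_carrier[OF gen2_subgroup[of P T], of R]
  by (simp add: inv_G G_simps del: on_curve.simps)

text \<open>The two alternatives in \<open>nq\<close> serve orders divisible by q, where the
  generator must not be divisible by q, and orders prime to q, where there must be no q-torsion at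
  all.\<close>

lemma cyclic_torsion:
  assumes P: "on_curve E P" and n: "grp.ord P = n" "n > 0"
    and q: "prime q"
    and co: "\<And>R. cotorsion q R \<Longrightarrow> R \<in> grp.gen2 P Point_At_Infinity"
    and qt: "\<And>R. on_curve E R \<Longrightarrow> R [^]\<^bsub>G\<^esub> q = Point_At_Infinity \<Longrightarrow> R \<in> grp.gen2 P Point_At_Infinity"
    and nq: "(\<forall>R. on_curve E R \<longrightarrow> R [^]\<^bsub>G\<^esub> q \<noteq> P) \<or> (\<forall>R. on_curve E R \<longrightarrow> R [^]\<^bsub>G\<^esub> q = Point_At_Infinity \<longrightarrow> R = Point_At_Infinity)"
  shows "torsion_subgroup G \<cong> integer_mod_group n"
proof (rule grp.cyclic_torsion_iso)
  show Pc: "P \<in> carrier G" using P(1) by (simp only: G_simps)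
  show "grp.ord P = n" "n > 0" by (rule n)+
  let ?H = "grp.gen2 P \<one>\<^bsub>G\<^esub>"
  have H: "subgroup ?H G" by (rule grp.gen2_subgroup) (use Pc in simp_all)
  fix y assume "grp.is_torsion y"
  then obtain k :: nat where y: "y \<in> carrier G" "k > 0" "y [^]\<^bsub>G\<^esub> k = \<one>\<^bsub>G\<^esub>" by (auto simp: grp.is_torsion_def)
  show "y \<in> ?H"
  proof (rule grp.torsion_in[OF H q _ _ y(1,3,2)])
    show "x \<in> ?H" if "grp.coprime_torsion q x" for x
      using co that by (simp add: cotorsion_def G_simps)
    show "x \<in> ?H" if x: "x \<in> carrier G" "x [^]\<^bsub>G\<^esub> (q ^ k) = \<one>\<^bsub>G\<^esub>" for x k
    proof (rule disjE[OF nq])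
      assume nq: "\<forall>R. on_curve E R \<longrightarrow> R [^]\<^bsub>G\<^esub> q \<noteq> P"
      show ?thesis
      proof (rule grp.q_power_torsion_in[OF H _ _ x])
        show "z \<in> ?H" if "z \<in> carrier G" "z [^]\<^bsub>G\<^esub> q = \<one>\<^bsub>G\<^esub>" for z
          using qt that by (simp add: G_simps del: on_curve.simps)
        show "\<exists>h\<in>?H. h [^]\<^bsub>G\<^esub> q = z [^]\<^bsub>G\<^esub> q" if "z \<in> carrier G" "z [^]\<^bsub>G\<^esub> q \<in> ?H" for z
          using grp.cyclic_divisible[OF Pc q _ that] nq by (simp only: G_simps) blast
      qed
    next
      assume *: "\<forall>R. on_curve E R \<longrightarrow> R [^]\<^bsub>G\<^esub> q = Point_At_Infinity \<longrightarrow> R = Point_At_Infinity"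
      have "x \<in> {\<one>\<^bsub>G\<^esub>}"
      proof (rule grp.q_power_torsion_in[OF _ _ _ x])
        show "subgroup {\<one>\<^bsub>G\<^esub>} G" by (rule grp.triv_subgroup)
        show "z \<in> {\<one>\<^bsub>G\<^esub>}" if "z \<in> carrier G" "z [^]\<^bsub>G\<^esub> q = \<one>\<^bsub>G\<^esub>" for z
          using * that by (simp add: G_simps del: on_curve.simps)
        show "\<exists>h\<in>{\<one>\<^bsub>G\<^esub>}. h [^]\<^bsub>G\<^esub> q = z [^]\<^bsub>G\<^esub> q" if "z [^]\<^bsub>G\<^esub> q \<in> {\<one>\<^bsub>G\<^esub>}" for z
          using that by simp
      qed
      then show ?thesis using H subgroup.one_closed by fastforce
    qed
  qed
qed

text \<open>The cubic is (x - e) (x^2 + p x + r). The nonsquare discriminant leaves (e, 0) as the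
  only point of order 2, and the nonsquare x - e shows that P is not a double.\<close>

lemma cyclic_torsion_2:
  assumes P: "P = Affine x y" "y ^ 2 = F x" and m: "multiples P P Ss"
    and co: "\<And>R. cotorsion 2 R \<Longrightarrow> R \<in> grp.gen2 P Point_At_Infinity"
    and fac: "a = p - e" "b = r - e * p" "c = - e * r"
    and disc: "\<nexists>u. u ^ 2 = p ^ 2 - 4 * r"
    and e: "Affine e 0 \<in> set Ss" and nsq: "\<nexists>u. u ^ 2 = x - e"
    and n: "n = length Ss + 2"
  shows "torsion_subgroup G \<cong> integer_mod_group n"
proof (rule cyclic_torsion[OF _ _ _ _ co])
  have on: "on_curve E P" "P \<noteq> Point_At_Infinity" using P by simp_all
  show "on_curve E P" by (rule on)
  show "grp.ord P = n" "n > 0" using multiples_ord(1)[OF on m] n by simp_all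
  show "prime (2::nat)" by simp
  have Fe: "F z = (z - e) * (z ^ 2 + p * z + r)" for z
    unfolding fac by (simp add: algebra_simps power2_eq_square power3_eq_cube)
  show "R \<in> grp.gen2 P Point_At_Infinity" if R: "on_curve E R" "R [^]\<^bsub>G\<^esub> (2::nat) = Point_At_Infinity" for R
    using pow_2_eq_infinity[OF R]
  proof
    assume "R = Point_At_Infinity" then show ?thesis using gen2_mem[OF on(1), of Point_At_Infinity] by simp
  next
    assume "\<exists>z. R = Affine z 0 \<and> F z = 0"
    then obtain z where z: "R = Affine z 0" "F z = 0" by blast
    have "z ^ 2 + p * z + r \<noteq> 0"
    proof
      assume "z ^ 2 + p * z + r = 0"
      moreover have "(2 * z + p) ^ 2 = 4 * (z ^ 2 + p * z + r) + (p ^ 2 - 4 * r)"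
        by (simp add: algebra_simps power2_eq_square)
      ultimately have "(2 * z + p) ^ 2 = p ^ 2 - 4 * r" by simp
      then show False using disc by blast
    qed
    then have "z = e" using z(2) unfolding Fe by simp
    then show ?thesis using multiples_ord(2)[OF on m e] z(1) by simp
  qed
  have "F e = 0" by (simp only: Fe) simp
  then have "R [^]\<^bsub>G\<^esub> (2::nat) \<noteq> P" if "on_curve E R" for R
    using double_minus_root[of e R x y] that nsq P(1) by blast
  then show "(\<forall>R. on_curve E R \<longrightarrow> R [^]\<^bsub>G\<^esub> (2::nat) \<noteq> P) \<or>
    (\<forall>R. on_curve E R \<longrightarrow> R [^]\<^bsub>G\<^esub> (2::nat) = Point_At_Infinity \<longrightarrow> R = Point_At_Infinity)" by blast
qed

text \<open>None of P, T and P + T may be a double. For each the obstruction can come from any of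
  the three roots, which leaves an alternative over fields where one of the differences becomes a
  square.\<close>

lemma bicyclic_torsion_2:
  assumes P: "P = Affine x y" "y ^ 2 = F x" and m: "multiples P P Ss"
    and n: "length Ss + 2 = 2 * n"
    and T: "T = Affine e1 0" and abc: "a = - (e1 + e2 + e3)" "b = e1 * e2 + e1 * e3 + e2 * e3" "c = - (e1 * e2 * e3)"
    and e12: "P [^]\<^bsub>G\<^esub> n = Affine e2 0" "e1 \<noteq> e2" and PT: "ec_add E P T = Affine x' y'"
    and co: "\<And>R. cotorsion 2 R \<Longrightarrow> R \<in> grp.gen2 P T"
    and nP: "\<exists>e\<in>{e1, e2, e3}. \<nexists>u. u ^ 2 = x - e"
    and nT: "\<exists>e\<in>{e1, e2, e3}. \<nexists>u. u ^ 2 = e1 - e"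
    and nPT: "\<exists>e\<in>{e1, e2, e3}. \<nexists>u. u ^ 2 = x' - e"
  shows "torsion_subgroup G \<cong> integer_mod_group 2 \<times>\<times> integer_mod_group (2 * n)"
proof (rule grp.bicyclic_torsion_iso)
  have on: "on_curve E P" "P \<noteq> Point_At_Infinity" using P by simp_all
  have fac: "F z = (z - e1) * (z - e2) * (z - e3)" for z
    unfolding abc by (simp add: algebra_simps power2_eq_square power3_eq_cube)
  have onT: "on_curve E T" using fac[of e1] by (simp add: T)
  show Pc: "P \<in> carrier G" and Tc: "T \<in> carrier G" using on(1) onT by (simp_all only: G_simps)
  show "grp.ord P = 2 * n" using multiples_ord(1)[OF on m] n by simp
  show "n > 0" using n by simp
  show "T [^]\<^bsub>G\<^esub> (2::nat) = \<one>\<^bsub>G\<^esub>" using pow_2[OF onT] by (simp add: T G_simps)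
  show "T \<noteq> \<one>\<^bsub>G\<^esub>" by (simp add: T G_simps)
  show "T \<noteq> P [^]\<^bsub>G\<^esub> n" using e12 by (simp add: T)
  have root: "F e = 0" if "e \<in> {e1, e2, e3}" for e 
  proof -
    have "(e - e1) * (e - e2) * (e - e3) = 0" using that by auto
    then show ?thesis unfolding fac .
  qed
  have nd: "R [^]\<^bsub>G\<^esub> (2::nat) \<noteq> Affine z w" if "on_curve E R" "\<exists>e\<in>{e1, e2, e3}. \<nexists>u. u ^ 2 = z - e" for R z w
    using double_minus_root[OF root that(1), of _ z w] that(2) by blast
  have H: "subgroup (grp.gen2 P T) G" by (rule gen2_subgroup[OF on(1) onT])
  have mem: "P [^]\<^bsub>G\<^esub> n \<in> grp.gen2 P T" "T \<in> grp.gen2 P T" "Point_At_Infinity \<in> grp.gen2 P T"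
    using grp.gen2I[of P "int n" T 0] Tc gen2_mem[OF on(1) onT] Pc by (simp_all add: int_pow_int)
  have two: "R \<in> grp.gen2 P T" if R: "on_curve E R" "R [^]\<^bsub>G\<^esub> (2::nat) = Point_At_Infinity" for R
    using pow_2_eq_infinity[OF R]
  proof
    assume "R = Point_At_Infinity" then show ?thesis using mem by simp
  next
    assume "\<exists>z. R = Affine z 0 \<and> F z = 0"
    then obtain z where z: "R = Affine z 0" "F z = 0" by blast
    then consider "z = e1" | "z = e2" | "z = e3" unfolding fac by auto
    then show ?thesis
    proof cases
      case 1 then show ?thesis using mem(2) z by (simp add: T)
    next
      case 2 then show ?thesis using mem(1) z by (simp add: e12)
    next
      case 3
      have "ec_add E (P [^]\<^bsub>G\<^esub> n) T = Affine e3 0"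
        unfolding e12(1) T using abc(1) e12(2) by (simp add: Let_def)
      then have "Affine e3 0 = (P [^]\<^bsub>G\<^esub> n) \<otimes>\<^bsub>G\<^esub> T" by (simp only: G_simps)
      then have "Affine e3 0 \<in> grp.gen2 P T" using subgroup.m_closed[OF H mem(1,2)] by (simp only:)
      then show ?thesis using z 3 by simp
    qed
  qed
  fix R assume "grp.is_torsion R"
  then obtain k :: nat where R: "R \<in> carrier G" "k > 0" "R [^]\<^bsub>G\<^esub> k = \<one>\<^bsub>G\<^esub>" by (auto simp: grp.is_torsion_def)
  show "R \<in> grp.gen2 P T"
  proof (rule grp.torsion_in[OF H two_is_prime_nat _ _ R(1,3,2)])
    show "z \<in> grp.gen2 P T" if "grp.coprime_torsion 2 z" for z using co that by (simp only: cotorsion_def)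
    show "z \<in> grp.gen2 P T" if z: "z \<in> carrier G" "z [^]\<^bsub>G\<^esub> ((2::nat) ^ k) = \<one>\<^bsub>G\<^esub>" for z k
    proof (rule grp.q_power_torsion_in[OF H _ _ z])
      show "w \<in> grp.gen2 P T" if "w \<in> carrier G" "w [^]\<^bsub>G\<^esub> (2::nat) = \<one>\<^bsub>G\<^esub>" for w
        using two that by (simp only: G_simps)
      show "\<exists>h\<in>grp.gen2 P T. h [^]\<^bsub>G\<^esub> (2::nat) = w [^]\<^bsub>G\<^esub> (2::nat)"
        if "w \<in> carrier G" "w [^]\<^bsub>G\<^esub> (2::nat) \<in> grp.gen2 P T" for w
      proof (rule grp.gen2_halvable[OF Pc Tc _ _ _ that])
        show "z [^]\<^bsub>G\<^esub> (2::nat) \<noteq> P" if "z \<in> carrier G" for z using nd nP that unfolding P(1) G_simps by blast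
        show "z [^]\<^bsub>G\<^esub> (2::nat) \<noteq> T" if "z \<in> carrier G" for z using nd nT that unfolding T G_simps by blast
        show "z [^]\<^bsub>G\<^esub> (2::nat) \<noteq> P \<otimes>\<^bsub>G\<^esub> T" if "z \<in> carrier G" for z using nd nPT that unfolding G_simps PT by blast
      qed
    qed
  qed
qed

text \<open>Substitute for \<open>double_minus_root\<close> at the point (0, 0) itself, where x - e
  = 0 is a square and gives no obstruction.\<close>

lemma double_eq_origin:
  assumes c: "c = 0" and R: "on_curve E R" and d: "R [^]\<^bsub>G\<^esub> (2::nat) = Affine 0 w"
  shows "\<exists>x. x ^ 2 = b"
proof (cases R)
  case Point_At_Infinity
  then show ?thesis using d by (simp add: pow_2)
next
  case (Affine x y)
  have y: "y \<noteq> 0" using d R Affine by (auto simp: pow_2)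
  have F: "y ^ 2 = F x" using R Affine by simp
  obtain y' where "Affine 0 w = Affine (((x ^ 2 - b) ^ 2 - 4 * c * (2 * x + a)) / (4 * F x)) y'"
    using double[OF F y] d pow_2[OF R] Affine by metis
  then have "((x ^ 2 - b) ^ 2 - 4 * c * (2 * x + a)) / (4 * F x) = 0" by simp
  moreover have "4 * F x \<noteq> 0" using F y by (metis mult_eq_0_iff power_eq_0_iff zero_neq_numeral)
  ultimately have "(x ^ 2 - b) ^ 2 - 4 * c * (2 * x + a) = 0" using divide_eq_0_iff by blast
  then show ?thesis using c by (intro exI[of _ x]) simp
qed

end

section \<open>Groups of even order\<close>

text \<open>From order 4 on, the curves are specialisations of the universal curves with a point of the given order,
  with parameters for which the reduction at 2 is good or multiplicative.\<close>

lemma (in short_weierstrass) appears_of_iso: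
  "torsion_subgroup G \<cong> H \<Longrightarrow> appears_as_torsion_group TYPE('k) H"
  unfolding appears_as_torsion_group_def elliptic_curve_def using disc by blast

lemma nonsquare_pair:
  fixes r s :: int
  assumes "quadratic_field TYPE('k::field_char_0)"
    and "\<nexists>m::int. m ^ 2 = r" "\<nexists>m::int. m ^ 2 = s" "\<nexists>m::int. m ^ 2 = r * s"
  shows "(\<nexists>u::'k. u ^ 2 = of_int r) \<or> (\<nexists>u::'k. u ^ 2 = of_int s)"
  using not_both_squares[OF assms(1) _ _ assms(2-4)] by blast

text \<open>If both alternatives failed, one of r, s and one of r', s' would be squares in K
  together, which \<open>nonsquare_pair\<close> excludes for each of the four combinations.\<close>

lemma nonsquare_choice:
  fixes r s r' s' :: int
  assumes K: "quadratic_field TYPE('k::field_char_0)"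
    and "\<nexists>m::int. m ^ 2 = r" "\<nexists>m::int. m ^ 2 = s" "\<nexists>m::int. m ^ 2 = r'" "\<nexists>m::int. m ^ 2 = s'"
    and "\<nexists>m::int. m ^ 2 = r * r'" "\<nexists>m::int. m ^ 2 = r * s'" "\<nexists>m::int. m ^ 2 = s * r'" "\<nexists>m::int. m ^ 2 = s * s'"
  shows "(\<nexists>u::'k. u ^ 2 = of_int r) \<and> (\<nexists>u::'k. u ^ 2 = of_int s) \<or>
    (\<nexists>u::'k. u ^ 2 = of_int r') \<and> (\<nexists>u::'k. u ^ 2 = of_int s')"
  using nonsquare_pair[OF K assms(2,4,6)] nonsquare_pair[OF K assms(2,5,7)]
    nonsquare_pair[OF K assms(3,4,8)] nonsquare_pair[OF K assms(3,5,9)] by blast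

text \<open>The curve is y^2 = x (x^2 - 11 x + 32): 8 is the abscissa of P, measured from the root
  0, and -7 is the discriminant of the quadratic factor. The point \<open>T\<close> of order 3 is 2
  P.\<close>

lemma appears_6_of_nonsquares:
  assumes K: "quadratic_field TYPE('k::field_char_0)"
    and nsq: "\<nexists>u::'k. u ^ 2 = of_int 8" "\<nexists>u::'k. u ^ 2 = of_int (- 7)"
  shows "appears_as_torsion_group TYPE('k) (integer_mod_group 6)"
proof -
  obtain v :: "'k \<Rightarrow> int" where "quadratic_valuation 2 v"
    using exists_quadratic_valuation[OF K, of 2] by auto
  then interpret two_adic_curve v "(- 11) :: 'k" "32" "0" "-11" "2" "0"
    by (intro two_adic_curve.intro two_adic_curve_axioms.intro short_weierstrass.intro) (simp_all add: Let_def)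
  define P where "P = Affine 8 ((- 8) :: 'k)"
  have on: "on_curve E P" by (simp add: P_def)
  have m: "multiples P P [Affine 4 (- 4), Affine 0 0, Affine 4 4, Affine 8 8]"
    by (simp add: P_def Let_def)
  have P0: "P \<noteq> Point_At_Infinity" by (simp add: P_def)
  note mem = multiples_ord(2)[OF on P0 m] gen2_mem[OF on, of Point_At_Infinity]
  have co: "R \<in> grp.gen2 P Point_At_Infinity" if R: "cotorsion 2 R" for R
  proof -
    define T where "T = Affine 4 ((- 4) :: 'k)"
    have T: "T \<in> grp.gen2 P Point_At_Infinity" "T \<noteq> Point_At_Infinity" "on_curve E T"
      using mem(1)[of T] by (simp_all add: T_def)
    have "T [^]\<^bsub>G\<^esub> (3::nat) = Point_At_Infinity" unfolding pow_3[OF T(3)] by (simp add: T_def Let_def)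
    then have "cotorsion 2 T" using cotorsionI[OF T(3)] by simp
    then have "R = Point_At_Infinity \<or> R = T \<or> R = neg T"
      using odd_torsion_three_elements[of "1" T R] R T(2) by simp
    then show ?thesis using T mem gen2_neg[OF on _ T(1)] by auto
  qed
  have "torsion_subgroup G \<cong> integer_mod_group 6"
    using nsq by (intro cyclic_torsion_2[OF P_def _ m co, where e = "0" and p = "(- 11)" and r = "32"]) simp_all
  then show ?thesis by (rule appears_of_iso)
qed

lemma appears_6_of_nonsquares':
  assumes K: "quadratic_field TYPE('k::field_char_0)"
    and nsq: "\<nexists>u::'k. u ^ 2 = of_int 24" "\<nexists>u::'k. u ^ 2 = of_int (- 375)"
  shows "appears_as_torsion_group TYPE('k) (integer_mod_group 6)"
proof -
  obtain v :: "'k \<Rightarrow> int" where "quadratic_valuation 2 v"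
    using exists_quadratic_valuation[OF K, of 2] by auto
  then interpret two_adic_curve v "(- 3) :: 'k" "96" "0" "-3" "6" "0"
    by (intro two_adic_curve.intro two_adic_curve_axioms.intro short_weierstrass.intro) (simp_all add: Let_def)
  define P where "P = Affine 24 ((- 120) :: 'k)"
  have on: "on_curve E P" by (simp add: P_def)
  have m: "multiples P P [Affine 4 (- 20), Affine 0 0, Affine 4 20, Affine 24 120]"
    by (simp add: P_def Let_def)
  have P0: "P \<noteq> Point_At_Infinity" by (simp add: P_def)
  note mem = multiples_ord(2)[OF on P0 m] gen2_mem[OF on, of Point_At_Infinity]
  have co: "R \<in> grp.gen2 P Point_At_Infinity" if R: "cotorsion 2 R" for R
  proof -
    define T where "T = Affine 4 ((- 20) :: 'k)"
    have T: "T \<in> grp.gen2 P Point_At_Infinity" "T \<noteq> Point_At_Infinity" "on_curve E T"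
      using mem(1)[of T] by (simp_all add: T_def)
    have "T [^]\<^bsub>G\<^esub> (3::nat) = Point_At_Infinity" unfolding pow_3[OF T(3)] by (simp add: T_def Let_def)
    then have "cotorsion 2 T" using cotorsionI[OF T(3)] by simp
    then have "R = Point_At_Infinity \<or> R = T \<or> R = neg T"
      using odd_torsion_three_elements[of "9" T R] R T(2) by simp
    then show ?thesis using T mem gen2_neg[OF on _ T(1)] by auto
  qed
  have "torsion_subgroup G \<cong> integer_mod_group 6"
    using nsq by (intro cyclic_torsion_2[OF P_def _ m co, where e = "0" and p = "(- 3)" and r = "96"]) simp_all
  then show ?thesis by (rule appears_of_iso)
qed

lemma appears_6:
  assumes K: "quadratic_field TYPE('k::field_char_0)"
  shows "appears_as_torsion_group TYPE('k) (integer_mod_group 6)"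
proof -
  have "(\<nexists>u::'k. u ^ 2 = of_int 8) \<and> (\<nexists>u::'k. u ^ 2 = of_int (- 7)) \<or>
      (\<nexists>u::'k. u ^ 2 = of_int 24) \<and> (\<nexists>u::'k. u ^ 2 = of_int (- 375))"
    by (rule nonsquare_choice[OF K])
      (use not_int_square[of 8 2] not_int_square[of "-7" 0] not_int_square[of 24 4] not_int_square[of "-375" 0] not_int_square[of 192 13] not_int_square[of "-3000" 0] not_int_square[of "-168" 0] not_int_square[of 2625 51] in simp_all)
  then show ?thesis using appears_6_of_nonsquares[OF K] appears_6_of_nonsquares'[OF K] by blast
qed

text \<open>On y^2 = x (x^2 + x - 16) the number -16 is the coefficient that would have to be a
  square for (0, 0) to be a double, and 65 is the discriminant of the quadratic factor.\<close>

lemma appears_2_of_nonsquares: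
  assumes K: "quadratic_field TYPE('k::field_char_0)"
    and nsq: "\<nexists>u::'k. u ^ 2 = of_int (- 16)" "\<nexists>u::'k. u ^ 2 = of_int 65"
  shows "appears_as_torsion_group TYPE('k) (integer_mod_group 2)"
proof -
  obtain v :: "'k \<Rightarrow> int" where "quadratic_valuation 2 v"
    using exists_quadratic_valuation[OF K, of 2] by auto
  then interpret two_adic_curve v "1 :: 'k" "(- 16)" "0" "1" "-1" "0"
    by (intro two_adic_curve.intro two_adic_curve_axioms.intro short_weierstrass.intro) (simp_all add: Let_def)
  define P where "P = Affine 0 (0 :: 'k)"
  have on: "on_curve E P" by (simp add: P_def)
  have P0: "P \<noteq> Point_At_Infinity" by (simp add: P_def)
  have m: "multiples P P []" by (simp add: P_def)
  note mem = gen2_mem[OF on, of Point_At_Infinity]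
  have "torsion_subgroup G \<cong> integer_mod_group 2"
  proof (rule cyclic_torsion[OF on _ _ two_is_prime_nat])
    show "grp.ord P = 2" "(0::nat) < 2" using multiples_ord(1)[OF on P0 m] by simp_all
    show "R \<in> grp.gen2 P Point_At_Infinity" if "cotorsion 2 R" for R
      using no_odd_torsion_of_good_reduction[OF _ that] mem by simp
    show "R \<in> grp.gen2 P Point_At_Infinity"
      if R: "on_curve E R" "R [^]\<^bsub>G\<^esub> (2::nat) = Point_At_Infinity" for R
      using pow_2_eq_infinity[OF R]
    proof
      assume "\<exists>x. R = Affine x 0 \<and> F x = 0"
      then obtain x where x: "R = Affine x 0" "F x = 0" by blast
      have "x * (x ^ 2 + 1 * x + (- 16)) = 0" using x(2) by (simp add: algebra_simps power2_eq_square power3_eq_cube)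
      moreover have "x ^ 2 + 1 * x + (- 16) \<noteq> 0"
      proof
        assume "x ^ 2 + 1 * x + (- 16) = 0"
        moreover have "(2 * x + 1) ^ 2 = 4 * (x ^ 2 + 1 * x + (- 16)) + of_int 65"
          by (simp add: algebra_simps power2_eq_square)
        ultimately show False using nsq(2) by simp
      qed
      ultimately show ?thesis using x(1) mem by (simp add: P_def)
    qed (use mem in simp)
    have "R [^]\<^bsub>G\<^esub> (2::nat) \<noteq> P" if R: "on_curve E R" for R
    proof
      assume *: "R [^]\<^bsub>G\<^esub> (2::nat) = P"
      then show False using double_eq_origin[OF _ R, of 0] nsq(1) by (auto simp: P_def)
    qed
    then show "(\<forall>R. on_curve E R \<longrightarrow> R [^]\<^bsub>G\<^esub> (2::nat) \<noteq> P) \<or>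
      (\<forall>R. on_curve E R \<longrightarrow> R [^]\<^bsub>G\<^esub> (2::nat) = Point_At_Infinity \<longrightarrow> R = Point_At_Infinity)" by blast
  qed
  then show ?thesis by (rule appears_of_iso)
qed

lemma appears_2_of_nonsquares':
  assumes K: "quadratic_field TYPE('k::field_char_0)"
    and nsq: "\<nexists>u::'k. u ^ 2 = of_int 48" "\<nexists>u::'k. u ^ 2 = of_int (- 191)"
  shows "appears_as_torsion_group TYPE('k) (integer_mod_group 2)"
proof -
  obtain v :: "'k \<Rightarrow> int" where "quadratic_valuation 2 v"
    using exists_quadratic_valuation[OF K, of 2] by auto
  then interpret two_adic_curve v "1 :: 'k" "48" "0" "1" "3" "0"
    by (intro two_adic_curve.intro two_adic_curve_axioms.intro short_weierstrass.intro) (simp_all add: Let_def)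
  define P where "P = Affine 0 (0 :: 'k)"
  have on: "on_curve E P" by (simp add: P_def)
  have P0: "P \<noteq> Point_At_Infinity" by (simp add: P_def)
  have m: "multiples P P []" by (simp add: P_def)
  note mem = gen2_mem[OF on, of Point_At_Infinity]
  have "torsion_subgroup G \<cong> integer_mod_group 2"
  proof (rule cyclic_torsion[OF on _ _ two_is_prime_nat])
    show "grp.ord P = 2" "(0::nat) < 2" using multiples_ord(1)[OF on P0 m] by simp_all
    show "R \<in> grp.gen2 P Point_At_Infinity" if "cotorsion 2 R" for R
      using no_odd_torsion_of_good_reduction[OF _ that] mem by simp
    show "R \<in> grp.gen2 P Point_At_Infinity"
      if R: "on_curve E R" "R [^]\<^bsub>G\<^esub> (2::nat) = Point_At_Infinity" for R
      using pow_2_eq_infinity[OF R]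
    proof
      assume "\<exists>x. R = Affine x 0 \<and> F x = 0"
      then obtain x where x: "R = Affine x 0" "F x = 0" by blast
      have "x * (x ^ 2 + 1 * x + 48) = 0" using x(2) by (simp add: algebra_simps power2_eq_square power3_eq_cube)
      moreover have "x ^ 2 + 1 * x + 48 \<noteq> 0"
      proof
        assume "x ^ 2 + 1 * x + 48 = 0"
        moreover have "(2 * x + 1) ^ 2 = 4 * (x ^ 2 + 1 * x + 48) + of_int (- 191)"
          by (simp add: algebra_simps power2_eq_square)
        ultimately show False using nsq(2) by simp
      qed
      ultimately show ?thesis using x(1) mem by (simp add: P_def)
    qed (use mem in simp)
    have "R [^]\<^bsub>G\<^esub> (2::nat) \<noteq> P" if R: "on_curve E R" for R
    proof
      assume *: "R [^]\<^bsub>G\<^esub> (2::nat) = P"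
      then show False using double_eq_origin[OF _ R, of 0] nsq(1) by (auto simp: P_def)
    qed
    then show "(\<forall>R. on_curve E R \<longrightarrow> R [^]\<^bsub>G\<^esub> (2::nat) \<noteq> P) \<or>
      (\<forall>R. on_curve E R \<longrightarrow> R [^]\<^bsub>G\<^esub> (2::nat) = Point_At_Infinity \<longrightarrow> R = Point_At_Infinity)" by blast
  qed
  then show ?thesis by (rule appears_of_iso)
qed

lemma appears_2:
  assumes K: "quadratic_field TYPE('k::field_char_0)"
  shows "appears_as_torsion_group TYPE('k) (integer_mod_group 2)"
proof -
  have "(\<nexists>u::'k. u ^ 2 = of_int (- 16)) \<and> (\<nexists>u::'k. u ^ 2 = of_int 65) \<or>
      (\<nexists>u::'k. u ^ 2 = of_int 48) \<and> (\<nexists>u::'k. u ^ 2 = of_int (- 191))"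
    by (rule nonsquare_choice[OF K])
      (use not_int_square[of "-16" 0] not_int_square[of 65 8] not_int_square[of 48 6] not_int_square[of "-191" 0] not_int_square[of "-768" 0] not_int_square[of 3056 55] not_int_square[of 3120 55] not_int_square[of "-12415" 0] in simp_all)
  then show ?thesis using appears_2_of_nonsquares[OF K] appears_2_of_nonsquares'[OF K] by blast
qed

text \<open>The curve is y^2 = (x + 61) (x^2 + 32000), with 21 = -40 + 61 and -128000 = -4 * 32000.
  The point \<open>T\<close> of order 3 is 4 P.\<close>

lemma appears_12_of_nonsquares:
  assumes K: "quadratic_field TYPE('k::field_char_0)"
    and nsq: "\<nexists>u::'k. u ^ 2 = of_int 21" "\<nexists>u::'k. u ^ 2 = of_int (- 128000)"
  shows "appears_as_torsion_group TYPE('k) (integer_mod_group 12)"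
proof -
  obtain v :: "'k \<Rightarrow> int" where "quadratic_valuation 2 v"
    using exists_quadratic_valuation[OF K, of 2] by auto
  then interpret two_adic_curve v "61 :: 'k" "32000" "1952000" "61" "2000" "30500"
    by (intro two_adic_curve.intro two_adic_curve_axioms.intro short_weierstrass.intro) (simp_all add: Let_def)
  define P where "P = Affine (- 40) ((- 840) :: 'k)"
  have on: "on_curve E P" by (simp add: P_def)
  have m: "multiples P P [Affine 380 8820, Affine 128 (- 3024), Affine 20 1620, Affine 1640 (- 68040), Affine (- 61) 0, Affine 1640 68040, Affine 20 (- 1620), Affine 128 3024, Affine 380 (- 8820), Affine (- 40) 840]"
    by (simp add: P_def Let_def)
  have P0: "P \<noteq> Point_At_Infinity" by (simp add: P_def)
  note mem = multiples_ord(2)[OF on P0 m] gen2_mem[OF on, of Point_At_Infinity]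
  have co: "R \<in> grp.gen2 P Point_At_Infinity" if R: "cotorsion 2 R" for R
  proof -
    define T where "T = Affine 20 (1620 :: 'k)"
    have T: "T \<in> grp.gen2 P Point_At_Infinity" "T \<noteq> Point_At_Infinity" "on_curve E T"
      using mem(1)[of T] by (simp_all add: T_def)
    have "T [^]\<^bsub>G\<^esub> (3::nat) = Point_At_Infinity" unfolding pow_3[OF T(3)] by (simp add: T_def Let_def)
    then have "cotorsion 2 T" using cotorsionI[OF T(3)] by simp
    then have "R = Point_At_Infinity \<or> R = T \<or> R = neg T"
      using odd_torsion_three_elements[of "534875" T R] R T(2) by simp
    then show ?thesis using T mem gen2_neg[OF on _ T(1)] by auto
  qed
  have "torsion_subgroup G \<cong> integer_mod_group 12"
    using nsq by (intro cyclic_torsion_2[OF P_def _ m co, where e = "(- 61)" and p = "0" and r = "32000"]) simp_all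
  then show ?thesis by (rule appears_of_iso)
qed

text \<open>Here the root is 97187: -155 = 97032 - 97187, and 37721189376 is four times the number
  subtracted from x^2 in the quadratic factor. The signs are opposite to those of the first
  curve.\<close>

lemma appears_12_of_nonsquares':
  assumes K: "quadratic_field TYPE('k::field_char_0)"
    and nsq: "\<nexists>u::'k. u ^ 2 = of_int (- 155)" "\<nexists>u::'k. u ^ 2 = of_int 37721189376"
  shows "appears_as_torsion_group TYPE('k) (integer_mod_group 12)"
proof -
  obtain v :: "'k \<Rightarrow> int" where "quadratic_valuation 2 v"
    using exists_quadratic_valuation[OF K, of 2] by auto
  then interpret two_adic_curve v "(- 97187) :: 'k" "(- 9430297344)" "916502307971328" "-97187" "-589393584" "14320348562052"
    by (intro two_adic_curve.intro two_adic_curve_axioms.intro short_weierstrass.intro) (simp_all add: Let_def)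
  define P where "P = Affine 97032 (48360 :: 'k)"
  have on: "on_curve E P" by (simp add: P_def)
  have m: "multiples P P [Affine 121212 11243700, Affine 93312 1674000, Affine 97812 292500, Affine 312 30225000, Affine 97187 0, Affine 312 (- 30225000), Affine 97812 (- 292500), Affine 93312 (- 1674000), Affine 121212 (- 11243700), Affine 97032 (- 48360)]"
    by (simp add: P_def Let_def)
  have P0: "P \<noteq> Point_At_Infinity" by (simp add: P_def)
  note mem = multiples_ord(2)[OF on P0 m] gen2_mem[OF on, of Point_At_Infinity]
  have co: "R \<in> grp.gen2 P Point_At_Infinity" if R: "cotorsion 2 R" for R
  proof -
    define T where "T = Affine 97812 (292500 :: 'k)"
    have T: "T \<in> grp.gen2 P Point_At_Infinity" "T \<noteq> Point_At_Infinity" "on_curve E T"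
      using mem(1)[of T] by (simp_all add: T_def)
    have "T [^]\<^bsub>G\<^esub> (3::nat) = Point_At_Infinity" unfolding pow_3[OF T(3)] by (simp add: T_def Let_def)
    then have "cotorsion 2 T" using cotorsionI[OF T(3)] by simp
    then have "R = Point_At_Infinity \<or> R = T \<or> R = neg T"
      using odd_torsion_three_elements[of "434784128140128195" T R] R T(2) by simp
    then show ?thesis using T mem gen2_neg[OF on _ T(1)] by auto
  qed
  have "torsion_subgroup G \<cong> integer_mod_group 12"
    using nsq by (intro cyclic_torsion_2[OF P_def _ m co, where e = "97187" and p = "0" and r = "(- 9430297344)"]) simp_all
  then show ?thesis by (rule appears_of_iso)
qed

lemma appears_12:
  assumes K: "quadratic_field TYPE('k::field_char_0)"
  shows "appears_as_torsion_group TYPE('k) (integer_mod_group 12)"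
proof -
  have "(\<nexists>u::'k. u ^ 2 = of_int 21) \<and> (\<nexists>u::'k. u ^ 2 = of_int (- 128000)) \<or>
      (\<nexists>u::'k. u ^ 2 = of_int (- 155)) \<and> (\<nexists>u::'k. u ^ 2 = of_int 37721189376)"
    by (rule nonsquare_choice[OF K])
      (use not_int_square[of 21 4] not_int_square[of "-128000" 0] not_int_square[of "-155" 0] not_int_square[of 37721189376 194219] not_int_square[of "-3255" 0] not_int_square[of 792144976896 890025] not_int_square[of 19840000 4454] not_int_square[of "-4828312240128000" 0] in simp_all)
  then show ?thesis using appears_12_of_nonsquares[OF K] appears_12_of_nonsquares'[OF K] by blast
qed

text \<open>For y^2 = x (x^2 + 9 x + 16) the two integers are the abscissa of P and 81 - 64. The
  reduction at 2 is good because \<beta> = 1 is odd and \<gamma> = 0.\<close>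

lemma appears_4_of_nonsquares:
  assumes K: "quadratic_field TYPE('k::field_char_0)"
    and nsq: "\<nexists>u::'k. u ^ 2 = of_int (- 4)" "\<nexists>u::'k. u ^ 2 = of_int 17"
  shows "appears_as_torsion_group TYPE('k) (integer_mod_group 4)"
proof -
  obtain v :: "'k \<Rightarrow> int" where "quadratic_valuation 2 v"
    using exists_quadratic_valuation[OF K, of 2] by auto
  then interpret two_adic_curve v "9 :: 'k" "16" "0" "9" "1" "0"
    by (intro two_adic_curve.intro two_adic_curve_axioms.intro short_weierstrass.intro) (simp_all add: Let_def)
  define P where "P = Affine (- 4) ((- 4) :: 'k)"
  have on: "on_curve E P" by (simp add: P_def)
  have m: "multiples P P [Affine 0 0, Affine (- 4) 4]"
    by (simp add: P_def Let_def)
  have P0: "P \<noteq> Point_At_Infinity" by (simp add: P_def)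
  note mem = multiples_ord(2)[OF on P0 m] gen2_mem[OF on, of Point_At_Infinity]
  have co: "R \<in> grp.gen2 P Point_At_Infinity" if R: "cotorsion 2 R" for R
    using no_odd_torsion_of_good_reduction[OF _ R] mem by simp
  have "torsion_subgroup G \<cong> integer_mod_group 4"
    using nsq by (intro cyclic_torsion_2[OF P_def _ m co, where e = "0" and p = "9" and r = "16"]) simp_all
  then show ?thesis by (rule appears_of_iso)
qed

lemma appears_4_of_nonsquares':
  assumes K: "quadratic_field TYPE('k::field_char_0)"
    and nsq: "\<nexists>u::'k. u ^ 2 = of_int 12" "\<nexists>u::'k. u ^ 2 = of_int (- 47)"
  shows "appears_as_torsion_group TYPE('k) (integer_mod_group 4)"
proof -
  obtain v :: "'k \<Rightarrow> int" where "quadratic_valuation 2 v"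
    using exists_quadratic_valuation[OF K, of 2] by auto
  then interpret two_adic_curve v "(- 23) :: 'k" "144" "0" "-23" "9" "0"
    by (intro two_adic_curve.intro two_adic_curve_axioms.intro short_weierstrass.intro) (simp_all add: Let_def)
  define P where "P = Affine 12 (12 :: 'k)"
  have on: "on_curve E P" by (simp add: P_def)
  have m: "multiples P P [Affine 0 0, Affine 12 (- 12)]"
    by (simp add: P_def Let_def)
  have P0: "P \<noteq> Point_At_Infinity" by (simp add: P_def)
  note mem = multiples_ord(2)[OF on P0 m] gen2_mem[OF on, of Point_At_Infinity]
  have co: "R \<in> grp.gen2 P Point_At_Infinity" if R: "cotorsion 2 R" for R
    using no_odd_torsion_of_good_reduction[OF _ R] mem by simp
  have "torsion_subgroup G \<cong> integer_mod_group 4"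
    using nsq by (intro cyclic_torsion_2[OF P_def _ m co, where e = "0" and p = "(- 23)" and r = "144"]) simp_all
  then show ?thesis by (rule appears_of_iso)
qed

lemma appears_4:
  assumes K: "quadratic_field TYPE('k::field_char_0)"
  shows "appears_as_torsion_group TYPE('k) (integer_mod_group 4)"
proof -
  have "(\<nexists>u::'k. u ^ 2 = of_int (- 4)) \<and> (\<nexists>u::'k. u ^ 2 = of_int 17) \<or>
      (\<nexists>u::'k. u ^ 2 = of_int 12) \<and> (\<nexists>u::'k. u ^ 2 = of_int (- 47))"
    by (rule nonsquare_choice[OF K])
      (use not_int_square[of "-4" 0] not_int_square[of 17 4] not_int_square[of 12 3] not_int_square[of "-47" 0] not_int_square[of "-48" 0] not_int_square[of 188 13] not_int_square[of 204 14] not_int_square[of "-799" 0] in simp_all)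
  then show ?thesis using appears_4_of_nonsquares[OF K] appears_4_of_nonsquares'[OF K] by blast
qed

text \<open>The curve is y^2 = (x - 23) (x^2 - 448), with -3 = 20 - 23 and 1792 = 4 * 448; it has
  good reduction at 2.\<close>

lemma appears_8_of_nonsquares:
  assumes K: "quadratic_field TYPE('k::field_char_0)"
    and nsq: "\<nexists>u::'k. u ^ 2 = of_int (- 3)" "\<nexists>u::'k. u ^ 2 = of_int 1792"
  shows "appears_as_torsion_group TYPE('k) (integer_mod_group 8)"
proof -
  obtain v :: "'k \<Rightarrow> int" where "quadratic_valuation 2 v"
    using exists_quadratic_valuation[OF K, of 2] by auto
  then interpret two_adic_curve v "(- 23) :: 'k" "(- 448)" "10304" "-23" "-28" "161"
    by (intro two_adic_curve.intro two_adic_curve_axioms.intro short_weierstrass.intro) (simp_all add: Let_def)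
  define P where "P = Affine 20 (12 :: 'k)"
  have on: "on_curve E P" by (simp add: P_def)
  have m: "multiples P P [Affine 32 72, Affine (- 4) 108, Affine 23 0, Affine (- 4) (- 108), Affine 32 (- 72), Affine 20 (- 12)]"
    by (simp add: P_def Let_def)
  have P0: "P \<noteq> Point_At_Infinity" by (simp add: P_def)
  note mem = multiples_ord(2)[OF on P0 m] gen2_mem[OF on, of Point_At_Infinity]
  have co: "R \<in> grp.gen2 P Point_At_Infinity" if R: "cotorsion 2 R" for R
    using no_odd_torsion_of_good_reduction[OF _ R] mem by simp
  have "torsion_subgroup G \<cong> integer_mod_group 8"
    using nsq by (intro cyclic_torsion_2[OF P_def _ m co, where e = "23" and p = "0" and r = "(- 448)"]) simp_all
  then show ?thesis by (rule appears_of_iso)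
qed

lemma appears_8_of_nonsquares':
  assumes K: "quadratic_field TYPE('k::field_char_0)"
    and nsq: "\<nexists>u::'k. u ^ 2 = of_int 5" "\<nexists>u::'k. u ^ 2 = of_int (- 2304)"
  shows "appears_as_torsion_group TYPE('k) (integer_mod_group 8)"
proof -
  obtain v :: "'k \<Rightarrow> int" where "quadratic_valuation 2 v"
    using exists_quadratic_valuation[OF K, of 2] by auto
  then interpret two_adic_curve v "(- 7) :: 'k" "576" "(- 4032)" "-7" "36" "-63"
    by (intro two_adic_curve.intro two_adic_curve_axioms.intro short_weierstrass.intro) (simp_all add: Let_def)
  define P where "P = Affine 12 (60 :: 'k)"
  have on: "on_curve E P" by (simp add: P_def)
  have m: "multiples P P [Affine 32 (- 200), Affine 132 1500, Affine 7 0, Affine 132 (- 1500), Affine 32 200, Affine 12 (- 60)]"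
    by (simp add: P_def Let_def)
  have P0: "P \<noteq> Point_At_Infinity" by (simp add: P_def)
  note mem = multiples_ord(2)[OF on P0 m] gen2_mem[OF on, of Point_At_Infinity]
  have co: "R \<in> grp.gen2 P Point_At_Infinity" if R: "cotorsion 2 R" for R
    using no_odd_torsion_of_good_reduction[OF _ R] mem by simp
  have "torsion_subgroup G \<cong> integer_mod_group 8"
    using nsq by (intro cyclic_torsion_2[OF P_def _ m co, where e = "7" and p = "0" and r = "576"]) simp_all
  then show ?thesis by (rule appears_of_iso)
qed

lemma appears_8:
  assumes K: "quadratic_field TYPE('k::field_char_0)"
  shows "appears_as_torsion_group TYPE('k) (integer_mod_group 8)"
proof -
  have "(\<nexists>u::'k. u ^ 2 = of_int (- 3)) \<and> (\<nexists>u::'k. u ^ 2 = of_int 1792) \<or>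
      (\<nexists>u::'k. u ^ 2 = of_int 5) \<and> (\<nexists>u::'k. u ^ 2 = of_int (- 2304))"
    by (rule nonsquare_choice[OF K])
      (use not_int_square[of "-3" 0] not_int_square[of 1792 42] not_int_square[of 5 2] not_int_square[of "-2304" 0] not_int_square[of "-15" 0] not_int_square[of 6912 83] not_int_square[of 8960 94] not_int_square[of "-4128768" 0] in simp_all)
  then show ?thesis using appears_8_of_nonsquares[OF K] appears_8_of_nonsquares'[OF K] by blast
qed

text \<open>For y^2 = x (x^2 + 25 x - 512) the integers are the abscissa -8 of P and the
  discriminant 625 + 2048. Here \<beta> = -32 has valuation 10, and 2 P has order 5 with X = 4,
  hence depth 4.\<close>

lemma appears_10_of_nonsquares:
  assumes K: "quadratic_field TYPE('k::field_char_0)"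
    and nsq: "\<nexists>u::'k. u ^ 2 = of_int (- 8)" "\<nexists>u::'k. u ^ 2 = of_int 2673"
  shows "appears_as_torsion_group TYPE('k) (integer_mod_group 10)"
proof -
  obtain v :: "'k \<Rightarrow> int" where "quadratic_valuation 2 v"
    using exists_quadratic_valuation[OF K, of 2] by auto
  then interpret two_adic_curve v "25 :: 'k" "(- 512)" "0" "25" "-32" "0"
    by (intro two_adic_curve.intro two_adic_curve_axioms.intro short_weierstrass.intro) (simp_all add: Let_def)
  define P where "P = Affine (- 8) ((- 72) :: 'k)"
  have on: "on_curve E P" by (simp add: P_def)
  have m: "multiples P P [Affine 16 (- 48), Affine (- 32) 96, Affine 64 576, Affine 0 0, Affine 64 (- 576), Affine (- 32) (- 96), Affine 16 48, Affine (- 8) 72]"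
    by (simp add: P_def Let_def)
  have P0: "P \<noteq> Point_At_Infinity" by (simp add: P_def)
  note mem = multiples_ord(2)[OF on P0 m] gen2_mem[OF on, of Point_At_Infinity]
  have co: "R \<in> grp.gen2 P Point_At_Infinity" if R: "cotorsion 2 R" for R
  proof (cases "R = Point_At_Infinity")
    case False
    define T where "T = Affine 16 ((- 48) :: 'k)"
    have T: "T \<in> grp.gen2 P Point_At_Infinity" "T \<noteq> Point_At_Infinity" "on_curve E T"
      using mem(1)[of T] by (simp_all add: T_def)
    have "multiples T T [Affine 64 576, Affine 64 (- 576), Affine 16 48]" by (simp add: T_def Let_def)
    then have "T [^]\<^bsub>G\<^esub> (5::nat) = Point_At_Infinity" by (rule multiples_infinity[OF T(3,2)]) simp
    then have "cotorsion 2 T" using cotorsionI[OF T(3)] by simp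
    moreover have "T = Affine (4 * of_int 4) ((- 48))" by (simp add: T_def)
    moreover have "veq (of_int 4) 4" by (rule veq_intI[of _ 2 "1"]) simp_all
    ultimately have "depth T 4" using depthI by metis
    moreover have "veq (of_int (- 32)) 10" by (rule veq_intI[of _ 5 "(- 1)"]) simp_all
    moreover have "psi3 x \<noteq> 0" for x :: 'k
    proof
      assume "psi3 x = 0"
      then have x: "of_int 3 * x ^ 4 + of_int 100 * x ^ 3 + of_int (- 3072) * x ^ 2 + of_int 0 * x + of_int (- 262144) = 0"
        by (simp add: psi3_def)
      \<comment> \<open>5 is merely an auxiliary prime: modulo 5 the quartic has no root in the
        field with 25 elements.\<close>
      obtain w :: "'k \<Rightarrow> int" where "quadratic_valuation 5 w"
        using exists_quadratic_valuation[OF K, of 5] by auto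
      then show False
        by (rule quadratic_valuation.quartic_no_root[OF _ _ _ _ x]) code_simp+
    qed
    ultimately have "R = T \<or> R = neg T \<or> R [^]\<^bsub>G\<^esub> (2::nat) = T \<or> R [^]\<^bsub>G\<^esub> (2::nat) = neg T"
      using odd_torsion_of_depth_10[OF _ _ _ _ _ R False] by simp
    then have "R \<in> grp.gen2 P Point_At_Infinity \<or> R [^]\<^bsub>G\<^esub> (2::nat) \<in> grp.gen2 P Point_At_Infinity"
      using T(1) gen2_neg[OF on _ T(1)] by auto
    \<comment> \<open>R has odd order, so it is a multiple of 2 R and lies in every subgroup that
      contains 2 R.\<close>
    then show ?thesis
      using grp.coprime_torsion_pow_mem[OF gen2_subgroup[OF on, of Point_At_Infinity]] R unfolding cotorsion_def by auto
  qed (use mem in simp)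
  have "torsion_subgroup G \<cong> integer_mod_group 10"
    using nsq by (intro cyclic_torsion_2[OF P_def _ m co, where e = "0" and p = "25" and r = "(- 512)"]) simp_all
  then show ?thesis by (rule appears_of_iso)
qed

lemma appears_10_of_nonsquares':
  assumes K: "quadratic_field TYPE('k::field_char_0)"
    and nsq: "\<nexists>u::'k. u ^ 2 = of_int 40" "\<nexists>u::'k. u ^ 2 = of_int (- 1215)"
  shows "appears_as_torsion_group TYPE('k) (integer_mod_group 10)"
proof -
  obtain v :: "'k \<Rightarrow> int" where "quadratic_valuation 2 v"
    using exists_quadratic_valuation[OF K, of 2] by auto
  then interpret two_adic_curve v "(- 95) :: 'k" "2560" "0" "-95" "160" "0"
    by (intro two_adic_curve.intro two_adic_curve_axioms.intro short_weierstrass.intro) (simp_all add: Let_def)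
  define P where "P = Affine 40 (120 :: 'k)"
  have on: "on_curve E P" by (simp add: P_def)
  have m: "multiples P P [Affine 16 (- 144), Affine 160 (- 1440), Affine 64 192, Affine 0 0, Affine 64 (- 192), Affine 160 1440, Affine 16 144, Affine 40 (- 120)]"
    by (simp add: P_def Let_def)
  have P0: "P \<noteq> Point_At_Infinity" by (simp add: P_def)
  note mem = multiples_ord(2)[OF on P0 m] gen2_mem[OF on, of Point_At_Infinity]
  have co: "R \<in> grp.gen2 P Point_At_Infinity" if R: "cotorsion 2 R" for R
  proof (cases "R = Point_At_Infinity")
    case False
    define T where "T = Affine 16 ((- 144) :: 'k)"
    have T: "T \<in> grp.gen2 P Point_At_Infinity" "T \<noteq> Point_At_Infinity" "on_curve E T"
      using mem(1)[of T] by (simp_all add: T_def)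
    have "multiples T T [Affine 64 192, Affine 64 (- 192), Affine 16 144]" by (simp add: T_def Let_def)
    then have "T [^]\<^bsub>G\<^esub> (5::nat) = Point_At_Infinity" by (rule multiples_infinity[OF T(3,2)]) simp
    then have "cotorsion 2 T" using cotorsionI[OF T(3)] by simp
    moreover have "T = Affine (4 * of_int 4) ((- 144))" by (simp add: T_def)
    moreover have "veq (of_int 4) 4" by (rule veq_intI[of _ 2 "1"]) simp_all
    ultimately have "depth T 4" using depthI by metis
    moreover have "veq (of_int 160) 10" by (rule veq_intI[of _ 5 "5"]) simp_all
    moreover have "psi3 x \<noteq> 0" for x :: 'k
    proof
      assume "psi3 x = 0"
      then have x: "of_int 3 * x ^ 4 + of_int (- 380) * x ^ 3 + of_int 15360 * x ^ 2 + of_int 0 * x + of_int (- 6553600) = 0"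
        by (simp add: psi3_def)
      obtain w :: "'k \<Rightarrow> int" where "quadratic_valuation 11 w"
        using exists_quadratic_valuation[OF K, of 11] by auto
      then show False
        by (rule quadratic_valuation.quartic_no_root[OF _ _ _ _ x]) code_simp+
    qed
    ultimately have "R = T \<or> R = neg T \<or> R [^]\<^bsub>G\<^esub> (2::nat) = T \<or> R [^]\<^bsub>G\<^esub> (2::nat) = neg T"
      using odd_torsion_of_depth_10[OF _ _ _ _ _ R False] by simp
    then have "R \<in> grp.gen2 P Point_At_Infinity \<or> R [^]\<^bsub>G\<^esub> (2::nat) \<in> grp.gen2 P Point_At_Infinity"
      using T(1) gen2_neg[OF on _ T(1)] by auto
    then show ?thesis
      using grp.coprime_torsion_pow_mem[OF gen2_subgroup[OF on, of Point_At_Infinity]] R unfolding cotorsion_def by auto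
  qed (use mem in simp)
  have "torsion_subgroup G \<cong> integer_mod_group 10"
    using nsq by (intro cyclic_torsion_2[OF P_def _ m co, where e = "0" and p = "(- 95)" and r = "2560"]) simp_all
  then show ?thesis by (rule appears_of_iso)
qed

lemma appears_10:
  assumes K: "quadratic_field TYPE('k::field_char_0)"
  shows "appears_as_torsion_group TYPE('k) (integer_mod_group 10)"
proof -
  have "(\<nexists>u::'k. u ^ 2 = of_int (- 8)) \<and> (\<nexists>u::'k. u ^ 2 = of_int 2673) \<or>
      (\<nexists>u::'k. u ^ 2 = of_int 40) \<and> (\<nexists>u::'k. u ^ 2 = of_int (- 1215))"
    by (rule nonsquare_choice[OF K])
      (use not_int_square[of "-8" 0] not_int_square[of 2673 51] not_int_square[of 40 6] not_int_square[of "-1215" 0] not_int_square[of "-320" 0] not_int_square[of 9720 98] not_int_square[of 106920 326] not_int_square[of "-3247695" 0] in simp_all)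
  then show ?thesis using appears_10_of_nonsquares[OF K] appears_10_of_nonsquares'[OF K] by blast
qed

text \<open>One curve serves all K: its roots are 0, 5 and 48, and for each point of order 2 the two
  differences with the other roots, and their product, are not squares of integers.\<close>

lemma appears_2_2:
  assumes K: "quadratic_field TYPE('k::field_char_0)"
  shows "appears_as_torsion_group TYPE('k) (integer_mod_group 2 \<times>\<times> integer_mod_group (2 * 1))"
proof -
  obtain v :: "'k \<Rightarrow> int" where "quadratic_valuation 2 v"
    using exists_quadratic_valuation[OF K, of 2] by auto
  then interpret two_adic_curve v "(- 53) :: 'k" "240" "0" "-53" "15" "0"
    by (intro two_adic_curve.intro two_adic_curve_axioms.intro short_weierstrass.intro) (simp_all add: Let_def)
  define P T where "P = Affine 48 (0 :: 'k)" and "T = Affine 0 (0 :: 'k)"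
  have on: "on_curve E P" "on_curve E T" by (simp_all add: P_def T_def)
  have m: "multiples P P []"
    by (simp add: P_def Let_def)
  have P0: "P \<noteq> Point_At_Infinity" by (simp add: P_def)
  note mem = gen2_mem[OF on]
  have co: "R \<in> grp.gen2 P T" if R: "cotorsion 2 R" for R
    using no_odd_torsion_of_good_reduction[OF _ R] mem by simp
  have nP: "(\<nexists>u::'k. u ^ 2 = of_int 48) \<or> (\<nexists>u::'k. u ^ 2 = of_int 43)"
    by (rule nonsquare_pair[OF K]) (use not_int_square[of 48 6] not_int_square[of 43 6] not_int_square[of 2064 45] in simp_all)
  have nT: "(\<nexists>u::'k. u ^ 2 = of_int (- 48)) \<or> (\<nexists>u::'k. u ^ 2 = of_int (- 5))"
    by (rule nonsquare_pair[OF K]) (use not_int_square[of "-48" 0] not_int_square[of "-5" 0] not_int_square[of 240 15] in simp_all)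
  have nPT: "(\<nexists>u::'k. u ^ 2 = of_int 5) \<or> (\<nexists>u::'k. u ^ 2 = of_int (- 43))"
    by (rule nonsquare_pair[OF K]) (use not_int_square[of 5 2] not_int_square[of "-43" 0] not_int_square[of "-215" 0] in simp_all)
  have half: "P [^]\<^bsub>G\<^esub> (1::nat) = Affine 48 0" using on(1) by (simp add: P_def G_simps del: on_curve.simps)
  have "torsion_subgroup G \<cong> integer_mod_group 2 \<times>\<times> integer_mod_group (2 * 1)"
  proof (rule bicyclic_torsion_2[OF P_def _ m _ T_def _ _ _ half _ _ co, where ?e3.0 = "5"])
    show "ec_add E P T = Affine 5 0" by (simp add: P_def T_def Let_def)
  qed (use nP nT nPT in auto)
  then show ?thesis by (rule appears_of_iso)
qed

text \<open>The roots 0, -16, -49 make the differences 0 + 16 and 0 + 49 squares, so that (0, 0)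
  becomes a double; the abscissa 28 of its half P is 4 * 7.\<close>

lemma appears_2_4:
  assumes K: "quadratic_field TYPE('k::field_char_0)"
  shows "appears_as_torsion_group TYPE('k) (integer_mod_group 2 \<times>\<times> integer_mod_group (2 * 2))"
proof -
  obtain v :: "'k \<Rightarrow> int" where "quadratic_valuation 2 v"
    using exists_quadratic_valuation[OF K, of 2] by auto
  then interpret two_adic_curve v "65 :: 'k" "784" "0" "65" "49" "0"
    by (intro two_adic_curve.intro two_adic_curve_axioms.intro short_weierstrass.intro) (simp_all add: Let_def)
  define P T where "P = Affine 28 (308 :: 'k)" and "T = Affine (- 16) (0 :: 'k)"
  have on: "on_curve E P" "on_curve E T" by (simp_all add: P_def T_def)
  have m: "multiples P P [Affine 0 0, Affine 28 (- 308)]"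
    by (simp add: P_def Let_def)
  have P0: "P \<noteq> Point_At_Infinity" by (simp add: P_def)
  note mem = gen2_mem[OF on]
  have co: "R \<in> grp.gen2 P T" if R: "cotorsion 2 R" for R
    using no_odd_torsion_of_good_reduction[OF _ R] mem by simp
  have nP: "(\<nexists>u::'k. u ^ 2 = of_int 44) \<or> (\<nexists>u::'k. u ^ 2 = of_int 28)"
    by (rule nonsquare_pair[OF K]) (use not_int_square[of 44 6] not_int_square[of 28 5] not_int_square[of 1232 35] in simp_all)
  have nT: "(\<nexists>u::'k. u ^ 2 = of_int (- 16)) \<or> (\<nexists>u::'k. u ^ 2 = of_int 33)"
    by (rule nonsquare_pair[OF K]) (use not_int_square[of "-16" 0] not_int_square[of 33 5] not_int_square[of "-528" 0] in simp_all)
  have nPT: "(\<nexists>u::'k. u ^ 2 = of_int (- 12)) \<or> (\<nexists>u::'k. u ^ 2 = of_int 21)"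
    by (rule nonsquare_pair[OF K]) (use not_int_square[of "-12" 0] not_int_square[of 21 4] not_int_square[of "-252" 0] in simp_all)
  have half: "P [^]\<^bsub>G\<^esub> (2::nat) = Affine 0 0" using multiples_nth[OF on(1) P0 m, of 0 2] by simp
  have "torsion_subgroup G \<cong> integer_mod_group 2 \<times>\<times> integer_mod_group (2 * 2)"
  proof (rule bicyclic_torsion_2[OF P_def _ m _ T_def _ _ _ half _ _ co, where ?e3.0 = "(- 49)"])
    show "ec_add E P T = Affine (- 28) 84" by (simp add: P_def T_def Let_def)
  qed (use nP nT nPT in auto)
  then show ?thesis by (rule appears_of_iso)
qed

text \<open>The curve is y^2 = x (x + 5) (x + 32). Reduction at 2 is multiplicative, and
  \<open>S\<close> = 2 P is the known point of order 3.\<close>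

lemma appears_2_6:
  assumes K: "quadratic_field TYPE('k::field_char_0)"
  shows "appears_as_torsion_group TYPE('k) (integer_mod_group 2 \<times>\<times> integer_mod_group (2 * 3))"
proof -
  obtain v :: "'k \<Rightarrow> int" where "quadratic_valuation 2 v"
    using exists_quadratic_valuation[OF K, of 2] by auto
  then interpret two_adic_curve v "37 :: 'k" "160" "0" "37" "10" "0"
    by (intro two_adic_curve.intro two_adic_curve_axioms.intro short_weierstrass.intro) (simp_all add: Let_def)
  define P T where "P = Affine 40 ((- 360) :: 'k)" and "T = Affine (- 5) (0 :: 'k)"
  have on: "on_curve E P" "on_curve E T" by (simp_all add: P_def T_def)
  have m: "multiples P P [Affine 4 (- 36), Affine 0 0, Affine 4 36, Affine 40 360]"
    by (simp add: P_def Let_def)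
  have P0: "P \<noteq> Point_At_Infinity" by (simp add: P_def)
  note mem = gen2_mem[OF on]
  have co: "R \<in> grp.gen2 P T" if R: "cotorsion 2 R" for R
  proof -
    define S where "S = Affine 4 ((- 36) :: 'k)"
    have S: "S \<noteq> Point_At_Infinity" "on_curve E S" by (simp_all add: S_def)
    have "ec_add E P P = S" by (simp add: P_def S_def Let_def)
    then have S_mem: "S \<in> grp.gen2 P T"
      using subgroup.m_closed[OF gen2_subgroup[OF on] mem(1) mem(1)] by (simp only: G_simps)
    have "S [^]\<^bsub>G\<^esub> (3::nat) = Point_At_Infinity" unfolding pow_3[OF S(2)] by (simp add: S_def Let_def)
    then have "cotorsion 2 S" using cotorsionI[OF S(2)] by simp
    then have "R = Point_At_Infinity \<or> R = S \<or> R = neg S"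
      using odd_torsion_three_elements[of "25" S R] R S(1) by simp
    then show ?thesis using S_mem mem gen2_neg[OF on S_mem] by auto
  qed
  have nP: "(\<nexists>u::'k. u ^ 2 = of_int 45) \<or> (\<nexists>u::'k. u ^ 2 = of_int 40)"
    by (rule nonsquare_pair[OF K]) (use not_int_square[of 45 6] not_int_square[of 40 6] not_int_square[of 1800 42] in simp_all)
  have nT: "(\<nexists>u::'k. u ^ 2 = of_int (- 5)) \<or> (\<nexists>u::'k. u ^ 2 = of_int 27)"
    by (rule nonsquare_pair[OF K]) (use not_int_square[of "-5" 0] not_int_square[of 27 5] not_int_square[of "-135" 0] in simp_all)
  have nPT: "(\<nexists>u::'k. u ^ 2 = of_int (- 3)) \<or> (\<nexists>u::'k. u ^ 2 = of_int (- 8))"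
    by (rule nonsquare_pair[OF K]) (use not_int_square[of "-3" 0] not_int_square[of "-8" 0] not_int_square[of 24 4] in simp_all)
  have half: "P [^]\<^bsub>G\<^esub> (3::nat) = Affine 0 0" using multiples_nth[OF on(1) P0 m, of 1 3] by simp
  have "torsion_subgroup G \<cong> integer_mod_group 2 \<times>\<times> integer_mod_group (2 * 3)"
  proof (rule bicyclic_torsion_2[OF P_def _ m _ T_def _ _ _ half _ _ co, where ?e3.0 = "(- 32)"])
    show "ec_add E P T = Affine (- 8) (- 24)" by (simp add: P_def T_def Let_def)
  qed (use nP nT nPT in auto)
  then show ?thesis by (rule appears_of_iso)
qed

text \<open>The curve is y^2 = x (x + 81) (x + 256). Here \<beta> = 1296 = 2^4 * 81 has valuation 8,
  and 11 is an auxiliary prime that rules out roots of \<open>psi3\<close> in K.\<close>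

lemma appears_2_8:
  assumes K: "quadratic_field TYPE('k::field_char_0)"
  shows "appears_as_torsion_group TYPE('k) (integer_mod_group 2 \<times>\<times> integer_mod_group (2 * 4))"
proof -
  obtain v :: "'k \<Rightarrow> int" where "quadratic_valuation 2 v"
    using exists_quadratic_valuation[OF K, of 2] by auto
  then interpret two_adic_curve v "337 :: 'k" "20736" "0" "337" "1296" "0"
    by (intro two_adic_curve.intro two_adic_curve_axioms.intro short_weierstrass.intro) (simp_all add: Let_def)
  define P T where "P = Affine 864 (30240 :: 'k)" and "T = Affine (- 81) (0 :: 'k)"
  have on: "on_curve E P" "on_curve E T" by (simp_all add: P_def T_def)
  have m: "multiples P P [Affine 144 3600, Affine 24 840, Affine 0 0, Affine 24 (- 840), Affine 144 (- 3600), Affine 864 (- 30240)]"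
    by (simp add: P_def Let_def)
  have P0: "P \<noteq> Point_At_Infinity" by (simp add: P_def)
  note mem = gen2_mem[OF on]
  have co: "R \<in> grp.gen2 P T" if R: "cotorsion 2 R" for R
  proof -
    have "veq (of_int 1296) 8" by (rule veq_intI[of _ 4 "81"]) simp_all
    moreover have "psi3 x \<noteq> 0" for x :: 'k
    proof
      assume "psi3 x = 0"
      then have x: "of_int 3 * x ^ 4 + of_int 1348 * x ^ 3 + of_int 124416 * x ^ 2 + of_int 0 * x + of_int (- 429981696) = 0"
        by (simp add: psi3_def)
      obtain w :: "'k \<Rightarrow> int" where "quadratic_valuation 11 w"
        using exists_quadratic_valuation[OF K, of 11] by auto
      then show False
        by (rule quadratic_valuation.quartic_no_root[OF _ _ _ _ x]) code_simp+
    qed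
    ultimately have "R = Point_At_Infinity" using no_odd_torsion_of_depth_8[OF _ _ _ _ R] by simp
    then show ?thesis using mem by simp
  qed
  have nP: "(\<nexists>u::'k. u ^ 2 = of_int 945) \<or> (\<nexists>u::'k. u ^ 2 = of_int 864)"
    by (rule nonsquare_pair[OF K]) (use not_int_square[of 945 30] not_int_square[of 864 29] not_int_square[of 816480 903] in simp_all)
  have nT: "(\<nexists>u::'k. u ^ 2 = of_int (- 81)) \<or> (\<nexists>u::'k. u ^ 2 = of_int 175)"
    by (rule nonsquare_pair[OF K]) (use not_int_square[of "-81" 0] not_int_square[of 175 13] not_int_square[of "-14175" 0] in simp_all)
  have nPT: "(\<nexists>u::'k. u ^ 2 = of_int (- 15)) \<or> (\<nexists>u::'k. u ^ 2 = of_int (- 96))"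
    by (rule nonsquare_pair[OF K]) (use not_int_square[of "-15" 0] not_int_square[of "-96" 0] not_int_square[of 1440 37] in simp_all)
  have half: "P [^]\<^bsub>G\<^esub> (4::nat) = Affine 0 0" using multiples_nth[OF on(1) P0 m, of 2 4] by simp
  have "torsion_subgroup G \<cong> integer_mod_group 2 \<times>\<times> integer_mod_group (2 * 4)"
  proof (rule bicyclic_torsion_2[OF P_def _ m _ T_def _ _ _ half _ _ co, where ?e3.0 = "(- 256)"])
    show "ec_add E P T = Affine (- 96) 480" by (simp add: P_def T_def Let_def)
  qed (use nP nT nPT in auto)
  then show ?thesis by (rule appears_of_iso)
qed

section \<open>Cyclic groups of odd order\<close>

locale integral_curve = quadratic_valuation p v + short_weierstrass a b c
  for p :: int and v :: "'k::field_char_0 \<Rightarrow> int" and a b c :: 'k +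
  assumes integral: "vge a 0" "vge b 0" "vge c 0"
begin

text \<open>If \<open>P\<close> and \<open>R\<close> have the same residue and \<open>P \<noteq> \<plusminus> R\<close>, one of \<open>P + R\<close>, \<open>P - R\<close> is not integral.\<close>

lemma congruent_cotorsion:
  assumes int: "\<And>x y. cotorsion q (Affine x y) \<Longrightarrow> vge x 0"
    and T: "cotorsion q (Affine x1 y1)" "cotorsion q (Affine x2 y2)"
    and x: "vge (x1 - x2) 1" and u: "veq (4 * F x2) 0"
  shows "Affine x1 y1 = Affine x2 y2 \<or> Affine x1 y1 = neg (Affine x2 y2)"
proof -
  have on: "y1 ^ 2 = F x1" "y2 ^ 2 = F x2" using cotorsion_on[OF T(1)] cotorsion_on[OF T(2)] by simp_all
  show ?thesis
  proof (cases "x1 = x2")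
    case True
    then show ?thesis using equal_x cotorsion_on[OF T(1)] cotorsion_on[OF T(2)] by blast
  next
    case False
    obtain s w t w' where s: "ec_add E (Affine x1 y1) (Affine x2 y2) = Affine s w"
      "ec_add E (Affine x1 y1) (neg (Affine x2 y2)) = Affine t w'"
      "(s + t) * (x1 - x2) ^ 2 = 2 * x1 * x2 * (x1 + x2) + 4 * a * x1 * x2 + 2 * b * (x1 + x2) + 4 * c"
      using sum_difference[OF on False] by metis
    have "vge s 0" using int cotorsion_add[OF T] unfolding s(1) .
    moreover have "vge t 0" using int cotorsion_add[OF T(1) cotorsion_neg[OF T(2)]] unfolding s(2) .
    ultimately have "vge ((s + t) * (x1 - x2) ^ 2) 2" using x by (intro vge_monom[OF vge_add]) auto
    moreover have "veq ((s + t) * (x1 - x2) ^ 2) 0"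
    proof -
      \<comment> \<open>At x1 = x2 the numerator of the sum formula becomes 4 F(x2), so it is
        congruent to that unit.\<close>
      have "(s + t) * (x1 - x2) ^ 2 = 4 * F x2 + (x1 - x2) * (2 * x2 * (x1 + 2 * x2) + 4 * a * x2 + 2 * b)"
        unfolding s(3) by (simp add: algebra_simps power2_eq_square power3_eq_cube)
      moreover have "vge (2 * x2 * (x1 + 2 * x2) + 4 * a * x2 + 2 * b) 0"
        using int[OF T(1)] int[OF T(2)] integral by (intro integral_intros)
      then have "vge ((x1 - x2) * (2 * x2 * (x1 + 2 * x2) + 4 * a * x2 + 2 * b)) 1" by (rule vge_mult_left[OF x])
      ultimately show ?thesis using veq_add[OF u] by simp
    qed
    ultimately show ?thesis using vge_veq_unique by fastforce
  qed
qed

lemma integral_y: "vge x 0 \<Longrightarrow> y ^ 2 = F x \<Longrightarrow> vge y 0"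
proof (rule ccontr)
  assume x: "vge x 0" and y: "y ^ 2 = F x" and "\<not> vge y 0"
  then obtain n where n: "n < 0" "veq y n" using not_vge by blast
  have "vge (F x) 0" using x integral by (intro integral_intros)
  moreover have "veq (F x) (2 * n)" unfolding y[symmetric] by (rule veq_power[OF n(2)]) simp
  ultimately show False using n(1) vge_veq_unique by fastforce
qed

end

text \<open>The curves y^2 = x^3 + d, on which the points with x = 0 have order 3. By
  \<open>no_root\<close>, doubling never sends a nonzero abscissa to 0.\<close>

locale mordell_curve = integral_curve "2::int" v 0 0 c
  for v :: "'k::field_char_0 \<Rightarrow> int" and c :: 'k +
  fixes d :: int
  assumes c: "c = of_int d" and odd_d: "odd d" and no_root: "\<And>x::'k. x ^ 3 \<noteq> of_int (8 * d)"
begin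

lemma mordell_double:
  assumes T: "cotorsion 2 (Affine x y)"
  shows "x ^ 3 + of_int d \<noteq> 0" "\<exists>y'. Affine x y [^]\<^bsub>G\<^esub> (2::nat)
    = Affine (x * (x ^ 3 + of_int (- 8 * d)) / (of_int 4 * (x ^ 3 + of_int d))) y'"
proof -
  have on: "on_curve E (Affine x y)" using cotorsion_on T by blast
  have y: "y \<noteq> 0"
  proof
    assume "y = 0"
    then have "Affine x y [^]\<^bsub>G\<^esub> (2::nat) = Point_At_Infinity" using pow_2[OF on] by simp
    then show False using cotorsion_pow_eq_infinity[OF T] by simp
  qed
  then show "x ^ 3 + of_int d \<noteq> 0" using on by (auto simp: c)
  have "(x ^ 2 - 0) ^ 2 - 4 * c * (2 * x + 0) = x * (x ^ 3 + of_int (- 8 * d))"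
    by (simp add: c algebra_simps power2_eq_square power3_eq_cube)
  moreover have "4 * F x = of_int 4 * (x ^ 3 + of_int d)" by (simp add: c)
  moreover have "y ^ 2 = F x" using on by simp
  ultimately show "\<exists>y'. Affine x y [^]\<^bsub>G\<^esub> (2::nat)
    = Affine (x * (x ^ 3 + of_int (- 8 * d)) / (of_int 4 * (x ^ 3 + of_int d))) y'"
    using double[of y x] y unfolding pow_2[OF on] by metis
qed

definition xval :: "'k ec_point \<Rightarrow> int" where
  "xval P = (case P of Point_At_Infinity \<Rightarrow> 0 | Affine x y \<Rightarrow> v x)"

lemma v4: "veq (of_int 4) 4"
  by (rule veq_intI[of 4 2 1 4]) simp_all

lemma v8: "veq (of_int (- 8 * d)) 6"
  by (rule veq_intI[of _ 3 "- d"]) (use odd_d in simp_all)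

text \<open>Doubling decreases the valuation of \<open>x\<close> if it is at most 0 and increases it if it is at least 2.\<close>

lemma mordell_odd_torsion:
  assumes T: "cotorsion 2 (Affine x y)"
  shows "x = 0"
proof (rule ccontr)
  assume x0: "x \<noteq> 0"
  have 1: "vge x 1" if T: "cotorsion 2 (Affine x y)" for x y
  proof (rule ccontr)
    assume "\<not> vge x 1"
    define Z where "Z P \<longleftrightarrow> (\<exists>x y. P = Affine x y \<and> \<not> vge x 1)" for P :: "'k ec_point"
    have step: "Z (P [^]\<^bsub>G\<^esub> (2::nat)) \<and> xval (P [^]\<^bsub>G\<^esub> (2::nat)) < xval P" if P: "cotorsion 2 P" "Z P" for P
    proof -
      obtain x y where X: "P = Affine x y" "\<not> vge x 1" using P(2) by (auto simp: Z_def)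
      obtain n where n: "n < 1" "veq x n" using X(2) not_vge by blast
      obtain y' where y': "P [^]\<^bsub>G\<^esub> (2::nat) = Affine (x * (x ^ 3 + of_int (- 8 * d)) / (of_int 4 * (x ^ 3 + of_int d))) y'"
        using mordell_double(2) P(1) X(1) by blast
      have "veq (x ^ 3 + of_int (- 8 * d)) (3 * n)"
        using n by (intro veq_add[OF veq_power[OF n(2)] veq_vge[OF v8 order_refl]]) auto
      then have num: "veq (x * (x ^ 3 + of_int (- 8 * d))) (4 * n)" using n by (intro veq_mult) auto
      have "vge (x ^ 3 + of_int d) (3 * n)"
        using n by (intro vge_add vge_power[OF veq_vge[OF n(2) order_refl]] vge_mono[OF vge_int]) auto
      then have "vge (of_int 4 * (x ^ 3 + of_int d)) (4 + 3 * n)" by (intro vge_mult[OF veq_vge[OF v4 order_refl]]) auto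
      moreover have "x ^ 3 + of_int d \<noteq> 0" using mordell_double(1) P(1) X(1) by blast
      then have "of_int 4 * (x ^ 3 + of_int d) \<noteq> 0" by (simp only: mult_eq_0_iff) simp
      ultimately obtain e where e: "veq (of_int 4 * (x ^ 3 + of_int d)) e" "e \<ge> 4 + 3 * n"
        unfolding vge_def veq_def by blast
      have r: "veq (x * (x ^ 3 + of_int (- 8 * d)) / (of_int 4 * (x ^ 3 + of_int d))) (4 * n - e)"
        by (rule veq_divide[OF num e(1) refl])
      have "\<not> vge (x * (x ^ 3 + of_int (- 8 * d)) / (of_int 4 * (x ^ 3 + of_int d))) 1"
        using vge_veq_unique[OF _ r, of 1] e(2) n(1) by auto
      then have "Z (P [^]\<^bsub>G\<^esub> (2::nat))" unfolding Z_def y' by blast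
      moreover have "xval (P [^]\<^bsub>G\<^esub> (2::nat)) = 4 * n - e" unfolding y' xval_def using r by (simp only: veq_def ec_point.case)
      moreover have "xval P = n" using n(2) by (simp add: X(1) xval_def veq_def)
      ultimately show ?thesis using e(2) n(1) by simp
    qed
    have "Z (Affine x y)" using \<open>\<not> vge x 1\<close> by (auto simp: Z_def)
    then show False using cotorsion_descent[of 2 "Affine x y" Z xval] step T by blast
  qed
  \<comment> \<open>All abscissas now have positive valuation. The descent is repeated with the
    opposite sign, since doubling raises the valuation of a nonzero abscissa.\<close>
  define Z where "Z P \<longleftrightarrow> (\<exists>x y. P = Affine x y \<and> x \<noteq> 0)" for P :: "'k ec_point"
  have step: "Z (P [^]\<^bsub>G\<^esub> (2::nat)) \<and> - xval (P [^]\<^bsub>G\<^esub> (2::nat)) < - xval P" if P: "cotorsion 2 P" "Z P" for P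
  proof -
    obtain x y where X: "P = Affine x y" "x \<noteq> 0" using P(2) by (auto simp: Z_def)
    have T: "cotorsion 2 (Affine x y)" using P X by simp
    define x' where "x' = x * (x ^ 3 + of_int (- 8 * d)) / (of_int 4 * (x ^ 3 + of_int d))"
    obtain y' where y': "P [^]\<^bsub>G\<^esub> (2::nat) = Affine x' y'"
      using mordell_double(2)[OF T] X(1) unfolding x'_def by blast
    have T': "vge x' 1" using 1 cotorsion_pow[OF P(1), of 2] unfolding y' .
    obtain n where n: "n \<ge> 1" "veq x n" using 1[OF T] X(2) by (auto simp: vge_def veq_def)
    have "vge (x ^ 3) 1" using vge_power[OF veq_vge[OF n(2) order_refl], of 1 3] n(1) by simp
    then have "veq (x ^ 3 + of_int d) 0" using odd_d by (intro veq_add'[OF _ veq_unit]) auto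
    then have den: "veq (of_int 4 * (x ^ 3 + of_int d)) 4" by (intro veq_mult[OF v4]) auto
    have nz: "x' \<noteq> 0"
    proof -
      have "x ^ 3 + of_int (- 8 * d) \<noteq> 0" using no_root[of x] by simp
      then show ?thesis using X(2) den by (simp add: x'_def veq_def)
    qed
    \<comment> \<open>From valuation 1 the double would have valuation 4 - 4 = 0, which was just
      excluded.\<close>
    have "n \<noteq> 1"
    proof
      assume "n = 1"
      then have "veq (x ^ 3 + of_int (- 8 * d)) 3"
        using n by (intro veq_add[OF veq_power[OF n(2)] veq_vge[OF v8 order_refl]]) auto
      then have "veq (x * (x ^ 3 + of_int (- 8 * d))) 4" using n \<open>n = 1\<close> by (intro veq_mult[OF n(2)]) auto
      then have "veq x' 0" unfolding x'_def using den by (intro veq_divide) auto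
      then show False using T' vge_veq_unique by fastforce
    qed
    then have "vge (x ^ 3 + of_int (- 8 * d)) 6"
      using n by (intro vge_add vge_power[OF veq_vge[OF n(2) order_refl]] veq_vge[OF v8]) auto
    then have "vge (x * (x ^ 3 + of_int (- 8 * d))) (n + 6)" by (intro vge_mult[OF veq_vge[OF n(2) order_refl]]) auto
    then have "vge x' (n + 2)" unfolding x'_def using den by (intro vge_divide) auto
    then have "v x' \<ge> n + 2" using nz by (simp add: vge_def)
    moreover have "Z (P [^]\<^bsub>G\<^esub> (2::nat))" unfolding Z_def y' using nz by blast
    moreover have "xval P = n" using n(2) by (simp add: X(1) xval_def veq_def)
    ultimately show ?thesis unfolding y' by (simp add: xval_def)
  qed
  have "Z (Affine x y)" using x0 by (auto simp: Z_def)
  then show False using cotorsion_descent[of 2 "Affine x y" Z "\<lambda>P. - xval P"] step T by blast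
qed

end

lemma no_int_root:
  fixes q :: int and u v w :: int
  assumes "\<forall>r\<in>set [0..q - 1]. \<not> q dvd r ^ 3 + u * r ^ 2 + v * r + w" "q > 0"
  shows "\<nexists>m::int. m ^ 3 + u * m ^ 2 + v * m + w = 0"
proof
  assume "\<exists>m::int. m ^ 3 + u * m ^ 2 + v * m + w = 0"
  then obtain m :: int where m: "m ^ 3 + u * m ^ 2 + v * m + w = 0" by blast
  define r where "r = m mod q"
  obtain d where "m = r + q * d" unfolding r_def by (metis mod_mult_div_eq)
  then have "r ^ 3 + u * r ^ 2 + v * r + w = (m ^ 3 + u * m ^ 2 + v * m + w)
     + q * (- d * (m ^ 2 + m * r + r ^ 2) - u * d * (m + r) - v * d)"
    by (simp add: algebra_simps power2_eq_square power3_eq_cube)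
  then have "q dvd r ^ 3 + u * r ^ 2 + v * r + w" using m by simp
  moreover have "r \<in> set [0..q - 1]" using assms(2) by (simp add: r_def)
  ultimately show False using assms(1) by blast
qed

lemma no_cubic_root:
  fixes x :: "'k::field_char_0" and u v w q :: int
  assumes "quadratic_field TYPE('k)" "\<forall>r\<in>set [0..q - 1]. \<not> q dvd r ^ 3 + u * r ^ 2 + v * r + w" "q > 0"
  shows "x ^ 3 + of_int u * x ^ 2 + of_int v * x + of_int w \<noteq> 0"
  using int_cubic_root[OF assms(1)] no_int_root[OF assms(2,3)] by blast

text \<open>Odd torsion on y^2 = x^3 + d has x = 0, hence y^2 = d, so a nonsquare d leaves
  none.\<close>

lemma trivial_of_nonsquare:
  fixes d :: int
  assumes K: "quadratic_field TYPE('k::field_char_0)" and d: "d = 3 \<or> d = 5"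
    and nsq: "\<nexists>u::'k. u ^ 2 = of_int d"
  shows "appears_as_torsion_group TYPE('k) (integer_mod_group 1)"
proof -
  obtain v :: "'k \<Rightarrow> int" where "quadratic_valuation 2 v"
    using exists_quadratic_valuation[OF K, of 2] by auto
  then interpret quadratic_valuation 2 v .
  \<comment> \<open>The only cubes modulo 7 are 0, 1 and -1.\<close>
  have d7: "\<forall>r\<in>set [0..7 - 1]. \<not> (7::int) dvd r ^ 3 + 0 * r ^ 2 + 0 * r + (- 8 * d)"
    "\<forall>r\<in>set [0..7 - 1]. \<not> (7::int) dvd r ^ 3 + 0 * r ^ 2 + 0 * r + d"
    by (rule disjE[OF d]; hypsubst; code_simp)+
  have root: "x ^ 3 + of_int d \<noteq> 0" "x ^ 3 \<noteq> of_int (8 * d)" for x :: 'k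
    using no_cubic_root[OF K d7(1), of x] no_cubic_root[OF K d7(2), of x] by simp_all
  interpret mordell_curve v "of_int d" d
  proof unfold_locales
    show "discriminant (Weierstrass 0 0 0 0 (of_int d :: 'k)) \<noteq> 0" using d by (auto simp: Let_def)
    show "odd d" using d by auto
    show "x ^ 3 \<noteq> of_int (8 * d)" for x :: 'k by (rule root)
  qed simp_all
  have "torsion_subgroup G \<cong> integer_mod_group 1"
  proof (rule cyclic_torsion[of Point_At_Infinity 1 2])
    show "grp.ord Point_At_Infinity = 1" using grp.ord_eq_1[of Point_At_Infinity] by (simp add: G_simps)
    show "R \<in> grp.gen2 Point_At_Infinity Point_At_Infinity" if R: "cotorsion 2 R" for R
    proof (cases R)
      case (Affine x y)
      then have "x = 0" using mordell_odd_torsion R by blast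
      then have "y ^ 2 = of_int d" using cotorsion_on[OF R] Affine by simp
      then show ?thesis using nsq by blast
    qed (use gen2_mem[of Point_At_Infinity Point_At_Infinity] in simp)
    have E2: "R = Point_At_Infinity" if "on_curve E R" "R [^]\<^bsub>G\<^esub> (2::nat) = Point_At_Infinity" for R
      using pow_2_eq_infinity[OF that] root(1) by auto
    show "R \<in> grp.gen2 Point_At_Infinity Point_At_Infinity"
      if "on_curve E R" "R [^]\<^bsub>G\<^esub> (2::nat) = Point_At_Infinity" for R
      using E2[OF that] gen2_mem[of Point_At_Infinity Point_At_Infinity] by simp
    show "(\<forall>R. on_curve E R \<longrightarrow> R [^]\<^bsub>G\<^esub> (2::nat) \<noteq> Point_At_Infinity) \<or>
      (\<forall>R. on_curve E R \<longrightarrow> R [^]\<^bsub>G\<^esub> (2::nat) = Point_At_Infinity \<longrightarrow> R = Point_At_Infinity)"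
      using E2 by blast
  qed simp_all
  then show ?thesis by (rule appears_of_iso)
qed

lemma appears_1:
  assumes K: "quadratic_field TYPE('k::field_char_0)"
  shows "appears_as_torsion_group TYPE('k) (integer_mod_group 1)"
proof -
  have "(\<nexists>u::'k. u ^ 2 = of_int 3) \<or> (\<nexists>u::'k. u ^ 2 = of_int 5)"
    by (rule nonsquare_pair[OF K])
      (use not_int_square[of 3 1] not_int_square[of 5 2] not_int_square[of 15 3] in simp_all)
  then show ?thesis using trivial_of_nonsquare[OF K, of 3] trivial_of_nonsquare[OF K, of 5] by blast
qed

text \<open>With d = 9 = 3^2 the points with x = 0 are rational over every field and form the whole
  odd torsion.\<close>

lemma appears_3:
  assumes K: "quadratic_field TYPE('k::field_char_0)"
  shows "appears_as_torsion_group TYPE('k) (integer_mod_group 3)"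
proof -
  obtain v :: "'k \<Rightarrow> int" where "quadratic_valuation 2 v"
    using exists_quadratic_valuation[OF K, of 2] by auto
  then interpret quadratic_valuation 2 v .
  have d7: "\<forall>r\<in>set [0..7 - 1]. \<not> (7::int) dvd r ^ 3 + 0 * r ^ 2 + 0 * r + (- 72)"
    "\<forall>r\<in>set [0..7 - 1]. \<not> (7::int) dvd r ^ 3 + 0 * r ^ 2 + 0 * r + 9"
    by code_simp+
  have root: "x ^ 3 + 9 \<noteq> 0" "x ^ 3 \<noteq> 72" for x :: 'k
    using no_cubic_root[OF K d7(1), of x] no_cubic_root[OF K d7(2), of x] by simp_all
  interpret mordell_curve v 9 9
  proof unfold_locales
    show "discriminant (Weierstrass 0 0 0 0 (9 :: 'k)) \<noteq> 0" by (simp add: Let_def)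
    show "x ^ 3 \<noteq> of_int (8 * 9)" for x :: 'k using root(2)[of x] by simp
  qed simp_all
  define P where "P = Affine 0 (3 :: 'k)"
  have on: "on_curve E P" by (simp add: P_def)
  have P0: "P \<noteq> Point_At_Infinity" by (simp add: P_def)
  have m: "multiples P P [Affine 0 (- 3)]" by (simp add: P_def Let_def)
  note mem = multiples_ord(2)[OF on P0 m] gen2_mem[OF on, of Point_At_Infinity]
  have "torsion_subgroup G \<cong> integer_mod_group 3"
  proof (rule cyclic_torsion[OF on _ _ two_is_prime_nat])
    show "grp.ord P = 3" "(0::nat) < 3" using multiples_ord(1)[OF on P0 m] by simp_all
    show "R \<in> grp.gen2 P Point_At_Infinity" if R: "cotorsion 2 R" for R
    proof (cases R)
      case (Affine x y)
      then have x: "x = 0" using mordell_odd_torsion R by blast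
      then have "y ^ 2 = 3 ^ 2" using cotorsion_on[OF R] Affine by simp
      then have "y = 3 \<or> y = - 3" by (simp only: power2_eq_iff)
      then show ?thesis using mem Affine x by (auto simp: P_def)
    qed (use mem in simp)
    have E2: "R = Point_At_Infinity" if "on_curve E R" "R [^]\<^bsub>G\<^esub> (2::nat) = Point_At_Infinity" for R
      using pow_2_eq_infinity[OF that] root(1) by auto
    show "R \<in> grp.gen2 P Point_At_Infinity"
      if "on_curve E R" "R [^]\<^bsub>G\<^esub> (2::nat) = Point_At_Infinity" for R
      using E2[OF that] mem by simp
    show "(\<forall>R. on_curve E R \<longrightarrow> R [^]\<^bsub>G\<^esub> (2::nat) \<noteq> P) \<or>
      (\<forall>R. on_curve E R \<longrightarrow> R [^]\<^bsub>G\<^esub> (2::nat) = Point_At_Infinity \<longrightarrow> R = Point_At_Infinity)"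
      using E2 by blast
  qed
  then show ?thesis by (rule appears_of_iso)
qed

text \<open>This is the modular curve X_1(11). Its reduction at 2 is supersingular and the
  coefficient of x^2 is even, so \<open>two_adic_curve\<close> does not apply.\<close>

locale curve_with_5_torsion = quadratic_valuation "2::int" v + short_weierstrass a b c
  for v :: "'k::field_char_0 \<Rightarrow> int" and a b c :: 'k +
  assumes abc: "a = - 4" "b = 0" "c = 16"
begin

lemma even_vge: "vge x 0 \<Longrightarrow> vge (2 * x) 1"
  using vge_dvd[of 2 x 1] by simp

lemma v4: "vge 4 4"
  using vge_intI[of 2 4 4] by simp

definition num :: "'k \<Rightarrow> 'k" where "num X = X ^ 4 + (- 2 * X + 1)"
definition den :: "'k \<Rightarrow> 'k" where "den X = 4 * X ^ 3 - 4 * X ^ 2 + 1"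

lemma double_scaled:
  assumes T: "cotorsion 2 (Affine (4 * X) y)"
  shows "den X \<noteq> 0" "\<exists>y'. Affine (4 * X) y [^]\<^bsub>G\<^esub> (2::nat) = Affine (4 * (num X / den X)) y'"
proof -
  have on: "on_curve E (Affine (4 * X) y)" using T cotorsion_on by blast
  have y: "y \<noteq> 0"
  proof
    assume "y = 0"
    then have "Affine (4 * X) y [^]\<^bsub>G\<^esub> (2::nat) = Point_At_Infinity" using pow_2[OF on] by simp
    then show False using cotorsion_pow_eq_infinity T by blast
  qed
  have F: "F (4 * X) = 16 * den X" by (simp add: den_def abc algebra_simps power2_eq_square power3_eq_cube)
  then show "den X \<noteq> 0" using on y by auto
  have n: "((4 * X) ^ 2 - b) ^ 2 - 4 * c * (2 * (4 * X) + a) = 256 * num X"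
    by (simp add: num_def abc algebra_simps power2_eq_square power4_eq_xxxx)
  have "y ^ 2 = F (4 * X)" using on by simp
  then obtain y' where "ec_add E (Affine (4 * X) y) (Affine (4 * X) y) = Affine (256 * num X / (4 * (16 * den X))) y'"
    using double[of y "4 * X"] y unfolding n F by blast
  moreover have "256 * num X / (4 * (16 * den X)) = 4 * (num X / den X)" by simp
  ultimately show "\<exists>y'. Affine (4 * X) y [^]\<^bsub>G\<^esub> (2::nat) = Affine (4 * (num X / den X)) y'"
    unfolding pow_2[OF on] by metis
qed

lemma odd_torsion_integral:
  assumes "cotorsion 2 (Affine (4 * X) y)"
  shows "vge X 0"
proof (rule ccontr)
  assume "\<not> vge X 0"
  define Z where "Z P \<longleftrightarrow> (\<exists>X y. P = Affine (4 * X) y \<and> \<not> vge X 0)" for P :: "'k ec_point"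
  define f where "f P = (case P of Point_At_Infinity \<Rightarrow> 0 | Affine x y \<Rightarrow> v (x / 4))" for P
  have step: "Z (P [^]\<^bsub>G\<^esub> (2::nat)) \<and> f (P [^]\<^bsub>G\<^esub> (2::nat)) < f P"
    if P: "cotorsion 2 P" "Z P" for P
  proof -
    obtain X y where X: "P = Affine (4 * X) y" "\<not> vge X 0" using P(2) by (auto simp: Z_def)
    have T: "cotorsion 2 (Affine (4 * X) y)" using P X by simp
    obtain n where n: "n < 0" "veq X n" using X(2) not_vge by blast
    have vX: "vge X n" using n veq_vge by blast
    have "vge (- 2 * X + 1) n"
      using n(1) vge_mult[OF vge_int vX, of n "- 2"] by (intro vge_add vge_mono[OF vge_numeral(2)]) simp_all
    then have "veq (num X) (4 * n)"
      unfolding num_def using n(1) by (intro veq_add[OF veq_power[OF n(2)]]) auto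
    moreover have "vge (den X) (min (4 + 3 * n) 0)"
      unfolding den_def using n(1) by (intro vge_add vge_diff vge_monom[OF v4 vX] vge_mono[OF vge_numeral(2)]) auto
    then obtain d where d: "veq (den X) d" "d \<ge> min (4 + 3 * n) 0"
      using double_scaled(1)[OF T] by (auto simp: vge_def veq_def)
    ultimately have e: "veq (num X / den X) (4 * n - d)" by (intro veq_divide) auto
    have less: "4 * n - d < n" using d(2) n(1) by (auto simp: min_def split: if_splits)
    obtain y' where y': "P [^]\<^bsub>G\<^esub> (2::nat) = Affine (4 * (num X / den X)) y'"
      using double_scaled(2)[OF T] X(1) by blast
    have "\<not> vge (num X / den X) 0" using e less n(1) not_vge by (metis less_trans)
    then have "Z (P [^]\<^bsub>G\<^esub> (2::nat))" unfolding Z_def y' by blast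
    moreover have "f (P [^]\<^bsub>G\<^esub> (2::nat)) = 4 * n - d" unfolding y' using e by (simp add: f_def veq_def)
    moreover have "f P = n" using n(2) by (simp add: X(1) f_def veq_def)
    ultimately show ?thesis using less by simp
  qed
  have "Z (Affine (4 * X) y)" using \<open>\<not> vge X 0\<close> by (auto simp: Z_def)
  then show False
    using cotorsion_descent[of 2 "Affine (4 * X) y" Z f] step assms by blast
qed

text \<open>With \<open>x = 4 X\<close> and \<open>y = 8 Y + 4\<close> the curve becomes \<open>Y^2 + Y = X^3 - X^2\<close>, whose affine points
  over the field with four elements have \<open>X \<in> {0, 1}\<close>.\<close>

lemma residue_X:
  assumes "cotorsion 2 (Affine (4 * X) y)"
  shows "vge X 1 \<or> vge (X - 1) 1"
proof -
  have X: "vge X 0" by (rule odd_torsion_integral[OF assms])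
  have on: "y ^ 2 = F (4 * X)" using cotorsion_on[OF assms] by simp
  define Y where "Y = (y - 4) / 8"
  have y: "y = 8 * Y + 4" by (simp add: Y_def field_simps)
  have "64 * (Y ^ 2 + Y) = 64 * (X ^ 3 - X ^ 2)"
    using on unfolding y by (simp add: abc algebra_simps power2_eq_square power3_eq_cube)
  then have eq: "Y ^ 2 + Y = X ^ 3 - X ^ 2" by (simp only: mult_left_cancel[OF zero_neq_numeral[symmetric]])
  have Y: "vge Y 0"
  proof (rule ccontr)
    assume "\<not> vge Y 0"
    then obtain n where n: "n < 0" "veq Y n" using not_vge by blast
    then have "veq (Y ^ 2 + Y) (2 * n)" by (intro veq_add[OF veq_power[OF n(2)] veq_vge[OF n(2) order_refl]]) auto
    moreover have "vge (Y ^ 2 + Y) 0" unfolding eq using X by (intro integral_intros)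
    ultimately show False using n(1) vge_veq_unique by fastforce
  qed
  have one: "\<not> vge 1 1" by (simp add: vge_def)
  have *: "vge X 1 \<or> vge (X - 1) 1" if "vge (Y * (Y + 1)) 1"
  proof -
    have "X ^ 2 * (X - 1) = Y * (Y + 1)" using eq by (simp add: algebra_simps power2_eq_square power3_eq_cube)
    then have "vge (X ^ 2) 1 \<or> vge (X - 1) 1"
      using that X by (intro vge_prod_1) (auto intro: integral_intros)
    then show ?thesis using vge_power_1[OF _ X] by auto
  qed
  consider "vge Y 1" | "vge (Y - 1) 1" | "vge (Y ^ 2 - Y - 1) 1" using residue2[OF refl Y] by blast
  then show ?thesis
  proof cases
    case 1
    then have "vge (Y * (Y + 1)) 1" using Y by (intro vge_mult_left) (auto intro: integral_intros)
    then show ?thesis by (rule *)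
  next
    case 2
    have "Y + 1 = (Y - 1) + 2 * 1" by simp
    then have "vge (Y + 1) 1" using vge_add[OF 2 even_vge[OF vge_numeral(2)]] by metis
    then have "vge ((Y + 1) * Y) 1" using Y by (rule vge_mult_left)
    then show ?thesis using * by (simp only: mult.commute)
  next
    \<comment> \<open>Y would be a primitive cube root of unity, so that X^3 - X^2 = 1; no element
      of the field with four elements satisfies this.\<close>
    case 3
    have "X ^ 3 - X ^ 2 - 1 = (Y ^ 2 - Y - 1) + 2 * Y" unfolding eq[symmetric] by simp
    then have c: "vge (X ^ 3 - X ^ 2 - 1) 1" using vge_add[OF 3 even_vge[OF Y]] by metis
    have "\<not> vge (X ^ 2 - X - 1) 1"
    proof
      assume d: "vge (X ^ 2 - X - 1) 1"
      have "X - 1 = (X ^ 3 - X ^ 2 - 1) - (X ^ 2 - X - 1) * X"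
        by (simp add: algebra_simps power2_eq_square power3_eq_cube)
      then have e: "vge (X - 1) 1" using vge_diff[OF c vge_mult_left[OF d X]] by metis
      have "1 = (X - 1) * X - (X ^ 2 - X - 1)" by (simp add: algebra_simps power2_eq_square)
      then have "vge 1 1" using vge_diff[OF vge_mult_left[OF e X] d] by metis
      then show False using one by simp
    qed
    then show ?thesis using residue2[OF refl X] by blast
  qed
qed

text \<open>On this curve the numerator of the sum formula is 1 modulo 2, so the argument works for
  every residue of X, including 0.\<close>

lemma congruent_odd_torsion:
  assumes T: "cotorsion 2 (Affine (4 * X1) y1)" "cotorsion 2 (Affine (4 * X2) y2)" and x: "vge (X1 - X2) 1"
  shows "Affine (4 * X1) y1 = Affine (4 * X2) y2 \<or> Affine (4 * X1) y1 = neg (Affine (4 * X2) y2)"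
proof -
  have on: "y1 ^ 2 = F (4 * X1)" "y2 ^ 2 = F (4 * X2)" using cotorsion_on[OF T(1)] cotorsion_on[OF T(2)] by simp_all
  show ?thesis
  proof (cases "X1 = X2")
    case True
    then show ?thesis using equal_x cotorsion_on[OF T(1)] cotorsion_on[OF T(2)] by blast
  next
    case False
    then have ne: "4 * X1 \<noteq> 4 * X2" by simp
    obtain s w t w' where s: "ec_add E (Affine (4 * X1) y1) (Affine (4 * X2) y2) = Affine s w"
      "ec_add E (Affine (4 * X1) y1) (neg (Affine (4 * X2) y2)) = Affine t w'"
      "(s + t) * (4 * X1 - 4 * X2) ^ 2 = 2 * (4 * X1) * (4 * X2) * (4 * X1 + 4 * X2) + 4 * a * (4 * X1) * (4 * X2)
         + 2 * b * (4 * X1 + 4 * X2) + 4 * c"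
      using sum_difference[OF on ne] by metis
    define S R where "S = s / 4" and "R = t / 4"
    have st: "s = 4 * S" "t = 4 * R" by (simp_all add: S_def R_def)
    have "64 * ((S + R) * (X1 - X2) ^ 2) = 64 * (1 + 2 * (X1 * X2 * (X1 + X2) - 2 * X1 * X2))"
      using s(3) unfolding st abc by (simp add: algebra_simps power2_eq_square)
    then have eq: "(S + R) * (X1 - X2) ^ 2 = 1 + 2 * (X1 * X2 * (X1 + X2) - 2 * X1 * X2)"
      by (simp only: mult_left_cancel[OF zero_neq_numeral[symmetric]])
    have "vge S 0" using odd_torsion_integral cotorsion_add[OF T] unfolding s(1) st .
    moreover have "vge R 0" using odd_torsion_integral cotorsion_add[OF T(1) cotorsion_neg[OF T(2)]] unfolding s(2) st .
    ultimately have "vge ((S + R) * (X1 - X2) ^ 2) 1" using x by (intro vge_monom[OF vge_add]) auto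
    moreover have "veq ((S + R) * (X1 - X2) ^ 2) 0"
      unfolding eq using odd_torsion_integral[OF T(1)] odd_torsion_integral[OF T(2)]
      by (intro veq_add[OF veq_unit[of 1, simplified] even_vge] integral_intros) auto
    ultimately show ?thesis using vge_veq_unique by fastforce
  qed
qed

end

lemma appears_5:
  assumes K: "quadratic_field TYPE('k::field_char_0)"
  shows "appears_as_torsion_group TYPE('k) (integer_mod_group 5)"
proof -
  obtain v :: "'k \<Rightarrow> int" where "quadratic_valuation 2 v"
    using exists_quadratic_valuation[OF K, of 2] by auto
  then interpret quadratic_valuation 2 v .
  have d3: "\<forall>r\<in>set [0..3 - 1]. \<not> (3::int) dvd r ^ 3 + (- 4) * r ^ 2 + 0 * r + 16"
    by code_simp
  have root: "x ^ 3 - 4 * x ^ 2 + 16 \<noteq> 0" for x :: 'k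
    using no_cubic_root[OF K d3, of x] by simp
  interpret curve_with_5_torsion v "- 4" 0 16
    by unfold_locales (simp_all add: Let_def)
  define P where "P = Affine 0 (4 :: 'k)"
  have on: "on_curve E P" by (simp add: P_def)
  have P0: "P \<noteq> Point_At_Infinity" by (simp add: P_def)
  have m: "multiples P P [Affine 4 (- 4), Affine 4 4, Affine 0 (- 4)]" by (simp add: P_def Let_def)
  note mem = multiples_ord(2)[OF on P0 m] gen2_mem[OF on, of Point_At_Infinity]
  have "P [^]\<^bsub>G\<^esub> (5::nat) = Point_At_Infinity" using multiples_ord(3)[OF on P0 m] by (simp add: numeral_eq_Suc)
  then have TP: "cotorsion 2 P" using cotorsionI[OF on, of 5 2] by simp
  have "P [^]\<^bsub>G\<^esub> (2::nat) = Affine 4 (- 4)" using multiples_ord(4)[OF on P0 m, of 0] by (simp add: numeral_2_eq_2)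
  then have TQ: "cotorsion 2 (Affine 4 (- 4))" using cotorsion_pow[OF TP, of 2] by simp
  have "torsion_subgroup G \<cong> integer_mod_group 5"
  proof (rule cyclic_torsion[OF on _ _ two_is_prime_nat])
    show "grp.ord P = 5" "(0::nat) < 5" using multiples_ord(1)[OF on P0 m] by simp_all
    show "R \<in> grp.gen2 P Point_At_Infinity" if R: "cotorsion 2 R" for R
    proof (cases R)
      case (Affine x y)
      have T: "cotorsion 2 (Affine (4 * (x / 4)) y)" using R Affine by simp
      have "Affine x y = P \<or> Affine x y = neg P" if "vge (x / 4) 1"
        using congruent_odd_torsion[OF T, of 0 4] TP that by (simp add: P_def)
      moreover have "Affine x y = Affine 4 (- 4) \<or> Affine x y = neg (Affine 4 (- 4))" if "vge (x / 4 - 1) 1"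
        using congruent_odd_torsion[OF T, of 1 "- 4"] TQ that by simp
      ultimately show ?thesis using residue_X[OF T] mem Affine by (auto simp: P_def)
    qed (use mem in simp)
    have E2: "R = Point_At_Infinity" if "on_curve E R" "R [^]\<^bsub>G\<^esub> (2::nat) = Point_At_Infinity" for R
      using pow_2_eq_infinity[OF that] root by auto
    show "R \<in> grp.gen2 P Point_At_Infinity"
      if "on_curve E R" "R [^]\<^bsub>G\<^esub> (2::nat) = Point_At_Infinity" for R
      using E2[OF that] mem by simp
    show "(\<forall>R. on_curve E R \<longrightarrow> R [^]\<^bsub>G\<^esub> (2::nat) \<noteq> P) \<or>
      (\<forall>R. on_curve E R \<longrightarrow> R [^]\<^bsub>G\<^esub> (2::nat) = Point_At_Infinity \<longrightarrow> R = Point_At_Infinity)"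
      using E2 by blast
  qed
  then show ?thesis by (rule appears_of_iso)
qed

text \<open>The residue of x is in the prime field or is a root of z^2 - s z - t, whose other root
  is s - x. Cubing is additive modulo 3, so it permutes these roots and its square fixes x.\<close>

lemma (in quadratic_valuation) frobenius_square_3:
  assumes p3: "p = 3" and x: "vge x 0"
  shows "vge (x ^ 9 - x) 1"
proof -
  have 3: "vge (3 * z) 1" if "vge z 0" for z
    using vge_dvd[of 3 z 1] p3 that by simp
  have cube: "vge (y ^ 3 - z ^ 3) 1" if "vge (y - z) 1" "vge y 0" "vge z 0" for y z
  proof -
    have "y ^ 3 - z ^ 3 = (y - z) * (y ^ 2 + y * z + z ^ 2)" by (simp add: algebra_simps power2_eq_square power3_eq_cube)
    moreover have "vge (y ^ 2 + y * z + z ^ 2) 0" using that by (intro integral_intros)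
    ultimately show ?thesis using vge_mult_left[OF that(1)] by metis
  qed
  have fermat: "vge (of_int s ^ 3 - of_int s) 1" if "s \<in> {0..<p}" for s
  proof -
    have "s = 0 \<or> s = 1 \<or> s = 2" using that p3 by auto
    then show ?thesis using 3[of 2] by auto
  qed
  have x3: "vge (x ^ 3) 0" using x by (rule vge_power0)
  have conj: "vge (x ^ 3 - x) 1 \<or> (\<exists>s \<in> {0..<p}. vge (x ^ 3 - (of_int s - x)) 1)"
    using x
  proof (cases rule: residue_cases)
    case (1 r)
    have "x ^ 3 - x = (x ^ 3 - of_int r ^ 3) + (of_int r ^ 3 - of_int r) - (x - of_int r)" by simp
    then have "vge (x ^ 3 - x) 1"
      using vge_diff[OF vge_add[OF cube[OF 1(2) x vge_int] fermat[OF 1(1)]] 1(2)] by metis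
    then show ?thesis by simp
  next
    case (2 s t)
    define l where "l = of_int s * x + of_int t"
    have l: "vge l 0" unfolding l_def using x by (intro integral_intros)
    \<comment> \<open>Modulo 3 the left-hand side is the value of z^2 - s z - t at x^3, which is the
      cube of its value at x.\<close>
    have "(x ^ 3 - x) * (x ^ 3 - (of_int s - x)) = ((x ^ 2) ^ 3 - l ^ 3) + (of_int s ^ 3 - of_int s) * x ^ 3
      + (of_int t ^ 3 - of_int t) + 3 * (of_int s * of_int t * x * l) - (x ^ 2 - l)"
      unfolding l_def by (simp add: algebra_simps power2_eq_square power3_eq_cube)
    moreover have "vge \<dots> 1"
    proof (rule vge_diff[OF vge_add[OF vge_add[OF vge_add]]])
      show e: "vge (x ^ 2 - l) 1" using 2(3) by (simp only: l_def)
      show "vge ((x ^ 2) ^ 3 - l ^ 3) 1" using x l by (intro cube e integral_intros)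
      show "vge ((of_int s ^ 3 - of_int s) * x ^ 3) 1" by (rule vge_mult_left[OF fermat[OF 2(1)] x3])
      show "vge (of_int t ^ 3 - of_int t) 1" by (rule fermat[OF 2(2)])
      show "vge (3 * (of_int s * of_int t * x * l)) 1" using x l by (intro 3 integral_intros)
    qed
    ultimately have "vge ((x ^ 3 - x) * (x ^ 3 - (of_int s - x))) 1" by simp
    then have "vge (x ^ 3 - x) 1 \<or> vge (x ^ 3 - (of_int s - x)) 1"
      using x x3 by (intro vge_prod_1 integral_intros)
    then show ?thesis using 2(1) by blast
  qed
  then show ?thesis
  proof (elim disjE bexE)
    assume a: "vge (x ^ 3 - x) 1"
    have "x ^ 9 - x = ((x ^ 3) ^ 3 - x ^ 3) + (x ^ 3 - x)" by simp
    then show ?thesis using vge_add[OF cube[OF a x3 x] a] by metis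
  next
    fix s assume s: "s \<in> {0..<p}" and a: "vge (x ^ 3 - (of_int s - x)) 1"
    have "x ^ 9 - x = ((x ^ 3) ^ 3 - (of_int s - x) ^ 3) + (of_int s ^ 3 - of_int s)
      - 3 * (of_int s * x * (of_int s - x)) - (x ^ 3 - (of_int s - x))"
      by (simp add: algebra_simps eval_nat_numeral)
    moreover have "vge \<dots> 1"
    proof (rule vge_diff[OF vge_diff[OF vge_add]])
      show "vge ((x ^ 3) ^ 3 - (of_int s - x) ^ 3) 1" using x by (intro cube a integral_intros)
      show "vge (of_int s ^ 3 - of_int s) 1" by (rule fermat[OF s])
      show "vge (3 * (of_int s * x * (of_int s - x))) 1" using x by (intro 3 integral_intros)
      show "vge (x ^ 3 - (of_int s - x)) 1" by (rule a)
    qed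
    ultimately show ?thesis by (simp only:)
  qed
qed

section \<open>Orders 7 and 9: tripling and valuations above 3\<close>

locale triadic_curve = integral_curve "3::int" v a b c
  for v :: "'k::field_char_0 \<Rightarrow> int" and a b c :: 'k
begin

lemma v8: "veq 8 0"
  using veq_unit[of 8] by simp

text \<open>The leading terms dominate \<open>F\<close> and \<open>h6\<close>, so
  \<open>phi3\<close> has valuation 9 n. The leading coefficient 3 of \<open>psi3\<close>
  contributes the extra 2, and 9 n - 2 (2 + 4 n) = n - 4. Taking e = 1 extends the argument to n =
  0.\<close>

lemma triple_valuation:
  assumes e: "0 \<le> e" "vge a e" "vge b e" "vge c e" and x: "veq x n" "n \<le> 0" "n < e"
    and psi: "vge (psi3 x) (2 + 4 * n)" "psi3 x \<noteq> 0"
  shows "\<exists>m \<le> n - 4. veq (phi3 x / psi3 x ^ 2) m"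
proof -
  have vx: "vge x n" using x veq_vge by blast
  have r: "vge (z * w) e" if "vge z 0" "vge w e" for z w using vge_mult[OF that] by simp
  have sq: "vge (b ^ 2) e" "vge (b ^ 3) e" "vge (c ^ 2) e"
    using e by (intro vge_power[OF e(3)] vge_power[OF e(4)]; simp)+
  have F: "veq (F x) (3 * n)"
  proof -
    have "vge (a * x ^ 2 + b * x ^ 1 + c) (3 * n + 1)"
      using x e by (intro vge_add vge_monom[OF e(2) vx] vge_monom[OF e(3) vx] vge_mono[OF e(4)]) auto
    then show ?thesis using veq_add[OF veq_power[OF x(1), of "3 * n" 3]] by (simp add: add.assoc)
  qed
  have h: "veq (h6 x) (6 * n)"
  proof -
    have quadratic: "vge (20 * a * c) e" "vge (8 * a ^ 2 * c) e" "vge (2 * a * b ^ 2) e" "vge (4 * b * c) e"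
      "vge (4 * a * b * c) e" "vge (5 * b ^ 2) e" "vge (8 * c ^ 2) e"
      by (intro r[OF _ e(4)] r[OF _ sq(1)] r[OF _ sq(3)] integral_intros integral)+
    have coeffs: "vge (2 * a) e" "vge (5 * b) e" "vge (20 * c) e" "vge (20 * a * c - 5 * b ^ 2) e"
      "vge (8 * a ^ 2 * c - 2 * a * b ^ 2 - 4 * b * c) e" "vge (4 * a * b * c - b ^ 3 - 8 * c ^ 2) e"
      by (intro vge_diff quadratic sq(2) r[OF _ e(2)] r[OF _ e(3)] r[OF _ e(4)] vge_numeral)+
    have "vge (2 * a * x ^ 5 + 5 * b * x ^ 4 + 20 * c * x ^ 3
     + (20 * a * c - 5 * b ^ 2) * x ^ 2 + (8 * a ^ 2 * c - 2 * a * b ^ 2 - 4 * b * c) * x ^ 1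
     + (4 * a * b * c - b ^ 3 - 8 * c ^ 2)) (6 * n + 1)"
      using x e(1)
      by (intro vge_add vge_monom[OF coeffs(1) vx] vge_monom[OF coeffs(2) vx] vge_monom[OF coeffs(3) vx]
          vge_monom[OF coeffs(4) vx] vge_monom[OF coeffs(5) vx] vge_mono[OF coeffs(6)]) auto
    then show ?thesis unfolding h6_def using veq_add[OF veq_power[OF x(1), of "6 * n" 6]] by simp
  qed
  have "veq (8 * (F x * h6 x)) (9 * n)" using veq_mult[OF v8 veq_mult[OF F h refl] refl] by simp
  moreover have "vge (x * psi3 x ^ 2) (9 * n + 4)" by (rule vge_monom[OF vx psi(1)]) simp
  ultimately have "veq (- (8 * (F x * h6 x)) + x * psi3 x ^ 2) (9 * n)" by (intro veq_add) auto
  then have num: "veq (phi3 x) (9 * n)" by (simp only: phi3_def mult.assoc uminus_add_conv_diff)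
  obtain k where k: "veq (psi3 x) k" "k \<ge> 2 + 4 * n" using psi by (auto simp: vge_def veq_def)
  have "veq (phi3 x / psi3 x ^ 2) (9 * n - 2 * k)" using k by (intro veq_divide[OF num veq_power]) auto
  moreover have "9 * n - 2 * k \<le> n - 4" using k(2) by simp
  ultimately show ?thesis by blast
qed

text \<open>With e = 0 the conclusion is integrality. With e = 1, for a cuspidal reduction, it says
  that x reduces to the cusp 0.\<close>

lemma triple_descent:
  assumes e: "0 \<le> e" "e \<le> 1" "vge a e" "vge b e" "vge c e"
    and psi: "\<And>x y n. cotorsion 3 (Affine x y) \<Longrightarrow> psi3 x \<noteq> 0"
      "\<And>x n. veq x n \<Longrightarrow> n < e \<Longrightarrow> vge (psi3 x) (2 + 4 * n)"
    and T: "cotorsion 3 (Affine x y)"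
  shows "vge x e"
proof (rule ccontr)
  assume x: "\<not> vge x e"
  define Z where "Z P \<longleftrightarrow> (\<exists>x y. P = Affine x y \<and> \<not> vge x e)" for P :: "'k ec_point"
  define f where "f P = (case P of Point_At_Infinity \<Rightarrow> 0 | Affine x y \<Rightarrow> v x)" for P
  have step: "Z (P [^]\<^bsub>G\<^esub> (3::nat)) \<and> f (P [^]\<^bsub>G\<^esub> (3::nat)) < f P"
    if P: "cotorsion 3 P" "Z P" for P
  proof -
    obtain x y where X: "P = Affine x y" "\<not> vge x e" using P(2) by (auto simp: Z_def)
    obtain n where n: "n < e" "veq x n" using X(2) not_vge by blast
    have T: "cotorsion 3 (Affine x y)" using P X by simp
    have on: "on_curve E (Affine x y)" "y ^ 2 = F x" using cotorsion_on[OF T] by simp_all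
    have nz: "psi3 x \<noteq> 0" by (rule psi(1)[OF T])
    have "n \<le> 0" using n e(2) by simp
    then obtain m where m: "m \<le> n - 4" "veq (phi3 x / psi3 x ^ 2) m"
      using triple_valuation[OF e(1,3-5) n(2) _ n(1) psi(2)[OF n(2,1)] nz] by blast
    obtain y' where y': "P [^]\<^bsub>G\<^esub> (3::nat) = Affine (phi3 x / psi3 x ^ 2) y'"
      using triple[OF on(2) nz] pow_3[OF on(1)] X(1) by metis
    have "\<not> vge (phi3 x / psi3 x ^ 2) e" using m n(1) vge_veq_unique by fastforce
    then have "Z (P [^]\<^bsub>G\<^esub> (3::nat))" unfolding Z_def y' by blast
    moreover have "f (P [^]\<^bsub>G\<^esub> (3::nat)) = m" unfolding y' using m by (simp add: f_def veq_def)
    moreover have "f P = n" using n(2) by (simp add: X(1) f_def veq_def)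
    ultimately show ?thesis using m by simp
  qed
  have "Z (Affine x y)" using x by (auto simp: Z_def)
  then show False using cotorsion_descent[of 3 "Affine x y" Z f] step T by blast
qed

end

text \<open>This curve has conductor 26: its reduction is bad at 2 but good, in fact supersingular,
  at 3, so the prime 3 is used.\<close>

locale curve_with_7_torsion = triadic_curve v a b c
  for v :: "'k::field_char_0 \<Rightarrow> int" and a b c :: 'k +
  assumes abc: "a = - 15" "b = 32" "c = 256"
begin

lemma psi3_eq: "psi3 x = of_int (- 16384) + of_int 3 * (x ^ 4 - 20 * x ^ 3 + 64 * x ^ 2 + 1024 * x)"
  unfolding psi3_def by (simp add: abc)

text \<open>All coefficients of \<open>psi3\<close> except the constant -2^14 are divisible by 3,
  which reflects the supersingular reduction. So \<open>psi3\<close> is a unit at integral x, and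
  for negative valuation the leading term dominates.\<close>

lemma psi3_valuation:
  shows "vge x 0 \<Longrightarrow> veq (psi3 x) 0" "veq x n \<Longrightarrow> n < 0 \<Longrightarrow> veq (psi3 x) (2 + 4 * n)"
proof -
  assume x: "vge x 0"
  then have "vge (of_int 3 * (x ^ 4 - 20 * x ^ 3 + 64 * x ^ 2 + 1024 * x)) 1"
    by (intro vge_dvd integral_intros) auto
  then show "veq (psi3 x) 0" unfolding psi3_eq by (intro veq_add[OF veq_unit]) auto
next
  assume x: "veq x n" "n < 0"
  have vx: "vge x n" using x veq_vge by blast
  have "vge (of_int (- 20) * x ^ 3 + of_int 64 * x ^ 2 + of_int 1024 * x ^ 1) (4 * n + 1)"
    using x by (intro vge_add vge_monom[OF vge_int vx]) auto
  then have "veq (x ^ 4 + (of_int (- 20) * x ^ 3 + of_int 64 * x ^ 2 + of_int 1024 * x ^ 1)) (4 * n)"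
    by (intro veq_add[OF veq_power[OF x(1)]]) auto
  then have "veq (x ^ 4 - 20 * x ^ 3 + 64 * x ^ 2 + 1024 * x) (4 * n)" by (simp add: algebra_simps)
  then have "veq (of_int 3 * (x ^ 4 - 20 * x ^ 3 + 64 * x ^ 2 + 1024 * x)) (2 + 4 * n)"
    by (intro veq_mult[OF veq_p]) auto
  then show "veq (psi3 x) (2 + 4 * n)" unfolding psi3_eq
    using x(2) by (intro veq_add'[OF vge_int]) auto
qed

lemma psi3_nonzero: "psi3 x \<noteq> 0"
  using psi3_valuation[of x] not_vge[of x 0] veq_nz by blast

lemma integral_x: "cotorsion 3 (Affine x y) \<Longrightarrow> vge x 0"
  by (rule triple_descent[of 0]) (use integral psi3_nonzero veq_vge[OF psi3_valuation(2)] in auto)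

text \<open>The reduction \<open>y^2 = x^3 - x + 1\<close> has no affine points over the field with nine elements apart from
  \<open>x \<in> {0, 1, 2}\<close>: the element \<open>w = x^3 - x\<close> satisfies \<open>w^3 = - w\<close>, so \<open>1 = (1 + w)^4 = 1 - w^2\<close>
  if \<open>1 + w\<close> is a nonzero square.\<close>

lemma residue_x:
  assumes "cotorsion 3 (Affine x y)"
  shows "vge x 1 \<or> vge (x - 1) 1 \<or> vge (x - 2) 1"
proof -
  have x: "vge x 0" by (rule integral_x[OF assms])
  have on: "y ^ 2 = F x" using cotorsion_on[OF assms] by simp
  have y: "vge y 0" by (rule integral_y[OF x on])
  have 3: "vge (3 * z) 1" if "vge z 0" for z
    using vge_dvd[of 3 z 1] that by simp
  define w where "w = x ^ 3 - x"
  have w: "vge w 0" unfolding w_def using x by (intro integral_intros)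
  have "w ^ 3 + w = (x ^ 9 - x) + 3 * (x ^ 5 - x ^ 7)"
    unfolding w_def by (simp add: algebra_simps eval_nat_numeral)
  moreover have "vge \<dots> 1" using x by (intro vge_add frobenius_square_3 3 integral_intros) auto
  ultimately have w3: "vge (w ^ 3 + w) 1" by simp
  define d where "d = y ^ 2 - (1 + w)"
  have d: "vge d 1"
  proof -
    have "d = 3 * (- 5 * x ^ 2 + 11 * x + 85)" unfolding d_def on w_def by (simp add: abc)
    also have "vge \<dots> 1" using x by (intro 3 integral_intros vge_minus[THEN iffD2]) auto
    finally show ?thesis .
  qed
  \<comment> \<open>Modulo 3, y = y^9 = y (1 + w)^4, and w^3 = - w gives (1 + w)^4 = 1 - w^2. Hence
    y w^2 vanishes.\<close>
  have "y * w ^ 2 = - (y ^ 9 - y) + y * ((y ^ 2) ^ 4 - (1 - w ^ 2))"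
    by (simp add: algebra_simps eval_nat_numeral)
  moreover have "vge (- (y ^ 9 - y)) 1" using frobenius_square_3[OF refl y] by (simp only: vge_minus)
  moreover have "vge (((y ^ 2) ^ 4 - (1 - w ^ 2)) * y) 1"
  proof (rule vge_mult_left[OF _ y])
    have "(y ^ 2) ^ 4 - (1 - w ^ 2) = d * (((y ^ 2) ^ 2 + (1 + w) ^ 2) * (y ^ 2 + 1 + w))
      + (w ^ 3 + w) * (1 + w) + 3 * ((w ^ 2 + w) * (1 + w))"
    unfolding d_def by (simp add: algebra_simps eval_nat_numeral)
    also have "vge \<dots> 1"
      using y w by (intro vge_add vge_mult_left[OF d] vge_mult_left[OF w3] 3 integral_intros)
    finally show "vge ((y ^ 2) ^ 4 - (1 - w ^ 2)) 1" .
  qed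
  ultimately have "vge (y * w ^ 2) 1" using vge_add by (metis mult.commute)
  then have "vge y 1 \<or> vge (w ^ 2) 1" using y w by (intro vge_prod_1 integral_intros)
  moreover have "\<not> vge y 1"
  proof
    assume "vge y 1"
    then have "vge (y ^ 2) 1" using vge_mult_left[OF _ y] by (simp add: power2_eq_square)
    then have w1: "vge (1 + w) 1" using vge_diff[OF _ d] unfolding d_def by fastforce
    have "of_int 2 = (1 + w) * (w ^ 2 - w + 2) - (w ^ 3 + w)"
      by (simp add: algebra_simps eval_nat_numeral)
    also have "vge \<dots> 1" using w by (intro vge_diff vge_mult_left[OF w1] w3 integral_intros)
    finally show False by (simp only: vge_int_1_iff) simp
  qed
  ultimately have "vge w 1" using vge_power_1[OF _ w] by auto
  moreover have "x * ((x - 1) * (x - 2)) = w + 3 * (x - x ^ 2)"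
    unfolding w_def by (simp add: algebra_simps eval_nat_numeral)
  ultimately have "vge (x * ((x - 1) * (x - 2))) 1"
    using vge_add[OF _ 3[OF vge_diff[OF x vge_power0[OF x]]]] by metis
  then have "vge x 1 \<or> vge ((x - 1) * (x - 2)) 1" using x by (intro vge_prod_1 integral_intros)
  moreover have "vge (x - 1) 1 \<or> vge (x - 2) 1" if "vge ((x - 1) * (x - 2)) 1"
    using that x by (intro vge_prod_1 integral_intros)
  ultimately show ?thesis by blast
qed

end

lemma appears_7:
  assumes K: "quadratic_field TYPE('k::field_char_0)"
  shows "appears_as_torsion_group TYPE('k) (integer_mod_group 7)"
proof -
  obtain v :: "'k \<Rightarrow> int" where "quadratic_valuation 3 v"
    using exists_quadratic_valuation[OF K, of 3] by auto
  then interpret quadratic_valuation 3 v .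
  interpret curve_with_7_torsion v "- 15" 32 256
    by unfold_locales (simp_all add: Let_def)
  define P where "P = Affine 0 (16 :: 'k)"
  have on: "on_curve E P" by (simp add: P_def)
  have P0: "P \<noteq> Point_At_Infinity" by (simp add: P_def)
  have m: "multiples P P [Affine 16 (- 32), Affine 8 8, Affine 8 (- 8), Affine 16 32, Affine 0 (- 16)]"
    by (simp add: P_def Let_def)
  note mem = multiples_ord(2)[OF on P0 m] gen2_mem[OF on, of Point_At_Infinity]
  have "P [^]\<^bsub>G\<^esub> (7::nat) = Point_At_Infinity" using multiples_ord(3)[OF on P0 m] by (simp add: numeral_eq_Suc)
  then have TP: "cotorsion 3 P" using cotorsionI[OF on, of 7 3] primes_coprime[of 7 "3::nat"] by simp
  have "P [^]\<^bsub>G\<^esub> (2::nat) = Affine 16 (- 32)" "P [^]\<^bsub>G\<^esub> (3::nat) = Affine 8 8"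
    using multiples_ord(4)[OF on P0 m, of 0] multiples_ord(4)[OF on P0 m, of 1] by (simp_all add: numeral_eq_Suc)
  then have TQ: "cotorsion 3 (Affine 16 (- 32))" "cotorsion 3 (Affine 8 8)"
    using cotorsion_pow[OF TP, of 2] cotorsion_pow[OF TP, of 3] by simp_all
  have three: "prime (3::nat)" by simp
  have "torsion_subgroup G \<cong> integer_mod_group 7"
  proof (rule cyclic_torsion[OF on _ _ three])
    show "grp.ord P = 7" "(0::nat) < 7" using multiples_ord(1)[OF on P0 m] by simp_all
    show "R \<in> grp.gen2 P Point_At_Infinity" if R: "cotorsion 3 R" for R
    proof (cases R)
      case (Affine x y)
      have T: "cotorsion 3 (Affine x y)" using R Affine by simp
      \<comment> \<open>The points P, 2 P and 3 P have abscissas 0, 16 and 8, one for each residue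
        0, 1 and 2; the values of 4 F there are powers of 2 and thus units.\<close>
      have same: "Affine x y = Affine x' y' \<or> Affine x y = neg (Affine x' y')"
        if "cotorsion 3 (Affine x' y')" "vge (x - x') 1" "veq (4 * F x') 0" for x' y'
        using congruent_cotorsion[OF _ T that] integral_x by blast
      have "Affine x y = P \<or> Affine x y = neg P" if "vge x 1"
        using same[of 0 16] TP that veq_unit[of 1024] by (simp add: P_def)
      moreover have "Affine x y = Affine 16 (- 32) \<or> Affine x y = neg (Affine 16 (- 32))" if x: "vge (x - 1) 1"
      proof -
        have "x - 16 = (x - 1) + of_int (- 15)" by simp
        then have "vge (x - 16) 1" using vge_add[OF x vge_intI[of 1 "- 15" 1]] by simp
        then show ?thesis using same[OF TQ(1)] veq_unit[of 4096] by simp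
      qed
      moreover have "Affine x y = Affine 8 8 \<or> Affine x y = neg (Affine 8 8)" if x: "vge (x - 2) 1"
      proof -
        have "x - 8 = (x - 2) + of_int (- 6)" by simp
        then have "vge (x - 8) 1" using vge_add[OF x vge_intI[of 1 "- 6" 1]] by simp
        then show ?thesis using same[OF TQ(2)] veq_unit[of 256] by simp
      qed
      ultimately show ?thesis using residue_x[OF T] mem Affine by (auto simp: P_def)
    qed (use mem in simp)
    have E3: "R = Point_At_Infinity" if "on_curve E R" "R [^]\<^bsub>G\<^esub> (3::nat) = Point_At_Infinity" for R
      using pow_3_eq_infinity that psi3_nonzero by (cases R) blast+
    show "R \<in> grp.gen2 P Point_At_Infinity"
      if "on_curve E R" "R [^]\<^bsub>G\<^esub> (3::nat) = Point_At_Infinity" for R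
      using E3[OF that] mem by simp
    show "(\<forall>R. on_curve E R \<longrightarrow> R [^]\<^bsub>G\<^esub> (3::nat) \<noteq> P) \<or>
      (\<forall>R. on_curve E R \<longrightarrow> R [^]\<^bsub>G\<^esub> (3::nat) = Point_At_Infinity \<longrightarrow> R = Point_At_Infinity)"
      using E3 by blast
  qed
  then show ?thesis by (rule appears_of_iso)
qed

text \<open>Modulo 3 the cubic is x^3, so the reduction has a cusp at x = 0. Triples never reduce to
  the cusp, whereas torsion of order prime to 3 would have to stay there. The cubic in
  \<open>no_root\<close> is the cofactor of 3 (x - 4) in \<open>psi3\<close>.\<close>

locale curve_with_9_torsion = triadic_curve v a b c
  for v :: "'k::field_char_0 \<Rightarrow> int" and a b c :: 'k +
  assumes abc: "a = - 3" "b = - 216" "c = 1872"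
    and no_root: "\<And>x::'k. x ^ 3 - 432 * x + 5760 \<noteq> 0"
begin

lemma psi3_eq:
  "psi3 x = of_int 3 * x ^ 4 + of_int (- 12) * x ^ 3 + of_int (- 1296) * x ^ 2 + of_int 22464 * x ^ 1 + of_int (- 69120)"
  unfolding psi3_def by (simp add: abc)

lemma F_eq: "F x = x ^ 3 + (of_int (- 3) * x ^ 2 + of_int (- 216) * x ^ 1) + of_int 1872"
  by (simp add: abc)

lemma h6_eq:
  "h6 x = x ^ 6 + (of_int (- 6) * x ^ 5 + of_int (- 1080) * x ^ 4 + of_int 37440 * x ^ 3
     + of_int (- 345600) * x ^ 2 + of_int 2032128 * x ^ 1) + of_int (- 13105152)"
  unfolding h6_def by (simp add: abc)

lemma coeff_valuations:
  "vge (of_int 3) 2" "vge (of_int (- 12)) 2" "vge (of_int (- 1296)) 8" "vge (of_int 22464) 6" "vge (of_int (- 69120)) 6"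
  "vge (of_int (- 3)) 2" "vge (of_int (- 216)) 6" "veq (of_int 1872) 4"
  "vge (of_int (- 6)) 2" "vge (of_int (- 1080)) 6" "vge (of_int 37440) 4" "vge (of_int (- 345600)) 6" "vge (of_int 2032128) 8"
  "veq (of_int (- 13105152)) 8"
proof -
  show "vge (of_int 3) 2" by (rule vge_intI[of 1]) simp_all
  show "vge (of_int (- 12)) 2" by (rule vge_intI[of 1]) simp_all
  show "vge (of_int (- 1296)) 8" by (rule vge_intI[of 4]) simp_all
  show "vge (of_int 22464) 6" by (rule vge_intI[of 3]) simp_all
  show "vge (of_int (- 69120)) 6" by (rule vge_intI[of 3]) simp_all
  show "vge (of_int (- 3)) 2" by (rule vge_intI[of 1]) simp_all
  show "vge (of_int (- 216)) 6" by (rule vge_intI[of 3]) simp_all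
  show "veq (of_int 1872) 4" by (rule veq_intI[of _ 2 208]) simp_all
  show "vge (of_int (- 6)) 2" by (rule vge_intI[of 1]) simp_all
  show "vge (of_int (- 1080)) 6" by (rule vge_intI[of 3]) simp_all
  show "vge (of_int 37440) 4" by (rule vge_intI[of 2]) simp_all
  show "vge (of_int (- 345600)) 6" by (rule vge_intI[of 3]) simp_all
  show "vge (of_int 2032128) 8" by (rule vge_intI[of 4]) simp_all
  show "veq (of_int (- 13105152)) 8" by (rule veq_intI[of _ 4 "- 161792"]) simp_all
qed

lemma psi3_root: "psi3 x = 0 \<Longrightarrow> y ^ 2 = F x \<Longrightarrow> x = 4 \<and> (y = 32 \<or> y = - 32)"
proof -
  assume x: "psi3 x = 0" and y: "y ^ 2 = F x"
  have "psi3 x = 3 * ((x - 4) * (x ^ 3 - 432 * x + 5760))"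
    unfolding psi3_def by (simp add: abc algebra_simps eval_nat_numeral)
  then have x4: "x = 4" using x no_root by simp
  then have "y ^ 2 = 32 ^ 2" using y by (simp add: abc)
  then show ?thesis using x4 by (simp only: power2_eq_iff)
qed

lemma psi3_valuation:
  "veq x n \<Longrightarrow> n \<le> 0 \<Longrightarrow> vge (psi3 x) (2 + 4 * n)" "veq x 1 \<Longrightarrow> vge (psi3 x) 5" "vge x 2 \<Longrightarrow> vge (psi3 x) 6"
proof -
  have monom: "vge (psi3 x) m" if x: "vge x n" and m: "m \<le> 2 + 4 * n" "m \<le> 2 + 3 * n" "m \<le> 8 + 2 * n"
    "m \<le> 6 + n" "m \<le> 6" for x n m
    unfolding psi3_eq using m
    by (intro vge_add vge_monom[OF coeff_valuations(1) x] vge_monom[OF coeff_valuations(2) x] vge_monom[OF coeff_valuations(3) x]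
        vge_monom[OF coeff_valuations(4) x] vge_mono[OF coeff_valuations(5)]) auto
  show "veq x n \<Longrightarrow> n \<le> 0 \<Longrightarrow> vge (psi3 x) (2 + 4 * n)" using monom[of x n "2 + 4 * n"] veq_vge by auto
  show "veq x 1 \<Longrightarrow> vge (psi3 x) 5" using monom[of x 1 5] veq_vge by auto
  show "vge x 2 \<Longrightarrow> vge (psi3 x) 6" using monom[of x 2 6] by auto
qed

lemma F_h6_valuation:
  "veq x 1 \<Longrightarrow> veq (F x * h6 x) 9" "vge x 2 \<Longrightarrow> veq (F x * h6 x) 12"
proof -
  have monom: "vge (of_int (- 3) * x ^ 2 + of_int (- 216) * x ^ 1) (2 + 2 * n)"
    "vge (of_int (- 6) * x ^ 5 + of_int (- 1080) * x ^ 4 + of_int 37440 * x ^ 3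
     + of_int (- 345600) * x ^ 2 + of_int 2032128 * x ^ 1) (min (min (2 + 5 * n) (4 + 3 * n)) (min (6 + 2 * n) (8 + n)))"
    if x: "vge x n" and n: "0 \<le> n" "n \<le> 4" for x n
    using n by (intro vge_add vge_monom[OF coeff_valuations(6) x] vge_monom[OF coeff_valuations(7) x] vge_monom[OF coeff_valuations(9) x]
      vge_monom[OF coeff_valuations(10) x] vge_monom[OF coeff_valuations(11) x] vge_monom[OF coeff_valuations(12) x]
      vge_monom[OF coeff_valuations(13) x]; auto)+
  show "veq (F x * h6 x) 9" if x: "veq x 1"
  proof (rule veq_mult)
    have vx: "vge x 1" using x veq_vge by blast
    show "veq (F x) 3" unfolding F_eq
      using monom(1)[OF vx]
      by (intro veq_add[OF veq_add[OF veq_power[OF x]] veq_vge[OF coeff_valuations(8) order_refl]]) auto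
    show "veq (h6 x) 6" unfolding h6_eq
      using monom(2)[OF vx]
      by (intro veq_add[OF veq_add[OF veq_power[OF x]] veq_vge[OF coeff_valuations(14) order_refl]]) auto
  qed simp
  show "veq (F x * h6 x) 12" if x: "vge x 2"
  proof (rule veq_mult)
    show "veq (F x) 4" unfolding F_eq
      using monom(1)[OF x] by (intro veq_add'[OF vge_add[OF vge_power[OF x]] coeff_valuations(8)]) auto
    show "veq (h6 x) 8" unfolding h6_eq
      using monom(2)[OF x] by (intro veq_add'[OF vge_add[OF vge_power[OF x]] coeff_valuations(14)]) auto
  qed simp
qed

text \<open>For v(x) <= 0 this is \<open>triple_valuation\<close> with e = 1. For v(x) = 1 the
  valuation of the quotient is at most 9 - 2 * 5, and for v(x) >= 2 it is at most 12 - 2 *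
  6.\<close>

lemma triple_not_vge:
  assumes nz: "psi3 x \<noteq> 0"
  shows "\<not> vge (phi3 x / psi3 x ^ 2) 1"
proof -
  obtain m where m: "veq (phi3 x / psi3 x ^ 2) m" "m \<le> 0"
  proof -
    have quot: "\<exists>m \<le> 0. veq (phi3 x / psi3 x ^ 2) m"
      if F: "veq (F x * h6 x) j" and x: "vge x i" and psi: "vge (psi3 x) k" and j: "j < i + 2 * k" "j \<le> 2 * k" for i j k
    proof -
      have "veq (8 * (F x * h6 x)) j" using veq_mult[OF v8 F] by simp
      moreover have "vge (x * psi3 x ^ 2) (i + 2 * k)" by (rule vge_monom[OF x psi]) simp
      ultimately have "veq (- (8 * (F x * h6 x)) + x * psi3 x ^ 2) j" using j by (intro veq_add) auto
      then have num: "veq (phi3 x) j" by (simp only: phi3_def mult.assoc uminus_add_conv_diff)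
      obtain l where l: "veq (psi3 x) l" "l \<ge> k" using nz psi by (auto simp: vge_def veq_def)
      have "veq (phi3 x / psi3 x ^ 2) (j - 2 * l)" using l by (intro veq_divide[OF num veq_power]) auto
      then show ?thesis using j l(2) by (intro exI[of _ "j - 2 * l"]) simp
    qed
    consider n where "veq x n" "n \<le> 0" | "veq x 1" | "vge x 2" by (cases "x = 0"; cases "v x \<le> 0"; cases "v x = 1") (auto simp: veq_def vge_def)
    then have "\<exists>m \<le> 0. veq (phi3 x / psi3 x ^ 2) m"
    proof cases
      case (1 n)
      have "vge a 1" "vge b 1" "vge c 1"
        using coeff_valuations(6,7)[THEN vge_mono, of 1] coeff_valuations(8)[THEN veq_vge, of 1] by (simp_all add: abc)
      then obtain m where m: "m \<le> n - 4" "veq (phi3 x / psi3 x ^ 2) m"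
        using triple_valuation[of 1 x n] psi3_valuation(1)[OF 1] nz 1 by auto
      then show ?thesis using 1(2) by (intro exI[of _ m]) simp
    next
      case 2
      then show ?thesis using quot[OF F_h6_valuation(1)[OF 2] veq_vge[OF 2 order_refl] psi3_valuation(2)[OF 2]] by simp
    next
      case 3
      then show ?thesis using quot[OF F_h6_valuation(2)[OF 3] 3 psi3_valuation(3)[OF 3]] by simp
    qed
    then show thesis using that by blast
  qed
  then show ?thesis using vge_veq_unique by fastforce
qed

lemma psi3_zero_order_3:
  assumes "psi3 x = 0" "y ^ 2 = F x"
  shows "Affine x y [^]\<^bsub>G\<^esub> (3::nat) = Point_At_Infinity"
proof -
  have "Affine x y = Affine 4 32 \<or> Affine x y = Affine 4 (- 32)" using psi3_root[OF assms] by auto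
  then show ?thesis using pow_3[of "Affine 4 32"] pow_3[of "Affine 4 (- 32)"] by (auto simp: abc Let_def)
qed

lemma order_3:
  assumes "on_curve E R" "R [^]\<^bsub>G\<^esub> (3::nat) = Point_At_Infinity"
  shows "R = Point_At_Infinity \<or> R = Affine 4 32 \<or> R = Affine 4 (- 32)"
proof (cases R)
  case (Affine x y)
  then show ?thesis using pow_3_eq_infinity[of x y] psi3_root[of x y] assms by auto
qed simp

lemma triple_cases:
  assumes R: "on_curve E R" "R [^]\<^bsub>G\<^esub> (3::nat) \<noteq> Point_At_Infinity"
  obtains x y where "R [^]\<^bsub>G\<^esub> (3::nat) = Affine x y" "\<not> vge x 1"
proof (cases R)
  case Point_At_Infinity
  then show thesis using R(2) by (simp add: pow_3)
next
  case (Affine x y)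
  have on: "y ^ 2 = F x" using R(1) Affine by simp
  have "psi3 x \<noteq> 0"
  proof
    assume "psi3 x = 0"
    then show False using psi3_zero_order_3[OF _ on] R(2) Affine by simp
  qed
  then show thesis using that triple[OF on] triple_not_vge pow_3[OF R(1)] Affine by metis
qed

text \<open>The descent gives every such point v(x) >= 1, but three times a nonzero one is again
  such a point and contradicts \<open>triple_not_vge\<close>.\<close>

lemma no_cotorsion: "cotorsion 3 R \<Longrightarrow> R = Point_At_Infinity"
proof (rule ccontr)
  assume R: "cotorsion 3 R" "R \<noteq> Point_At_Infinity"
  have nz: "psi3 x \<noteq> 0" if T: "cotorsion 3 (Affine x y)" for x y
    using psi3_zero_order_3[of x y] cotorsion_on[OF T] cotorsion_pow_eq_infinity[OF T] by auto
  have "vge a 1" "vge b 1" "vge c 1"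
    using coeff_valuations(6,7)[THEN vge_mono, of 1] coeff_valuations(8)[THEN veq_vge, of 1] by (simp_all add: abc)
  then have x: "vge x 1" if "cotorsion 3 (Affine x y)" for x y
    using triple_descent[OF _ _ _ _ _ nz _ that, of 1] psi3_valuation(1) by simp
  have "R [^]\<^bsub>G\<^esub> (3::nat) \<noteq> Point_At_Infinity" using cotorsion_pow_eq_infinity R by blast
  then obtain x y where "R [^]\<^bsub>G\<^esub> (3::nat) = Affine x y" "\<not> vge x 1"
    using triple_cases cotorsion_on[OF R(1)] by blast
  then show False using x cotorsion_pow[OF R(1), of 3] by simp
qed

end

lemma appears_9:
  assumes K: "quadratic_field TYPE('k::field_char_0)"
  shows "appears_as_torsion_group TYPE('k) (integer_mod_group 9)"
proof -
  obtain v :: "'k \<Rightarrow> int" where "quadratic_valuation 3 v"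
    using exists_quadratic_valuation[OF K, of 3] by auto
  then interpret quadratic_valuation 3 v .
  have d7: "\<forall>r\<in>set [0..7 - 1]. \<not> (7::int) dvd r ^ 3 + 0 * r ^ 2 + (- 432) * r + 5760"
    by code_simp
  interpret curve_with_9_torsion v "- 3" "- 216" 1872
  proof unfold_locales
    show "x ^ 3 - 432 * x + 5760 \<noteq> 0" for x :: 'k using no_cubic_root[OF K d7, of x] by simp
    show "vge (- 3) 0" "vge (- 216) 0" using vge_int[of "- 3"] vge_int[of "- 216"] by simp_all
  qed (simp_all add: Let_def)
  define P where "P = Affine (- 12) (48 :: 'k)"
  have on: "on_curve E P" by (simp add: P_def)
  have P0: "P \<noteq> Point_At_Infinity" by (simp add: P_def)
  have m: "multiples P P [Affine 36 (- 192), Affine 4 32, Affine 12 (- 24), Affine 12 24, Affine 4 (- 32),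
    Affine 36 192, Affine (- 12) (- 48)]"
    by (simp add: P_def Let_def)
  note mem = multiples_ord(2)[OF on P0 m] gen2_mem[OF on, of Point_At_Infinity]
  have three: "prime (3::nat)" by simp
  have "torsion_subgroup G \<cong> integer_mod_group 9"
  proof (rule cyclic_torsion[OF on _ _ three])
    show "grp.ord P = 9" "(0::nat) < 9" using multiples_ord(1)[OF on P0 m] by simp_all
    show "R \<in> grp.gen2 P Point_At_Infinity" if "cotorsion 3 R" for R
      using no_cotorsion[OF that] mem by simp
    show "R \<in> grp.gen2 P Point_At_Infinity"
      if "on_curve E R" "R [^]\<^bsub>G\<^esub> (3::nat) = Point_At_Infinity" for R
      using order_3[OF that] mem by auto
    \<comment> \<open>The abscissa -12 of P is divisible by 3, unlike that of any triple.\<close>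
    have "R [^]\<^bsub>G\<^esub> (3::nat) \<noteq> P" if R: "on_curve E R" for R
    proof
      assume eq: "R [^]\<^bsub>G\<^esub> (3::nat) = P"
      then obtain x y where "P = Affine x y" "\<not> vge x 1" using triple_cases[OF R] P0 by metis
      then show False using vge_intI[of 1 "- 12" 1] by (simp add: P_def)
    qed
    then show "(\<forall>R. on_curve E R \<longrightarrow> R [^]\<^bsub>G\<^esub> (3::nat) \<noteq> P) \<or>
      (\<forall>R. on_curve E R \<longrightarrow> R [^]\<^bsub>G\<^esub> (3::nat) = Point_At_Infinity \<longrightarrow> R = Point_At_Infinity)"
      by blast
  qed
  then show ?thesis by (rule appears_of_iso)
qed

theorem mainTheorem1:
  assumes "quadratic_field TYPE('k::field_char_0)"
  shows "(\<forall>n \<in> {1, 2, 3, 4, 5, 6, 7, 8, 9, 10, 12}.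
            appears_as_torsion_group TYPE('k) (integer_mod_group n)) \<and>
         (\<forall>n \<in> {1, 2, 3, 4}.
            appears_as_torsion_group TYPE('k) (integer_mod_group 2 \<times>\<times> integer_mod_group (2 * n)))"
  using appears_1[OF assms] appears_2[OF assms] appears_3[OF assms] appears_4[OF assms] appears_5[OF assms]
    appears_6[OF assms] appears_7[OF assms] appears_8[OF assms] appears_9[OF assms] appears_10[OF assms]
    appears_12[OF assms] appears_2_2[OF assms] appears_2_4[OF assms] appears_2_6[OF assms] appears_2_8[OF assms]
  by (simp only: ball_simps)

end
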